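(* Let $\Omega\subset\mathbb{R}^n$ be any bounded Lipschitz domain. Let $u$ and $v$ be $C^2_0(\mathbb{R}^n)$ functions. Then $$\lim_{s\to1}\int_{\mathbb{R}^n\setminus\Omega}\mathcal{N}_su\,v=\int_{\partial\Omega}\frac{\partial u}{\partial\nu}\,v,$$ where $\nu$ is the exterior unit normal to $\partial\Omega$ and the limit is taken over $s\in(0,1)$.
   Context: $C^2_0(\mathbb{R}^n)$ denotes the $C^2$ functions with compact support. For $s\in(0,1)$, $$\mathcal{N}_su(x)=c_{n,s}\int_\Omega\frac{u(x)-u(y)}{|x-y|^{n+2s}}\,dy,\qquad x\in\mathbb{R}^n\setminus\overline{\Omega},$$ where $c_{n,s}=\left(\int_{\mathbb{R}^n}\frac{1-\cos\zeta_1}{|\zeta|^{n+2s}}\,d\zeta\right)^{-1}$ is the normalization constant for which the fractional Laplacian $(-\Delta)^su(x)=c_{n,s}\,\mathrm{PV}\int_{\mathbb{R}^n}\frac{u(x)-u(y)}{|x-y|^{n+2s}}\,dy$ has Fourier symbol $|\xi|^{2s}$. *)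

theory Defs
  imports "HOL-Analysis.Analysis"
begin

definition gradient :: "('a::real_inner \<Rightarrow> real) \<Rightarrow> 'a \<Rightarrow> 'a" where
  "gradient f x = (SOME D. GDERIV f x :> D)"

definition C2_compact_support :: "('a::euclidean_space \<Rightarrow> real) \<Rightarrow> bool" where
  "C2_compact_support u \<longleftrightarrow>
     (\<exists>(G :: 'a \<Rightarrow> 'a) (H :: 'a \<Rightarrow> 'a \<Rightarrow>\<^sub>L 'a).
        (\<forall>x. GDERIV u x :> G x) \<and>
        (\<forall>x. (G has_derivative blinfun_apply (H x)) (at x)) \<and>
        continuous_on UNIV H) \<and>
     compact (closure {x. u x \<noteq> 0})"

text \<open>
  Near a boundary point the set is the open epigraph, in the direction of a unit vector e,
  of a Lipschitz function of the n - 1 variables orthogonal to e. Such a function is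
  represented as a function on the whole space that is constant in the direction e, so that
  e may be any unit vector and no rotation of the coordinates is needed. Its gradient is
  then orthogonal to e and is the usual gradient in the n - 1 variables.
\<close>

definition lipschitz_chart ::
    "'a::euclidean_space set \<Rightarrow> 'a set \<Rightarrow> 'a \<Rightarrow> ('a \<Rightarrow> real) \<Rightarrow> bool" where
  "lipschitz_chart \<Omega> U e \<phi> \<longleftrightarrow>
     open U \<and> norm e = 1 \<and>
     (\<exists>L. L-lipschitz_on UNIV \<phi>) \<and> (\<forall>x t. \<phi> (x + t *\<^sub>R e) = \<phi> x) \<and>
     \<Omega> \<inter> U = {x \<in> U. \<phi> x < x \<bullet> e}"

definition bounded_lipschitz_domain :: "'a::euclidean_space set \<Rightarrow> bool" where
  "bounded_lipschitz_domain \<Omega> \<longleftrightarrow>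
     open \<Omega> \<and> connected \<Omega> \<and> \<Omega> \<noteq> {} \<and> bounded \<Omega> \<and>
     (\<forall>x \<in> frontier \<Omega>. \<exists>U e \<phi>. x \<in> U \<and> lipschitz_chart \<Omega> U e \<phi>)"

text \<open>
  (n - 1)-dimensional Lebesgue measure on the hyperplane through 0 orthogonal to the unit
  vector e: by Fubini, the measure of a subset A of the hyperplane is the n-dimensional
  measure of the cylinder of height 1 over A. For n = 1 this is the unit mass at 0.
\<close>

definition hyperplane_lebesgue :: "'a::euclidean_space \<Rightarrow> 'a measure" where
  "hyperplane_lebesgue e =
     distr (restrict_space lborel {x. 0 \<le> x \<bullet> e \<and> x \<bullet> e \<le> 1}) borel
       (\<lambda>x. x - (x \<bullet> e) *\<^sub>R e)"

text \<open>
  The surface element of a Lipschitz graph. By Rademacher's theorem the set where the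
  gradient does not exist is negligible; on that set \<^const>\<open>gradient\<close> is constant.
\<close>

definition graph_measure :: "'a::euclidean_space \<Rightarrow> ('a \<Rightarrow> real) \<Rightarrow> 'a measure" where
  "graph_measure e \<phi> =
     distr (density (hyperplane_lebesgue e)
              (\<lambda>y. ennreal (sqrt (1 + (norm (gradient \<phi> y))\<^sup>2))))
       borel (\<lambda>y. y + \<phi> y *\<^sub>R e)"

text \<open>
  The surface measure of a Lipschitz domain is the unique Borel measure, concentrated on the
  boundary, that is given by the surface element in every local graph representation.
\<close>

definition is_surface_measure :: "'a::euclidean_space set \<Rightarrow> 'a measure \<Rightarrow> bool" where
  "is_surface_measure \<Omega> \<sigma> \<longleftrightarrow>
     sets \<sigma> = sets borel \<and> emeasure \<sigma> (- frontier \<Omega>) = 0 \<and>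
     (\<forall>U e \<phi> A. lipschitz_chart \<Omega> U e \<phi> \<and> A \<in> sets borel \<and> A \<subseteq> U \<inter> frontier \<Omega> \<longrightarrow>
        emeasure \<sigma> A = emeasure (graph_measure e \<phi>) A)"

definition surface_measure :: "'a::euclidean_space set \<Rightarrow> 'a measure" where
  "surface_measure \<Omega> = (THE \<sigma>. is_surface_measure \<Omega> \<sigma>)"

text \<open>
  The exterior unit normal exists at almost every boundary point, namely where the function
  of a chart is differentiable, and does not depend on the chart. The domain lies above the
  graph, so the exterior normal has a negative component along e.
\<close>

definition is_exterior_normal :: "'a::euclidean_space set \<Rightarrow> 'a \<Rightarrow> 'a \<Rightarrow> bool" where
  "is_exterior_normal \<Omega> x \<nu> \<longleftrightarrow>
     (\<exists>U e \<phi> D. lipschitz_chart \<Omega> U e \<phi> \<and> x \<in> U \<inter> frontier \<Omega> \<and> GDERIV \<phi> x :> D \<and>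
        \<nu> = (D - e) /\<^sub>R sqrt (1 + (norm D)\<^sup>2))"

definition exterior_normal :: "'a::euclidean_space set \<Rightarrow> 'a \<Rightarrow> 'a" where
  "exterior_normal \<Omega> x = (THE \<nu>. is_exterior_normal \<Omega> x \<nu>)"

definition normal_derivative ::
    "'a::euclidean_space set \<Rightarrow> ('a \<Rightarrow> real) \<Rightarrow> 'a \<Rightarrow> real" where
  "normal_derivative \<Omega> u x = gradient u x \<bullet> exterior_normal \<Omega> x"

text \<open>
  The index k plays the role of the first coordinate; the index type has no distinguished
  element. By symmetry the value does not depend on k.
\<close>

definition frac_laplace_const :: "'n::finite \<Rightarrow> real \<Rightarrow> real" where
  "frac_laplace_const k s =
     inverse (LINT \<zeta>|lborel. (1 - cos ((\<zeta> :: real ^ 'n) $ k)) /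
                norm \<zeta> powr (real CARD('n) + 2 * s))"

definition nonlocal_normal_derivative ::
    "'n::finite \<Rightarrow> (real ^ 'n) set \<Rightarrow> real \<Rightarrow> (real ^ 'n \<Rightarrow> real) \<Rightarrow> real ^ 'n \<Rightarrow> real" where
  "nonlocal_normal_derivative k \<Omega> s u x =
     frac_laplace_const k s *
     (LINT y:\<Omega>|lborel. (u x - u y) / norm (x - y) powr (real CARD('n) + 2 * s))"

end

(*
  Substituting z = x - y turns the left-hand side into c(n,s) times the integral of h(z) |z|^(-n-2s),
  where h(z) integrates v(x) (u(x) - u(x-z)) over the x outside the domain with x - z inside.  Since the
  set of these x has measure O(|z|), h(z) = O(|z|^2) and everything converges absolutely.  Adding h(-z)
  replaces the two indicators by a difference of translates of one indicator, so that
    h(z) + h(-z) = integral over Omega of (W(x+z) - W(x)) . z + o(|z|^2)   with W = v grad u.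
  This is a quadratic form in z up to o(|z|^2).  As s -> 1 the normalised kernel concentrates at 0 and, by
  its symmetry, picks out the trace of the form, which is the integral of div W over Omega; the constant
  c(n,s) has the same asymptotics because 1 - cos z_k is z_k^2/2 near 0.

  It remains to prove the divergence theorem on Omega.  In a chart, the derivative of the volume above the
  graph under translations is computed by Fubini along the direction of the chart, dominated convergence
  and Rademacher's theorem (which follows on lines from the Vitali covering theorem and the Hahn
  decomposition, and in general from Fubini's theorem).  The resulting identity says that
  - grad 1_Omega is the normal times the graph measure.  The left-hand side does not depend on the chart,
  and neither does its total variation, so the graph measures agree on overlaps of charts: this replaces
  the area formula and gives existence and uniqueness of the surface measure.
*)
theory Submission
  imports Defs
begin

section \<open>Differentiability of Lipschitz functions on the line\<close>

text \<open>Symmetrising is forced by the shape of h. To leading order, h(z) is the boundary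
  integral of v (grad u . z) times the positive part of z . \<nu>, which is not a quadratic form in
  z; in h(z) + h(-z) the positive and negative parts recombine to z . \<nu> itself.
  \<open>surface_measure\<close> and \<open>exterior_normal\<close> are definite descriptions, so
  their well-posedness belongs to the proof. The normal must moreover be Borel on the whole
  boundary, including the points where a chart function has no gradient. A description of the normal
  by cones inside and outside \<Omega> settles this: it makes differentiability of the chart
  function at a boundary point a property of \<Omega> alone, so all charts share the normal and also
  its default value. No coordinates are adapted to a chart: integrals over the hyperplane orthogonal
  to e are written as integrals over the slab 0 \<le> x . e \<le> 1 of functions that are constant
  along e.\<close>

text \<open>Disjoint Vitali balls on which \<mu> is at least e times the volume fit into an open set
  around S of small \<mu>-mass, so their total volume is small as well. This is how each half of a
  Hahn decomposition becomes invisible from almost every point of the other half.\<close>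

lemma negligible_positive_upper_density:
  fixes \<mu> :: "'a::euclidean_space measure"
  assumes sets: "sets \<mu> = sets borel" and fin: "emeasure \<mu> (space \<mu>) \<noteq> \<infinity>"
    and S: "S \<in> sets borel" "emeasure \<mu> S = 0" and e: "e > (0::real)"
  shows "negligible {x \<in> S. \<forall>d>0. \<exists>r. 0 < r \<and> r < d \<and>
           ennreal e * emeasure lborel (ball x r) \<le> emeasure \<mu> (ball x r)}"
    (is "negligible ?T")
  unfolding negligible_outer_le
proof (intro allI impI)
  fix \<eta> :: real assume "\<eta> > 0"
  have "(INF U\<in>{U. S \<subseteq> U \<and> open U}. emeasure \<mu> U) = 0"
    using outer_regular[OF sets fin S(1)] S(2) by simp
  \<comment> \<open>The bound e * \<eta> becomes \<eta> once the comparison of \<mu> with e times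
    the volume is divided by e.\<close>
  then have "(INF U\<in>{U. S \<subseteq> U \<and> open U}. emeasure \<mu> U) < ennreal (e * \<eta>)"
    using \<open>\<eta> > 0\<close> e by simp
  then have "\<exists>U\<in>{U. S \<subseteq> U \<and> open U}. emeasure \<mu> U < ennreal (e * \<eta>)"
    by (simp only: INF_less_iff)
  then obtain U where U: "S \<subseteq> U" "open U" "emeasure \<mu> U < ennreal (e * \<eta>)"
    by auto
  define K where "K = {(x, r). x \<in> ?T \<and> 0 < r \<and> ball x r \<subseteq> U \<and>
      ennreal e * emeasure lborel (ball x r) \<le> emeasure \<mu> (ball x r)}"
  have cov: "\<exists>i. i \<in> K \<and> x \<in> ball (fst i) (snd i) \<and> snd i < d" if x: "x \<in> ?T" and "d > 0" for x d
  proof -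
    have "x \<in> U" using U(1) x by blast
    then obtain d' where d': "d' > 0" "ball x d' \<subseteq> U"
      using U(2) open_contains_ball by blast
    from x obtain r where r: "0 < r" "r < min d d'"
        "ennreal e * emeasure lborel (ball x r) \<le> emeasure \<mu> (ball x r)"
      using \<open>d > 0\<close> \<open>d' > 0\<close> unfolding mem_Collect_eq by (metis min_less_iff_conj)
    have "ball x r \<subseteq> U"
      using r d' subset_ball[of r d' x] by auto
    with r x have "(x, r) \<in> K"
      unfolding K_def by blast
    with r show ?thesis
      by (intro exI[of _ "(x, r)"]) auto
  qed
  obtain C where C: "countable C" "C \<subseteq> K"
      "pairwise (\<lambda>i j. disjnt (ball (fst i) (snd i)) (ball (fst j) (snd j))) C"
      "negligible (?T - (\<Union>i\<in>C. ball (fst i) (snd i)))"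
    by (rule Vitali_covering_theorem_balls[of ?T K fst snd, OF cov])
  let ?V = "\<Union>i\<in>C. ball (fst i) (snd i)"
  have disj: "disjoint_family_on (\<lambda>i. ball (fst i) (snd i)) C"
    using C(3) unfolding disjoint_family_on_def pairwise_def disjnt_def by blast
  have "ennreal e * emeasure lborel ?V = (\<integral>\<^sup>+ i. ennreal e * emeasure lborel (ball (fst i) (snd i)) \<partial>count_space C)"
    using C(1) disj by (subst emeasure_UN_countable) (auto simp: nn_integral_cmult)
  also have "\<dots> \<le> (\<integral>\<^sup>+ i. emeasure \<mu> (ball (fst i) (snd i)) \<partial>count_space C)"
    using C(2) by (intro nn_integral_mono) (auto simp: K_def)
  also have "\<dots> = emeasure \<mu> ?V"
    using C(1) disj sets by (subst emeasure_UN_countable) auto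
  also have "\<dots> \<le> emeasure \<mu> U"
    using C(2) U(2) sets by (intro emeasure_mono) (fastforce simp: K_def)+
  also have "\<dots> \<le> ennreal e * ennreal \<eta>"
    using U(3) e \<open>\<eta> > 0\<close> by (simp add: ennreal_mult)
  finally have V: "emeasure lborel ?V \<le> ennreal \<eta>"
    using e by (subst (asm) ennreal_mult_le_mult_iff) auto
  then have "emeasure lebesgue ?V \<le> ennreal \<eta>"
    using open_UN[of C "\<lambda>i. ball (fst i) (snd i)"] by simp
  moreover have Vs: "?V \<in> sets lebesgue"
    using open_UN[of C "\<lambda>i. ball (fst i) (snd i)"] by (intro sets_completionI_sets) auto
  ultimately have Vm: "?V \<in> lmeasurable" and Vle: "measure lebesgue ?V \<le> \<eta>"
    using \<open>\<eta> > 0\<close> by (auto intro!: fmeasurableI enn2real_leI simp: measure_def order.strict_trans1)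
  have N: "?T - ?V \<in> null_sets lebesgue"
    using C(4) by (simp add: negligible_iff_null_sets)
  \<comment> \<open>The measurability of \<open>?T\<close> is not at hand; \<open>?T\<close> is
    covered by the balls together with a remainder that Vitali's theorem makes negligible.\<close>
  show "\<exists>T. ?T \<subseteq> T \<and> T \<in> lmeasurable \<and> measure lebesgue T \<le> \<eta>"
  proof (intro exI conjI)
    show "?V \<union> (?T - ?V) \<in> lmeasurable"
      using Vm N C(4) negligible_imp_measurable by (intro fmeasurable.Un)
    show "measure lebesgue (?V \<union> (?T - ?V)) \<le> \<eta>"
      using measure_Un_null_set[OF Vs N] Vle by simp
  qed blast
qed

text \<open>The Hahn decomposition of the Stieltjes measure of F against p times Lebesgue measure
  splits a bounded interval into Y, where F grows at rate at most p, and the rest, where it grows at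
  rate at least p. From almost every point of one half the other half has density zero, so the
  quotients at this point obey the bound of its own half up to e.\<close>

lemma negligible_monotone_quotient:
  fixes F :: "real \<Rightarrow> real"
  assumes F: "\<And>x y. x \<le> y \<Longrightarrow> F x \<le> F y" and cont: "continuous_on UNIV F" and p: "0 \<le> p"
  shows "negligible {x. \<not> ((\<forall>e>0. \<forall>\<^sub>F h in at 0. (F (x + h) - F x) / h \<le> p + e) \<or>
                            (\<forall>e>0. \<forall>\<^sub>F h in at 0. (F (x + h) - F x) / h \<ge> p - e))}"
    (is "negligible {x. \<not> (?U x \<or> ?L x)}")
proof -
  let ?\<mu> = "interval_measure F"
  have rc: "continuous (at_right a) F" for a
    using cont by (simp add: continuous_on_eq_continuous_at continuous_at_imp_continuous_at_within)
  have em: "emeasure ?\<mu> {a<..b} = ennreal (F b - F a)" if "a \<le> b" for a b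
    using that F rc by (intro emeasure_interval_measure_Ioc) auto
  have "negligible ({-real N<..<real N} \<inter> {x. \<not> (?U x \<or> ?L x)})" for N
  proof -
    let ?A = "{-real N<..<real N}"
    let ?M = "density lborel (\<lambda>_. ennreal p)"
    have "emeasure ?\<mu> ?A \<le> emeasure ?\<mu> {-real N<..real N}"
      by (intro emeasure_mono) auto
    also have "\<dots> < top" by (subst em) auto
    finally have \<mu>fin: "emeasure ?\<mu> ?A \<noteq> top" by simp
    have "emeasure ?M ?A \<noteq> top"
      by (simp add: emeasure_density nn_integral_cmult_indicator ennreal_mult_eq_top_iff)
    with \<mu>fin obtain Y where Y: "Y \<in> sets borel" "Y \<subseteq> ?A"
       "\<And>X. X \<in> sets borel \<Longrightarrow> X \<subseteq> Y \<Longrightarrow> emeasure ?\<mu> X \<le> emeasure ?M X"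
       "\<And>X. X \<in> sets borel \<Longrightarrow> X \<subseteq> ?A \<Longrightarrow> X \<inter> Y = {} \<Longrightarrow> emeasure ?M X \<le> emeasure ?\<mu> X"
      using unsigned_Hahn_decomposition[of ?\<mu> ?M ?A] by auto
    note [measurable] = Y(1)
    \<comment> \<open>The Stieltjes measure off Y and Lebesgue measure on Y: the masses that disturb
      the estimate at a point of Y and at a point of its complement, respectively.\<close>
    let ?\<mu>1 = "density ?\<mu> (indicator (?A - Y))" and ?\<mu>2 = "density lborel (indicator Y)"
    have M: "emeasure ?M X = ennreal p * emeasure lborel X" if "X \<in> sets borel" for X
      using that by (simp add: emeasure_density nn_integral_cmult_indicator)
    have e1: "emeasure ?\<mu>1 X = emeasure ?\<mu> ((?A - Y) \<inter> X)" if "X \<in> sets borel" for X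
      using that by (simp add: emeasure_density indicator_inter_arith[symmetric])
    have e2: "emeasure ?\<mu>2 X = emeasure lborel (Y \<inter> X)" if "X \<in> sets borel" for X
      using that by (simp add: emeasure_density indicator_inter_arith[symmetric])
    have "emeasure ?\<mu> (?A - Y) \<le> emeasure ?\<mu> ?A" "emeasure lborel Y \<le> emeasure lborel ?A"
      using Y(2) by (intro emeasure_mono; auto)+
    then have fin: "emeasure ?\<mu>1 (space ?\<mu>1) \<noteq> \<infinity>" "emeasure ?\<mu>2 (space ?\<mu>2) \<noteq> \<infinity>"
      using \<mu>fin by (auto simp: e1 e2 top_unique)
    let ?E1 = "\<lambda>n. {x \<in> Y. \<forall>d>0. \<exists>r. 0 < r \<and> r < d \<and>
             ennreal (1 / real (Suc n)) * emeasure lborel (ball x r) \<le> emeasure ?\<mu>1 (ball x r)}"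
    let ?E2 = "\<lambda>n. {x \<in> ?A - Y. \<forall>d>0. \<exists>r. 0 < r \<and> r < d \<and>
             ennreal (1 / real (Suc n)) * emeasure lborel (ball x r) \<le> emeasure ?\<mu>2 (ball x r)}"
    have zero: "(?A - Y) \<inter> Y = {}" by auto
    have "negligible (?E1 n)" for n
      using fin by (intro negligible_positive_upper_density) (auto simp: e1 zero)
    moreover have "negligible (?E2 n)" for n
      using fin by (intro negligible_positive_upper_density) (auto simp: e2)
    ultimately have neg: "negligible ((\<Union>n. ?E1 n) \<union> (\<Union>n. ?E2 n))"
      by (intro negligible_Un negligible_countable_Union) auto
    have quot: "(F (x + h) - F x) / h = (F (max x (x+h)) - F (min x (x+h))) / \<bar>h\<bar>" for x h
      by (cases "h < 0") (auto simp: max_def min_def minus_divide_left[symmetric] diff_divide_distrib)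
    have small: "\<exists>d>0. \<forall>r. 0 < r \<and> r < d \<longrightarrow> emeasure m (ball x r) \<le> ennreal (e * r)"
      if nE: "\<And>n. \<not> (\<forall>d>0. \<exists>r. 0 < r \<and> r < d \<and>
           ennreal (1 / real (Suc n)) * emeasure lborel (ball x r) \<le> emeasure m (ball x r))" and "e > 0"
      for x e :: real and m :: "real measure"
    proof -
      obtain n where n: "1 / real (Suc n) < e / 2"
        using \<open>e > 0\<close> by (metis nat_approx_posE half_gt_zero)
      obtain d where "d > 0" and d: "\<And>r. 0 < r \<Longrightarrow> r < d \<Longrightarrow>
         \<not> ennreal (1 / real (Suc n)) * emeasure lborel (ball x r) \<le> emeasure m (ball x r)"
        using nE[of n] by auto
      have "emeasure m (ball x r) \<le> ennreal (e * r)" if "0 < r" "r < d" for r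
      proof -
        have "emeasure m (ball x r) \<le> ennreal (1 / real (Suc n)) * emeasure lborel (ball x r)"
          using d[OF that] by simp
        also have "\<dots> = ennreal (1 / real (Suc n) * (2 * r))"
          using \<open>0 < r\<close> by (simp add: ball_eq_greaterThanLessThan ennreal_mult[symmetric] del: of_nat_Suc)
        also have "\<dots> \<le> ennreal (e * r)"
          using mult_right_mono[of "1 / real (Suc n)" "e / 2" "2 * r"] n \<open>0 < r\<close>
          by (intro ennreal_leI) simp
        finally show ?thesis .
      qed
      with \<open>d > 0\<close> show ?thesis by blast
    qed
    have inA: "\<exists>d>0. \<forall>h. \<bar>h\<bar> < d \<longrightarrow> {min x (x+h)<..max x (x+h)} \<subseteq> ?A" if "x \<in> ?A" for x
      using that by (intro exI[of _ "min (real N - x) (x + real N)"]) auto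
    \<comment> \<open>The interval may contain its endpoint at distance |h|, which the open ball of
      radius |h| misses. Hence the radius 2 |h| and the factors 1/2 in the densities below.\<close>
    have inb: "{min x (x+h)<..max x (x+h)} \<subseteq> ball x (2 * \<bar>h\<bar>)" if "h \<noteq> 0" for x h :: real
      using that by (auto simp: dist_real_def)
    have len: "emeasure lborel {min x (x+h)<..max x (x+h)} = ennreal \<bar>h\<bar>" for x h :: real
      by (auto simp: min_def max_def)
    have "?A \<inter> {x. \<not> (?U x \<or> ?L x)} \<subseteq> (\<Union>n. ?E1 n) \<union> (\<Union>n. ?E2 n)"
    proof (rule subsetI, rule ccontr)
      fix x assume x: "x \<in> ?A \<inter> {x. \<not> (?U x \<or> ?L x)}" and nx: "x \<notin> (\<Union>n. ?E1 n) \<union> (\<Union>n. ?E2 n)"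
      obtain d0 where d0: "d0 > 0" "\<And>h. \<bar>h\<bar> < d0 \<Longrightarrow> {min x (x+h)<..max x (x+h)} \<subseteq> ?A"
        using inA x by blast
      show False
      proof (cases "x \<in> Y")
        case True
        have "?U x"
        proof (intro allI impI)
          fix e :: real assume "e > 0"
          have "\<exists>d>0. \<forall>r. 0 < r \<and> r < d \<longrightarrow> emeasure ?\<mu>1 (ball x r) \<le> ennreal (e / 2 * r)"
          proof (rule small)
            show "\<not> (\<forall>d>0. \<exists>r. 0 < r \<and> r < d \<and>
             ennreal (1 / real (Suc n)) * emeasure lborel (ball x r) \<le> emeasure ?\<mu>1 (ball x r))" for n
              using nx True by blast
          qed (use \<open>e > 0\<close> in simp)
          then obtain d where d: "d > 0" "\<And>r. 0 < r \<Longrightarrow> r < d \<Longrightarrow> emeasure ?\<mu>1 (ball x r) \<le> ennreal (e / 2 * r)"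
            by blast
          have "(F (x + h) - F x) / h \<le> p + e" if h: "h \<noteq> 0" "\<bar>h\<bar> < min d0 (d / 2)" for h
          proof -
            let ?I = "{min x (x+h)<..max x (x+h)}"
            have "ennreal (F (max x (x+h)) - F (min x (x+h))) = emeasure ?\<mu> ?I"
              by (subst em) auto
            also have "?I = (?I \<inter> Y) \<union> ((?A - Y) \<inter> ?I)"
              using d0(2)[of h] h by auto
            also have "emeasure ?\<mu> \<dots> \<le> emeasure ?\<mu> (?I \<inter> Y) + emeasure ?\<mu> ((?A - Y) \<inter> ?I)"
              by (intro emeasure_subadditive) auto
            also have "\<dots> \<le> ennreal (p * \<bar>h\<bar>) + ennreal (e / 2 * (2 * \<bar>h\<bar>))"
            proof (rule add_mono)
              have "emeasure ?\<mu> (?I \<inter> Y) \<le> emeasure ?M (?I \<inter> Y)"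
                by (intro Y(3)) auto
              also have "\<dots> \<le> emeasure ?M ?I"
                by (intro emeasure_mono) auto
              also have "\<dots> = ennreal (p * \<bar>h\<bar>)"
                using p by (simp add: M len ennreal_mult)
              finally show "emeasure ?\<mu> (?I \<inter> Y) \<le> ennreal (p * \<bar>h\<bar>)" .
              have "emeasure ?\<mu> ((?A - Y) \<inter> ?I) \<le> emeasure ?\<mu> ((?A - Y) \<inter> ball x (2*\<bar>h\<bar>))"
                using inb[OF h(1)] by (intro emeasure_mono) auto
              also have "\<dots> \<le> ennreal (e / 2 * (2 * \<bar>h\<bar>))"
                using d(2)[of "2 * \<bar>h\<bar>"] h by (simp add: e1)
              finally show "emeasure ?\<mu> ((?A - Y) \<inter> ?I) \<le> ennreal (e / 2 * (2 * \<bar>h\<bar>))" .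
            qed
            also have "ennreal (p * \<bar>h\<bar>) + ennreal (e / 2 * (2 * \<bar>h\<bar>)) = ennreal ((p + e) * \<bar>h\<bar>)"
              using p \<open>e > 0\<close> by (simp add: ennreal_plus[symmetric] algebra_simps del: ennreal_plus)
            finally have "F (max x (x+h)) - F (min x (x+h)) \<le> (p + e) * \<bar>h\<bar>"
              using p \<open>e > 0\<close> by (subst (asm) ennreal_le_iff) auto
            then show ?thesis
              unfolding quot using h by (simp add: divide_le_eq)
          qed
          then show "\<forall>\<^sub>F h in at 0. (F (x + h) - F x) / h \<le> p + e"
            using d0(1) d(1) unfolding eventually_at by (intro exI[of _ "min d0 (d / 2)"]) auto
        qed
        with x show False by blast
      next
        case False
        have "?L x"
        proof (intro allI impI)
          fix e :: real assume "e > 0"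
          \<comment> \<open>This density gets multiplied by p later on; p + 1 instead of p in the
            denominator covers p = 0.\<close>
          have "\<exists>d>0. \<forall>r. 0 < r \<and> r < d \<longrightarrow> emeasure ?\<mu>2 (ball x r) \<le> ennreal (e / (2 * (p + 1)) * r)"
          proof (rule small)
            show "\<not> (\<forall>d>0. \<exists>r. 0 < r \<and> r < d \<and>
             ennreal (1 / real (Suc n)) * emeasure lborel (ball x r) \<le> emeasure ?\<mu>2 (ball x r))" for n
              using nx False x by blast
          qed (use \<open>e > 0\<close> p in simp)
          then obtain d where d: "d > 0" "\<And>r. 0 < r \<Longrightarrow> r < d \<Longrightarrow> emeasure ?\<mu>2 (ball x r) \<le> ennreal (e / (2 * (p + 1)) * r)"
            by blast
          have "(F (x + h) - F x) / h \<ge> p - e" if h: "h \<noteq> 0" "\<bar>h\<bar> < min d0 (d / 2)" for h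
          proof -
            let ?I = "{min x (x+h)<..max x (x+h)}"
            have 1: "emeasure lborel (Y \<inter> ball x (2*\<bar>h\<bar>)) \<le> ennreal (e / (2 * (p + 1)) * (2 * \<bar>h\<bar>))"
              using d(2)[of "2 * \<bar>h\<bar>"] h e2[of "ball x (2 * \<bar>h\<bar>)"] by simp
            have le: "p * (e / (2 * (p + 1)) * (2 * \<bar>h\<bar>)) \<le> e * \<bar>h\<bar>"
            proof -
              have "p * (e / (2 * (p + 1)) * (2 * \<bar>h\<bar>)) = (p / (p + 1)) * (e * \<bar>h\<bar>)"
                using p by (simp add: divide_simps)
              also have "\<dots> \<le> 1 * (e * \<bar>h\<bar>)"
                using p \<open>e > 0\<close> by (intro mult_right_mono) auto
              finally show ?thesis by simp
            qed
            have "ennreal (p * \<bar>h\<bar>) = emeasure ?M ?I"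
              using p by (simp add: M len ennreal_mult)
            also have "?I = (?I - Y) \<union> (Y \<inter> ?I)"
              by auto
            also have "emeasure ?M \<dots> \<le> emeasure ?M (?I - Y) + emeasure ?M (Y \<inter> ?I)"
              by (intro emeasure_subadditive) auto
            also have "\<dots> \<le> ennreal (F (max x (x + h)) - F (min x (x + h))) + ennreal (e * \<bar>h\<bar>)"
            proof (rule add_mono)
              have "emeasure ?M (?I - Y) \<le> emeasure ?\<mu> (?I - Y)"
                using d0(2)[of h] h by (intro Y(4)) auto
              also have "\<dots> \<le> emeasure ?\<mu> ?I"
                by (intro emeasure_mono) auto
              also have "\<dots> = ennreal (F (max x (x+h)) - F (min x (x+h)))"
                by (subst em) auto
              finally show "emeasure ?M (?I - Y) \<le> ennreal (F (max x (x+h)) - F (min x (x+h)))" .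
              have "emeasure ?M (Y \<inter> ?I) \<le> emeasure ?M (Y \<inter> ball x (2*\<bar>h\<bar>))"
                using inb[OF h(1)] by (intro emeasure_mono) auto
              also have "\<dots> \<le> ennreal p * ennreal (e / (2 * (p + 1)) * (2 * \<bar>h\<bar>))"
                using 1 by (auto simp: M intro: mult_left_mono)
              also have "\<dots> = ennreal (p * (e / (2 * (p + 1)) * (2 * \<bar>h\<bar>)))"
                using p \<open>e > 0\<close> by (intro ennreal_mult[symmetric]) auto
              also have "\<dots> \<le> ennreal (e * \<bar>h\<bar>)"
                using le by (rule ennreal_leI)
              finally show "emeasure ?M (Y \<inter> ?I) \<le> ennreal (e * \<bar>h\<bar>)" .
            qed
            also have "ennreal (F (max x (x + h)) - F (min x (x + h))) + ennreal (e * \<bar>h\<bar>) = 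
                ennreal (F (max x (x + h)) - F (min x (x + h)) + e * \<bar>h\<bar>)"
              using F[of "min x (x+h)" "max x (x+h)"] \<open>e > 0\<close> by (simp add: ennreal_plus[symmetric] del: ennreal_plus)
            finally have "p * \<bar>h\<bar> \<le> F (max x (x+h)) - F (min x (x+h)) + e * \<bar>h\<bar>"
              using F[of "min x (x+h)" "max x (x+h)"] \<open>e > 0\<close> by (subst (asm) ennreal_le_iff) auto
            then show ?thesis
              unfolding quot using h by (simp add: le_divide_eq algebra_simps)
          qed
          then show "\<forall>\<^sub>F h in at 0. (F (x + h) - F x) / h \<ge> p - e"
            using d0(1) d(1) unfolding eventually_at by (intro exI[of _ "min d0 (d / 2)"]) auto
        qed
        with x show False by blast
      qed
    qed
    with neg show ?thesis by (rule negligible_subset)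
  qed
  then have "negligible (\<Union>N. {-real N<..<real N} \<inter> {x. \<not> (?U x \<or> ?L x)})"
    by (intro negligible_countable_Union) auto
  moreover have "{x. \<not> (?U x \<or> ?L x)} \<subseteq> (\<Union>N. {-real N<..<real N} \<inter> {x. \<not> (?U x \<or> ?L x)})"
  proof
    fix x assume "x \<in> {x. \<not> (?U x \<or> ?L x)}"
    moreover obtain N :: nat where "\<bar>x\<bar> < real N" using reals_Archimedean2 by blast
    ultimately show "x \<in> (\<Union>N. {-real N<..<real N} \<inter> {x. \<not> (?U x \<or> ?L x)})"
      by (auto intro!: exI[of _ N])
  qed
  ultimately show ?thesis by (rule negligible_subset)
qed

text \<open>Outside countably many null sets, every nonnegative rational slope bounds the quotients
  from above or from below in the limit. The infimum of the upper slopes is then the derivative: a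
  smaller nonnegative rational is not an upper slope and hence a lower one.\<close>

lemma negligible_not_differentiable_mono:
  fixes F :: "real \<Rightarrow> real"
  assumes F: "\<And>x y. x \<le> y \<Longrightarrow> F x \<le> F y" and lip: "L-lipschitz_on UNIV F"
  shows "negligible {x. \<not> (\<exists>l. ((\<lambda>h. (F (x + h) - F x) / h) \<longlongrightarrow> l) (at 0))}"
proof -
  let ?U = "\<lambda>x p. \<forall>e>0. \<forall>\<^sub>F h in at 0. (F (x + h) - F x) / h \<le> p + e"
  let ?L = "\<lambda>x p. \<forall>e>0. \<forall>\<^sub>F h in at 0. (F (x + h) - F x) / h \<ge> p - e"
  let ?P = "{p \<in> \<rat>. 0 \<le> p}"
  have cont: "continuous_on UNIV F"
    using lip by (rule lipschitz_on_continuous_on)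
  have "negligible (\<Union>p\<in>?P. {x. \<not> (?U x p \<or> ?L x p)})"
    using negligible_monotone_quotient[OF F cont] countable_subset[OF _ countable_rat, of ?P]
    by (intro negligible_countable_Union) auto
  moreover have "{x. \<not> (\<exists>l. ((\<lambda>h. (F (x + h) - F x) / h) \<longlongrightarrow> l) (at 0))} \<subseteq> (\<Union>p\<in>?P. {x. \<not> (?U x p \<or> ?L x p)})"
  proof (rule subsetI, rule ccontr)
    fix x assume nd: "x \<in> {x. \<not> (\<exists>l. ((\<lambda>h. (F (x + h) - F x) / h) \<longlongrightarrow> l) (at 0))}"
      and "x \<notin> (\<Union>p\<in>?P. {x. \<not> (?U x p \<or> ?L x p)})"
    then have UL: "?U x p \<or> ?L x p" if "p \<in> ?P" for p
      using that by blast
    let ?Q = "\<lambda>h. (F (x + h) - F x) / h"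
    have Q: "0 \<le> ?Q h" "?Q h \<le> L" if "h \<noteq> 0" for h
    proof -
      show "0 \<le> ?Q h"
        using F[of x "x+h"] F[of "x+h" x] that by (cases "h > 0") (auto intro: divide_nonneg_pos divide_nonpos_neg)
      have "\<bar>F (x + h) - F x\<bar> \<le> L * \<bar>h\<bar>"
        using lipschitz_onD[OF lip, of "x+h" x] by (simp add: dist_real_def)
      then have "\<bar>?Q h\<bar> \<le> L"
        using that by (simp add: abs_divide divide_le_eq)
      then show "?Q h \<le> L" by linarith
    qed
    have L0: "0 \<le> L" using lip by (rule lipschitz_on_nonneg)
    define R where "R = {p \<in> ?P. ?U x p}"
    \<comment> \<open>A rational above the Lipschitz constant is an upper slope, so the infimum is
      taken over a nonempty set.\<close>
    obtain q where q: "q \<in> \<rat>" "L < q" "q < L + 1" using Rats_dense_in_real[of L "L+1"] by auto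
    have evn: "\<forall>\<^sub>F h::real in at 0. h \<noteq> 0" by (simp add: eventually_at_filter)
    have "?U x q"
    proof (intro allI impI)
      fix e :: real assume "e > 0"
      show "\<forall>\<^sub>F h in at 0. (F (x + h) - F x) / h \<le> q + e"
        using evn by eventually_elim (use Q(2) q \<open>e > 0\<close> in fastforce)
    qed
    with q L0 have "q \<in> R" unfolding R_def by auto
    then have Rne: "R \<noteq> {}" by blast
    have Rb: "bdd_below R" by (auto simp: R_def intro!: bdd_belowI[of _ 0])
    define l where "l = Inf R"
    have l0: "0 \<le> l" unfolding l_def using Rne by (intro cInf_greatest) (auto simp: R_def)
    have "(?Q \<longlongrightarrow> l) (at 0)"
    proof (rule order_tendstoI)
      fix a assume "a < l"
      show "\<forall>\<^sub>F h in at 0. a < ?Q h"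
      proof (cases "a < 0")
        case True
        show ?thesis using evn by eventually_elim (use Q(1) True in fastforce)
      next
        case False
        obtain p where p: "p \<in> \<rat>" "a < p" "p < l" using Rats_dense_in_real[OF \<open>a < l\<close>] by auto
        have "p \<notin> R" using p(3) Rb cInf_lower[of p R] by (auto simp: l_def)
        then have "?L x p" using UL[of p] p False by (auto simp: R_def)
        then have "\<forall>\<^sub>F h in at 0. ?Q h \<ge> p - (p - a) / 2" using p by simp
        moreover have "p - (p - a) / 2 > a" using p by (simp add: field_simps)
        ultimately show ?thesis by (auto elim: eventually_mono)
      qed
    next
      fix a assume "l < a"
      then obtain p where p: "p \<in> R" "p < a"
        unfolding l_def using Rne Rb cInf_less_iff by blast
      then have "?U x p" unfolding R_def by blast
      then have "\<forall>\<^sub>F h in at 0. ?Q h \<le> p + (a - p) / 2" using p by simp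
      moreover have "p + (a - p) / 2 < a" using p by (simp add: field_simps)
      ultimately show "\<forall>\<^sub>F h in at 0. ?Q h < a" by (auto elim: eventually_mono)
    qed
    with nd show False by blast
  qed
  ultimately show ?thesis by (rule negligible_subset)
qed

text \<open>Adding L x makes f nondecreasing, keeps it Lipschitz and shifts every derivative by
  L.\<close>

lemma negligible_not_differentiable_lipschitz_real:
  fixes f :: "real \<Rightarrow> real"
  assumes lip: "L-lipschitz_on UNIV f"
  shows "negligible {x. \<not> (\<exists>l. ((\<lambda>h. (f (x + h) - f x) / h) \<longlongrightarrow> l) (at 0))}"
proof -
  have ab: "\<bar>f y - f x\<bar> \<le> L * \<bar>y - x\<bar>" for x y
    using lipschitz_onD[OF lip, of y x] by (simp add: dist_real_def)
  let ?F = "\<lambda>x. f x + L * x"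
  have 1: "?F x \<le> ?F y" if "x \<le> y" for x y
    using ab[of y x] that by (simp add: algebra_simps)
  have L0: "0 \<le> L" using lip by (rule lipschitz_on_nonneg)
  have 2: "(L + L)-lipschitz_on UNIV ?F"
    using L0 by (intro lipschitz_on_add lip lipschitz_onI)
      (auto simp: dist_real_def abs_mult right_diff_distrib[symmetric])
  have "((\<lambda>h. (f (x + h) - f x) / h) \<longlongrightarrow> l - L) (at 0)"
    if "((\<lambda>h. (?F (x + h) - ?F x) / h) \<longlongrightarrow> l) (at 0)" for x l
  proof (rule Lim_transform_eventually)
    show "((\<lambda>h. (?F (x + h) - ?F x) / h - L) \<longlongrightarrow> l - L) (at 0)"
      using that by (intro tendsto_intros)
    show "\<forall>\<^sub>F h in at 0. (?F (x + h) - ?F x) / h - L = (f (x + h) - f x) / h"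
      by (auto simp: eventually_at_filter field_simps)
  qed
  then have "{x. \<not> (\<exists>l. ((\<lambda>h. (f (x + h) - f x) / h) \<longlongrightarrow> l) (at 0))} \<subseteq>
      {x. \<not> (\<exists>l. ((\<lambda>h. (?F (x + h) - ?F x) / h) \<longlongrightarrow> l) (at 0))}"
    by blast
  then show ?thesis
    using negligible_not_differentiable_mono[of ?F, OF 1 2] by (rule negligible_subset[rotated])
qed

section \<open>Rademacher's theorem\<close>

lemma lborel_distr_uminus_euclidean: "distr lborel borel uminus = (lborel :: 'a::euclidean_space measure)"
  using lborel_affine[of "-1" "0::'a"] by (simp add: density_1)

lemma nn_integral_lborel_translate:
  fixes f :: "'a::euclidean_space \<Rightarrow> ennreal"
  assumes [measurable]: "f \<in> borel_measurable borel"
  shows "(\<integral>\<^sup>+x. f (x + c) \<partial>lborel) = (\<integral>\<^sup>+x. f x \<partial>lborel)"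
proof -
  have "(\<integral>\<^sup>+x. f x \<partial>lborel) = (\<integral>\<^sup>+x. f x \<partial>distr lborel borel ((+) c))"
    by (simp only: lborel_distr_plus)
  also have "\<dots> = (\<integral>\<^sup>+x. f (c + x) \<partial>lborel)"
    by (intro nn_integral_distr) auto
  finally show ?thesis by (simp add: add.commute)
qed

lemma integral_lborel_translate:
  fixes f :: "'a::euclidean_space \<Rightarrow> real"
  assumes [measurable]: "f \<in> borel_measurable borel"
  shows "(\<integral>x. f (x + c) \<partial>lborel) = (\<integral>x. f x \<partial>lborel)"
proof -
  have "(\<integral>x. f x \<partial>lborel) = (\<integral>x. f x \<partial>distr lborel borel ((+) c))"
    by (simp only: lborel_distr_plus)
  also have "\<dots> = (\<integral>x. f (c + x) \<partial>lborel)"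
    by (intro integral_distr) auto
  finally show ?thesis by (simp add: add.commute)
qed

lemma integrable_lborel_translate:
  fixes f :: "'a::euclidean_space \<Rightarrow> real"
  assumes "integrable lborel f"
  shows "integrable lborel (\<lambda>x. f (x + c))"
proof -
  have "integrable (distr lborel borel ((+) c)) f"
    using assms by (simp only: lborel_distr_plus)
  then have "integrable lborel (\<lambda>x. f (c + x))"
    by (subst (asm) integrable_distr_eq) (use assms in auto)
  then show ?thesis by (simp add: add.commute)
qed

lemma integral_lborel_reflect:
  fixes f :: "'a::euclidean_space \<Rightarrow> real"
  assumes [measurable]: "f \<in> borel_measurable borel"
  shows "(\<integral>x. f (- x) \<partial>lborel) = (\<integral>x. f x \<partial>lborel)"
proof -
  have "(\<integral>x. f x \<partial>lborel) = (\<integral>x. f x \<partial>distr lborel borel uminus)"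
    by (simp only: lborel_distr_uminus_euclidean)
  also have "\<dots> = (\<integral>x. f (- x) \<partial>lborel)"
    by (intro integral_distr) auto
  finally show ?thesis by simp
qed

text \<open>Fubini along the lines parallel to an arbitrary direction d: every line spends unit time in the
  slab, so no rotation of the coordinates is needed.\<close>

lemma nn_integral_slab:
  fixes f :: "'a::euclidean_space \<Rightarrow> ennreal"
  assumes f[measurable]: "f \<in> borel_measurable borel" and d: "d \<noteq> 0"
  shows "(\<integral>\<^sup>+x. f x \<partial>lborel) =
    (\<integral>\<^sup>+x. indicator {x. 0 \<le> x \<bullet> d \<and> x \<bullet> d \<le> d \<bullet> d} x * (\<integral>\<^sup>+t. f (x + t *\<^sub>R d) \<partial>lborel) \<partial>lborel)"
proof -
  let ?S = "{x. 0 \<le> x \<bullet> d \<and> x \<bullet> d \<le> d \<bullet> d}"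
  have [measurable]: "?S \<in> sets borel" by measurable
  have unit: "(\<integral>\<^sup>+t. indicator ?S (x - t *\<^sub>R d) \<partial>lborel) = 1" for x
  proof -
    have dd: "d \<bullet> d > 0" using d by simp
    have "indicator ?S (x - t *\<^sub>R d) = (indicator {x \<bullet> d / (d \<bullet> d) - 1..x \<bullet> d / (d \<bullet> d)} t :: ennreal)" for t
      using dd by (auto simp: indicator_def inner_diff_left field_simps)
    then show ?thesis by simp
  qed
  have "(\<integral>\<^sup>+x. indicator ?S x * (\<integral>\<^sup>+t. f (x + t *\<^sub>R d) \<partial>lborel) \<partial>lborel) =
      (\<integral>\<^sup>+x. (\<integral>\<^sup>+t. indicator ?S x * f (x + t *\<^sub>R d) \<partial>lborel) \<partial>lborel)"
    by (intro nn_integral_cong nn_integral_cmult[symmetric]) auto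
  also have "\<dots> = (\<integral>\<^sup>+t. (\<integral>\<^sup>+x. indicator ?S x * f (x + t *\<^sub>R d) \<partial>lborel) \<partial>lborel)"
    by (intro lborel_pair.Fubini') measurable
  also have "\<dots> = (\<integral>\<^sup>+t. (\<integral>\<^sup>+x. indicator ?S (x - t *\<^sub>R d) * f x \<partial>lborel) \<partial>lborel)"
  proof (rule nn_integral_cong)
    fix t :: real
    show "(\<integral>\<^sup>+x. indicator ?S x * f (x + t *\<^sub>R d) \<partial>lborel) = (\<integral>\<^sup>+x. indicator ?S (x - t *\<^sub>R d) * f x \<partial>lborel)"
      using nn_integral_lborel_translate[of "\<lambda>x. indicator ?S (x - t *\<^sub>R d) * f x" "t *\<^sub>R d"] by simp
  qed
  also have "\<dots> = (\<integral>\<^sup>+x. (\<integral>\<^sup>+t. indicator ?S (x - t *\<^sub>R d) * f x \<partial>lborel) \<partial>lborel)"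
    by (intro lborel_pair.Fubini'[symmetric]) measurable
  also have "\<dots> = (\<integral>\<^sup>+x. f x \<partial>lborel)"
    by (intro nn_integral_cong) (simp add: nn_integral_multc unit)
  finally show ?thesis ..
qed

text \<open>The slab formula integrates the indicator of the exceptional set along the lines of
  direction d, where it contributes nothing. The set must be Borel for this, which is why the sets
  of differentiability are shown to be Borel below.\<close>

lemma AE_lborel_lines:
  fixes d :: "'a::euclidean_space"
  assumes [measurable]: "{x. P x} \<in> sets borel" and d: "d \<noteq> 0"
    and AE: "\<And>x. AE t in lborel. P (x + t *\<^sub>R d)"
  shows "AE x in lborel. P x"
proof -
  have [measurable]: "Measurable.pred borel P" by (simp add: pred_def)
  have "(\<integral>\<^sup>+x. indicator {x. \<not> P x} x \<partial>lborel) = 0"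
  proof (subst nn_integral_slab[OF _ d])
    have "(\<integral>\<^sup>+t. indicator {x. \<not> P x} (x + t *\<^sub>R d) \<partial>lborel) = 0" for x
      using AE[of x] by (subst nn_integral_0_iff_AE) (auto simp: indicator_def)
    then show "(\<integral>\<^sup>+x. indicator {x. 0 \<le> x \<bullet> d \<and> x \<bullet> d \<le> d \<bullet> d} x *
       (\<integral>\<^sup>+t. indicator {x. \<not> P x} (x + t *\<^sub>R d) \<partial>lborel) \<partial>lborel) = 0" by simp
  qed measurable
  then show ?thesis
    by (subst (asm) nn_integral_0_iff_AE) (auto simp: indicator_def)
qed

section \<open>Gradients and their Borel measurability\<close>

lemma GDERIV_iff_eps:
  fixes f :: "'a::euclidean_space \<Rightarrow> real"
  shows "GDERIV f x :> D \<longleftrightarrow> (\<forall>e>0. \<exists>\<delta>>0. \<forall>h. norm h < \<delta> \<longrightarrow> \<bar>f (x + h) - f x - h \<bullet> D\<bar> \<le> e * norm h)"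
  unfolding gderiv_def has_derivative_at_alt
proof (safe, goal_cases)
  case (1 e)
  then obtain \<delta> where "\<delta> > 0" "\<And>y. norm (y - x) < \<delta> \<Longrightarrow> norm (f y - f x - (y - x) \<bullet> D) \<le> e * norm (y - x)"
    by meson
  then show ?case
    by (intro exI[of _ \<delta>]) (metis add_diff_cancel_left' real_norm_def)
next
  case 2
  show ?case by (rule bounded_linear_inner_left)
next
  case (3 e)
  then obtain \<delta> where "\<delta> > 0" "\<And>h. norm h < \<delta> \<Longrightarrow> \<bar>f (x + h) - f x - h \<bullet> D\<bar> \<le> e * norm h"
    by meson
  then show ?case
    by (intro exI[of _ \<delta>]) (metis add.commute diff_add_cancel real_norm_def)
qed

lemma GDERIV_shift: "GDERIV f x :> D \<longleftrightarrow> GDERIV (\<lambda>h. f (x + h)) 0 :> (D::'a::euclidean_space)"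
  by (simp add: GDERIV_iff_eps)

lemma GDERIV_unique: "GDERIV f x :> D \<Longrightarrow> GDERIV f x :> E \<Longrightarrow> D = (E::'a::real_inner)"
proof -
  assume "GDERIV f x :> D" "GDERIV f x :> E"
  then have "(\<lambda>h. h \<bullet> D) = (\<lambda>h. h \<bullet> E)"
    unfolding gderiv_def by (rule has_derivative_unique)
  then have "(D - E) \<bullet> (D - E) = 0"
    by (metis inner_diff_right right_minus_eq)
  then show ?thesis by simp
qed

lemma gradient_eq: "GDERIV f x :> D \<Longrightarrow> gradient f x = (D::'a::real_inner)"
  unfolding gradient_def by (rule some_equality) (auto intro: GDERIV_unique)

lemma GDERIV_gradient: "GDERIV f x :> D \<Longrightarrow> GDERIV f x :> gradient f x"
  by (simp add: gradient_eq)

text \<open>A gradient exists iff for every n some q from a countable dense set approximates with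
  relative error 1 / (n + 1) on some ball of radius 1 / (m + 1). For fixed n, m, q this is an
  intersection of closed conditions on x. Conversely, the vectors q belonging to the various n form
  a Cauchy sequence, and its limit is the gradient. The parameter form covers gradients of \<phi> as
  well as derivatives along a line.\<close>

lemma sets_GDERIV_exists:
  fixes G :: "'b::topological_space \<Rightarrow> 'c::euclidean_space \<Rightarrow> real"
  assumes cont: "\<And>h. continuous_on UNIV (\<lambda>x. G x h)"
  shows "{x. \<exists>D. GDERIV (G x) 0 :> D} \<in> sets borel"
proof -
  obtain Q :: "'c set" where Q: "countable Q" "\<And>X. open X \<Longrightarrow> X \<noteq> {} \<Longrightarrow> \<exists>q\<in>Q. q \<in> X"
    using countable_dense_setE by auto
  define A where "A n m q = {x. \<forall>h. norm h < 1 / real (Suc m) \<longrightarrow> \<bar>G x h - G x 0 - h \<bullet> q\<bar> \<le> norm h / real (Suc n)}"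
    for n m q
  have "closed (A n m q)" for n m q
  proof -
    have "A n m q = (\<Inter>h\<in>{h. norm h < 1 / real (Suc m)}. {x. \<bar>G x h - G x 0 - h \<bullet> q\<bar> \<le> norm h / real (Suc n)})"
      by (auto simp: A_def)
    also have "closed \<dots>"
      by (intro closed_INT ballI closed_Collect_le continuous_intros cont)
    finally show ?thesis .
  qed
  then have "(\<Inter>n. \<Union>m. \<Union>q\<in>Q. A n m q) \<in> sets borel"
    using Q(1) by (intro sets.countable_INT'' sets.countable_UN'' borel_closed) auto
  also have "(\<Inter>n. \<Union>m. \<Union>q\<in>Q. A n m q) = {x. \<exists>D. GDERIV (G x) 0 :> D}"
  proof (intro subset_antisym subsetI)
    fix x assume "x \<in> {x. \<exists>D. GDERIV (G x) 0 :> D}"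
    then obtain D where D: "\<And>e. e > 0 \<Longrightarrow> \<exists>\<delta>>0. \<forall>h. norm h < \<delta> \<longrightarrow> \<bar>G x h - G x 0 - h \<bullet> D\<bar> \<le> e * norm h"
      by (auto simp: GDERIV_iff_eps)
    show "x \<in> (\<Inter>n. \<Union>m. \<Union>q\<in>Q. A n m q)"
    proof
      fix n
      let ?e = "1 / (2 * real (Suc n))"
      obtain \<delta> where \<delta>: "\<delta> > 0" "\<And>h. norm h < \<delta> \<Longrightarrow> \<bar>G x h - G x 0 - h \<bullet> D\<bar> \<le> ?e * norm h"
        using D[of ?e] by auto
      obtain m where m: "1 / real (Suc m) < \<delta>" using \<delta>(1) nat_approx_posE by blast
      obtain q where q: "q \<in> Q" "dist D q < ?e" using Q(2)[of "ball D ?e"] by auto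
      have "\<bar>G x h - G x 0 - h \<bullet> q\<bar> \<le> norm h / real (Suc n)" if "norm h < 1 / real (Suc m)" for h
      proof -
        have "\<bar>h \<bullet> (D - q)\<bar> \<le> norm h * norm (D - q)" by (rule Cauchy_Schwarz_ineq2)
        also have "\<dots> \<le> norm h * ?e" using q(2) by (intro mult_left_mono) (auto simp: dist_norm)
        finally have "\<bar>G x h - G x 0 - h \<bullet> q\<bar> \<le> ?e * norm h + norm h * ?e"
          using \<delta>(2)[of h] that m by (auto simp: inner_diff_right)
        also have "\<dots> = norm h / real (Suc n)" by (simp add: divide_simps)
        finally show ?thesis .
      qed
      then have "x \<in> A n m q" by (simp add: A_def)
      with q(1) show "x \<in> (\<Union>m. \<Union>q\<in>Q. A n m q)" by blast
    qed
  next
    fix x assume "x \<in> (\<Inter>n. \<Union>m. \<Union>q\<in>Q. A n m q)"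
    then have "\<forall>n. \<exists>m q. x \<in> A n m q" by blast
    then obtain m q where mq: "\<And>n. x \<in> A n (m n) (q n)" by metis
    have qd: "norm (q n - q k) \<le> 1 / real (Suc n) + 1 / real (Suc k)" for n k
    proof (cases "q n = q k")
      case False
      define w where "w = q n - q k"
      have w: "norm w > 0" using False by (simp add: w_def)
      \<comment> \<open>Both approximations are tested on w = q n - q k itself, scaled into the
        smaller of the two radii; this bounds the norm of w.\<close>
      define r where "r = min (1 / real (Suc (m n))) (1 / real (Suc (m k))) / (2 * norm w)"
      have r: "r > 0" using w by (auto simp: r_def)
      have rw: "norm (r *\<^sub>R w) = min (1 / real (Suc (m n))) (1 / real (Suc (m k))) / 2"
        using w by (simp add: r_def)
      also have "\<dots> < min (1 / real (Suc (m n))) (1 / real (Suc (m k)))"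
        by (simp add: min_def)
      finally have "norm (r *\<^sub>R w) < 1 / real (Suc (m n))" "norm (r *\<^sub>R w) < 1 / real (Suc (m k))" by auto
      then have "\<bar>G x (r *\<^sub>R w) - G x 0 - (r *\<^sub>R w) \<bullet> q n\<bar> \<le> norm (r *\<^sub>R w) / real (Suc n)"
        "\<bar>G x (r *\<^sub>R w) - G x 0 - (r *\<^sub>R w) \<bullet> q k\<bar> \<le> norm (r *\<^sub>R w) / real (Suc k)"
        using mq[of n] mq[of k] by (simp_all only: A_def mem_Collect_eq)
      then have "(r *\<^sub>R w) \<bullet> q n - (r *\<^sub>R w) \<bullet> q k \<le> norm (r *\<^sub>R w) / real (Suc n) + norm (r *\<^sub>R w) / real (Suc k)"
        by linarith
      moreover have "(r *\<^sub>R w) \<bullet> q n - (r *\<^sub>R w) \<bullet> q k = r * (norm w)\<^sup>2"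
        by (simp add: w_def power2_norm_eq_inner inner_diff_right right_diff_distrib)
      ultimately have "r * (norm w)\<^sup>2 \<le> r * (norm w * (1 / real (Suc n) + 1 / real (Suc k)))"
        using r by (simp add: distrib_left del: of_nat_Suc)
      then show ?thesis
        using r w by (simp add: power2_eq_square w_def del: of_nat_Suc)
    qed auto
    have "Cauchy q"
      unfolding Cauchy_iff
    proof (intro allI impI)
      fix e :: real assume "e > 0"
      then obtain M where M: "1 / real (Suc M) < e / 2" by (metis nat_approx_posE half_gt_zero)
      have "norm (q i - q j) < e" if "i \<ge> M" "j \<ge> M" for i j
      proof -
        have "1 / real (Suc i) \<le> 1 / real (Suc M)" "1 / real (Suc j) \<le> 1 / real (Suc M)"
          using that by (auto intro!: divide_left_mono)
        then show ?thesis using qd[of i j] M by linarith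
      qed
      then show "\<exists>M. \<forall>m\<ge>M. \<forall>n\<ge>M. norm (q m - q n) < e" by blast
    qed
    then obtain D where D: "q \<longlonglongrightarrow> D" using convergent_eq_Cauchy by (auto simp: convergent_def)
    have qD: "norm (q n - D) \<le> 1 / real (Suc n)" for n
    proof (rule LIMSEQ_le)
      show "(\<lambda>k. norm (q n - q k)) \<longlonglongrightarrow> norm (q n - D)" by (intro tendsto_intros D)
      show "(\<lambda>k. 1 / real (Suc n) + 1 / real (Suc k)) \<longlonglongrightarrow> 1 / real (Suc n)"
        using tendsto_add[OF tendsto_const LIMSEQ_inverse_real_of_nat, of "1 / real (Suc n)"]
        by (simp add: inverse_eq_divide del: of_nat_Suc)
    qed (use qd in blast)
    have "GDERIV (G x) 0 :> D"
      unfolding GDERIV_iff_eps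
    proof (intro allI impI)
      fix e :: real assume "e > 0"
      then obtain n where n: "1 / real (Suc n) < e / 2" by (metis nat_approx_posE half_gt_zero)
      have "\<bar>G x (0 + h) - G x 0 - h \<bullet> D\<bar> \<le> e * norm h" if "norm h < 1 / real (Suc (m n))" for h
      proof -
        have "\<bar>h \<bullet> (q n - D)\<bar> \<le> norm h * norm (q n - D)" by (rule Cauchy_Schwarz_ineq2)
        also have "\<dots> \<le> norm h * (1 / real (Suc n))" by (intro mult_left_mono qD) auto
        finally have "\<bar>G x h - G x 0 - h \<bullet> D\<bar> \<le> norm h / real (Suc n) + norm h * (1 / real (Suc n))"
          using mq[of n] that by (auto simp: A_def inner_diff_right abs_le_iff simp del: of_nat_Suc dest!: spec[of _ h])
        also have "\<dots> = norm h * (1 / real (Suc n) + 1 / real (Suc n))" by (simp add: distrib_left del: of_nat_Suc)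
        also have "\<dots> \<le> norm h * e" using n by (intro mult_left_mono) (auto simp del: of_nat_Suc)
        finally show ?thesis by (simp add: mult.commute)
      qed
      then show "\<exists>\<delta>>0. \<forall>h. norm h < \<delta> \<longrightarrow> \<bar>G x (0 + h) - G x 0 - h \<bullet> D\<bar> \<le> e * norm h"
        by (intro exI[of _ "1 / real (Suc (m n))"]) auto
    qed
    then show "x \<in> {x. \<exists>D. GDERIV (G x) 0 :> D}" by blast
  qed
  finally show ?thesis .
qed

lemma GDERIV_direction:
  fixes f :: "'a::euclidean_space \<Rightarrow> real"
  assumes "GDERIV f x :> D"
  shows "((\<lambda>t. (f (x + t *\<^sub>R d) - f x) / t) \<longlongrightarrow> d \<bullet> D) (at 0)"
proof -
  have "((\<lambda>t. f (x + t *\<^sub>R d)) has_derivative (\<lambda>t. (t *\<^sub>R d) \<bullet> D)) (at 0)"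
  proof (rule has_derivative_compose[where g=f])
    show "((\<lambda>t. x + t *\<^sub>R d) has_derivative (\<lambda>t. t *\<^sub>R d)) (at 0)"
      by (auto intro!: derivative_eq_intros)
    show "(f has_derivative (\<lambda>h. h \<bullet> D)) (at (x + 0 *\<^sub>R d))"
      using assms by (simp add: gderiv_def)
  qed
  then have "DERIV (\<lambda>t. f (x + t *\<^sub>R d)) 0 :> d \<bullet> D"
    unfolding has_field_derivative_def by (rule has_derivative_eq_rhs) (auto simp: fun_eq_iff)
  then show ?thesis by (simp add: DERIV_def)
qed

lemma LIMSEQ_quotient:
  assumes "((\<lambda>t. f t) \<longlongrightarrow> l) (at (0::real))"
  shows "(\<lambda>n. f (1 / real (Suc n))) \<longlonglongrightarrow> (l::real)"
proof (rule filterlim_compose[OF assms])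
  have "(\<lambda>n. 1 / real (Suc n)) \<longlonglongrightarrow> 0" using LIMSEQ_inverse_real_of_nat by (simp add: inverse_eq_divide)
  then show "filterlim (\<lambda>n. 1 / real (Suc n)) (at 0) sequentially"
    by (simp add: filterlim_at)
qed

text \<open>On the Borel set of differentiability each coordinate is a limit of measurable
  difference quotients. Elsewhere \<open>gradient\<close> chooses from the empty predicate, hence
  yields the same vector at all such points.\<close>

lemma borel_measurable_gradient_param:
  fixes G :: "'b::topological_space \<Rightarrow> 'c::euclidean_space \<Rightarrow> real"
  assumes cont: "\<And>h. continuous_on UNIV (\<lambda>x. G x h)"
  shows "(\<lambda>x. gradient (G x) 0) \<in> borel_measurable borel"
proof (rule borel_measurable_euclidean_space[THEN iffD2], intro ballI)
  fix b :: 'c assume "b \<in> Basis"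
  let ?Df = "{x. \<exists>D. GDERIV (G x) 0 :> D}"
  note [measurable] = sets_GDERIV_exists[OF cont] borel_measurable_continuous_onI[OF cont]
  let ?c = "(SOME D::'c. False)"
  let ?f = "\<lambda>n x. if x \<in> ?Df then (G x ((1 / real (Suc n)) *\<^sub>R b) - G x 0) / (1 / real (Suc n)) else ?c \<bullet> b"
  show "(\<lambda>x. gradient (G x) 0 \<bullet> b) \<in> borel_measurable borel"
  proof (rule borel_measurable_LIMSEQ_real)
    fix x
    show "(\<lambda>n. ?f n x) \<longlonglongrightarrow> gradient (G x) 0 \<bullet> b"
    proof (cases "x \<in> ?Df")
      case True
      then obtain D where D: "GDERIV (G x) 0 :> D" by blast
      from LIMSEQ_quotient[OF GDERIV_direction[OF D, of b]]
      have "(\<lambda>n. (G x ((1 / real (Suc n)) *\<^sub>R b) - G x 0) / (1 / real (Suc n))) \<longlonglongrightarrow> gradient (G x) 0 \<bullet> b"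
        by (simp add: gradient_eq[OF D] inner_commute del: of_nat_Suc)
      with True show ?thesis by (simp only: if_True)
    next
      case False
      then have "(\<lambda>D. GDERIV (G x) 0 :> D) = (\<lambda>D. False)" by auto
      then have "gradient (G x) 0 = ?c" by (simp add: gradient_def)
      with False show ?thesis by (simp only: if_False tendsto_const)
    qed
  qed measurable
qed

text \<open>The density (f + (C + 1)) / (C + 1) is nonnegative and gives every box its Lebesgue
  volume, so it defines Lebesgue measure and equals 1 almost everywhere. The summand 1 keeps the
  divisor positive when C = 0.\<close>

lemma AE_eq_0_if_integral_boxes:
  fixes f :: "'a::euclidean_space \<Rightarrow> real"
  assumes [measurable]: "f \<in> borel_measurable borel" and bd: "\<And>x. \<bar>f x\<bar> \<le> C"
    and box: "\<And>l u. (\<integral>x. indicator (box l u) x * f x \<partial>lborel) = 0"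
  shows "AE x in lborel. f x = 0"
proof -
  have C: "C + 1 > 0" using bd[of undefined] by linarith
  let ?g = "\<lambda>x. ennreal ((f x + (C + 1)) / (C + 1))"
  have nn: "0 \<le> (f x + (C + 1)) / (C + 1)" for x using bd[of x] C by (auto simp: abs_le_iff)
  have "lborel = density lborel ?g"
  proof (rule lborel_eqI)
    fix l u :: 'a assume lu: "\<And>b. b \<in> Basis \<Longrightarrow> l \<bullet> b \<le> u \<bullet> b"
    have int1: "integrable lborel (\<lambda>x. indicator (box l u) x :: real)"
      by (intro integrable_real_indicator) (auto simp: emeasure_lborel_box_eq)
    have int2: "integrable lborel (\<lambda>x. indicator (box l u) x * f x)"
      by (rule Bochner_Integration.integrable_bound[OF integrable_mult_right[OF int1, of C]])
         (use bd in \<open>auto simp: indicator_def intro: order_trans[OF _ abs_ge_self]\<close>)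
    have "emeasure (density lborel ?g) (box l u) = (\<integral>\<^sup>+x. ennreal (indicator (box l u) x * ((f x + (C + 1)) / (C + 1))) \<partial>lborel)"
      by (subst emeasure_density) (auto intro!: nn_integral_cong simp: indicator_def)
    also have "\<dots> = ennreal (\<integral>x. indicator (box l u) x * ((f x + (C + 1)) / (C + 1)) \<partial>lborel)"
    proof (rule nn_integral_eq_integral)
      have "integrable lborel (\<lambda>x. (indicator (box l u) x * f x + (C+1) * indicator (box l u) x) / (C + 1))"
        using int1 int2 by (intro integrable_divide Bochner_Integration.integrable_add integrable_mult_right)
      then show "integrable lborel (\<lambda>x. indicator (box l u) x * ((f x + (C + 1)) / (C + 1)))"
        by (simp add: algebra_simps)
    qed (use nn in \<open>auto simp: indicator_def\<close>)
    also have "(\<integral>x. indicator (box l u) x * ((f x + (C + 1)) / (C + 1)) \<partial>lborel) =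
        (\<integral>x. (indicator (box l u) x * f x + (C+1) * indicator (box l u) x) / (C + 1) \<partial>lborel)"
      by (intro Bochner_Integration.integral_cong) (auto simp: algebra_simps)
    also have "\<dots> = (0 + (C + 1) * measure lborel (box l u)) / (C + 1)"
      using int1 int2 box[of l u] by simp
    also have "\<dots> = measure lborel (box l u)" using C by simp
    also have "ennreal \<dots> = (\<Prod>b\<in>Basis. (u - l) \<bullet> b)"
      using lu by (simp add: measure_lborel_box_eq prod_nonneg inner_diff_left)
    finally show "emeasure (density lborel ?g) (box l u) = (\<Prod>b\<in>Basis. (u - l) \<bullet> b)" .
  qed simp
  then have "density lborel ?g = density lborel (\<lambda>_. 1)" by (simp add: density_1)
  then have "AE x in lborel. ?g x = 1"
    by (subst (asm) sigma_finite_measure.density_unique_iff[OF sigma_finite_lborel]) auto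
  then show ?thesis
  proof eventually_elim
    case (elim x)
    then have "(f x + (C + 1)) / (C + 1) = 1"
      using nn[of x] by (metis ennreal_eq_1)
    with C show ?case by (simp add: field_simps)
  qed
qed

section \<open>Directional derivatives of a Lipschitz function\<close>

text \<open>Phrased as a gradient on the real line, so that
  \<open>borel_measurable_gradient_param\<close> applies to it.\<close>

abbreviation dirderiv :: "('a::real_vector \<Rightarrow> real) \<Rightarrow> 'a \<Rightarrow> 'a \<Rightarrow> real" where
  "dirderiv \<phi> d x \<equiv> gradient (\<lambda>t::real. \<phi> (x + t *\<^sub>R d)) 0"

context
  fixes \<phi> :: "'a::euclidean_space \<Rightarrow> real" and L :: real
  assumes lip: "L-lipschitz_on UNIV \<phi>"
begin

lemma continuous_on_phi: "continuous_on A \<phi>"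
  using lipschitz_on_continuous_on[OF lip] continuous_on_subset by blast

lemma lip_abs: "\<bar>\<phi> x - \<phi> y\<bar> \<le> L * norm (x - y)"
  using lipschitz_onD[OF lip, of x y] by (simp add: dist_real_def dist_norm)

lemma phi_measurable: "\<phi> \<in> borel_measurable borel"
  by (intro borel_measurable_continuous_onI continuous_on_phi)

lemma continuous_on_translate: "continuous_on UNIV (\<lambda>x. \<phi> (x + h))"
  by (rule continuous_on_compose2[OF continuous_on_phi]) (auto intro!: continuous_intros)

lemma dirderiv_measurable: "(\<lambda>x. dirderiv \<phi> d x) \<in> borel_measurable borel"
  by (intro borel_measurable_gradient_param continuous_on_translate)

text \<open>Restricted to a line of direction d, \<phi> is a Lipschitz function of one variable, so
  the Borel set of good points has full measure on every such line.\<close>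

lemma AE_dirderiv: "AE x in lborel. DERIV (\<lambda>t. \<phi> (x + t *\<^sub>R d)) 0 :> dirderiv \<phi> d x"
proof -
  have "AE x in lborel. \<exists>l. GDERIV (\<lambda>t. \<phi> (x + t *\<^sub>R d)) 0 :> (l::real)"
  proof (cases "d = 0")
    case True
    then show ?thesis by (auto intro!: exI[of _ 0] derivative_eq_intros)
  next
    case False
    show ?thesis
    proof (rule AE_lborel_lines[OF _ False])
      show "{x. \<exists>l. GDERIV (\<lambda>t. \<phi> (x + t *\<^sub>R d)) 0 :> (l::real)} \<in> sets borel"
        by (intro sets_GDERIV_exists continuous_on_translate)
      fix x
      let ?f = "\<lambda>t. \<phi> (x + t *\<^sub>R d)"
      have "(L * norm d)-lipschitz_on UNIV ?f"
      proof (rule lipschitz_onI)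
        fix s t :: real
        have "\<bar>?f s - ?f t\<bar> \<le> L * norm ((x + s *\<^sub>R d) - (x + t *\<^sub>R d))" by (rule lip_abs)
        also have "(x + s *\<^sub>R d) - (x + t *\<^sub>R d) = (s - t) *\<^sub>R d" by (simp add: scaleR_diff_left)
        finally show "dist (?f s) (?f t) \<le> L * norm d * dist s t" by (simp add: dist_real_def mult_ac)
      qed (use lipschitz_on_nonneg[OF lip] in simp)
      then have "negligible {t. \<not> (\<exists>l. ((\<lambda>h. (?f (t + h) - ?f t) / h) \<longlongrightarrow> l) (at 0))}"
        by (rule negligible_not_differentiable_lipschitz_real)
      then have "AE t in lebesgue. \<exists>l. ((\<lambda>h. (?f (t + h) - ?f t) / h) \<longlongrightarrow> l) (at 0)"
        by (simp add: negligible_iff_null_sets eventually_ae_filter) blast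
      then have "AE t in lborel. \<exists>l. ((\<lambda>h. (?f (t + h) - ?f t) / h) \<longlongrightarrow> l) (at 0)"
        by (simp add: AE_completion_iff)
      then show "AE t in lborel. \<exists>l. GDERIV (\<lambda>s. \<phi> (x + t *\<^sub>R d + s *\<^sub>R d)) 0 :> (l::real)"
        by eventually_elim (simp add: DERIV_def algebra_simps)
    qed
  qed
  then show ?thesis
  proof eventually_elim
    case (elim x)
    then obtain l where l: "GDERIV (\<lambda>t. \<phi> (x + t *\<^sub>R d)) 0 :> (l::real)" by blast
    then show ?case using GDERIV_gradient[OF l] by simp
  qed
qed

lemma quotient_bound: "\<bar>(\<phi> (x + t *\<^sub>R d) - \<phi> x) / t\<bar> \<le> L * norm d"
proof (cases "t = 0")
  case False
  then show ?thesis using lip_abs[of "x + t *\<^sub>R d" x] by (simp add: abs_divide divide_le_eq mult_ac)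
qed (use lipschitz_on_nonneg[OF lip] in simp)

lemma dirderiv_bound:
  assumes "DERIV (\<lambda>t. \<phi> (x + t *\<^sub>R d)) 0 :> l"
  shows "\<bar>l\<bar> \<le> L * norm d"
proof (rule tendsto_upperbound)
  show "((\<lambda>t. \<bar>(\<phi> (x + t *\<^sub>R d) - \<phi> x) / t\<bar>) \<longlongrightarrow> \<bar>l\<bar>) (at 0)"
    using assms by (intro tendsto_intros) (simp add: DERIV_def)
qed (use quotient_bound in auto)

text \<open>The quotient for d + d' is the quotient for d at a point shifted by d' / (n + 1), plus
  the quotient for d'. The pointwise limit of the shifted quotient is not under control. After
  integration over a box, however, the shift passes to the indicator of the box and disappears in
  the limit, so both sides have the same integral over every box.\<close>

lemma AE_dirderiv_add: "AE x in lborel. dirderiv \<phi> (d + d') x = dirderiv \<phi> d x + dirderiv \<phi> d' x"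
proof -
  note [measurable] = phi_measurable
  \<comment> \<open>Where the derivative fails to exist, \<open>dirderiv\<close> is a default value.
    The cut-off makes the function bounded everywhere and changes it only on a null set.\<close>
  define g where "g d x = (if \<bar>dirderiv \<phi> d x\<bar> \<le> L * norm d then dirderiv \<phi> d x else 0)" for d x
  have [measurable]: "g d \<in> borel_measurable borel" for d
    unfolding g_def using dirderiv_measurable[of d] by measurable
  have gb: "\<bar>g d x\<bar> \<le> L * norm d" for d x
    using lipschitz_on_nonneg[OF lip] by (auto simp: g_def)
  define Q where "Q d n x = (\<phi> (x + (1 / real (Suc n)) *\<^sub>R d) - \<phi> x) / (1 / real (Suc n))" for d n x
  have [measurable]: "Q d n \<in> borel_measurable borel" for d n
    unfolding Q_def by measurable
  have Qb: "\<bar>Q d n x\<bar> \<le> L * norm d" for d n x unfolding Q_def by (rule quotient_bound)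
  have g_eq: "AE x in lborel. dirderiv \<phi> d x = g d x" for d
    using AE_dirderiv[of d] by eventually_elim (simp add: g_def dirderiv_bound)
  have lim: "AE x in lborel. (\<lambda>n. Q d n x) \<longlonglongrightarrow> g d x" for d
    using AE_dirderiv[of d] g_eq[of d]
  proof eventually_elim
    case (elim x)
    then have "((\<lambda>t. (\<phi> (x + t *\<^sub>R d) - \<phi> x) / t) \<longlongrightarrow> g d x) (at 0)"
      by (simp add: DERIV_def)
    from LIMSEQ_quotient[OF this] show ?case by (simp add: Q_def)
  qed
  have box0: "(\<integral>x. indicator (box l u) x * (g (d + d') x - (g d x + g d' x)) \<partial>lborel) = 0" for l u
  proof -
    let ?B = "box l u"
    obtain R where R: "?B \<subseteq> cball 0 R" "R > 0"
      using bounded_box[of l u] bounded_subset_ballD[of "box l u" 0] by (metis ball_subset_cball order_trans)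
    have R1: "x \<in> cball 0 (R + norm d')" if "x - (1 / real (Suc n)) *\<^sub>R d' \<in> ?B" for x n
    proof -
      have "norm ((1 / real (Suc n)) *\<^sub>R d') \<le> norm d'" using mult_left_le_one_le[of "norm d'" "1 / real (Suc n)"] by simp
      moreover have "norm (x - (1 / real (Suc n)) *\<^sub>R d') \<le> R" using that R(1) by auto
      ultimately show ?thesis using norm_triangle_sub[of x "(1 / real (Suc n)) *\<^sub>R d'"] by simp
    qed
    have intB: "integrable lborel (\<lambda>x. c * indicator (cball 0 r) x :: real)" for c r
      by (intro integrable_mult_right integrable_real_indicator emeasure_bounded_finite) auto
    have l1: "(\<lambda>n. \<integral>x. indicator ?B x * Q d n x \<partial>lborel) \<longlonglongrightarrow> (\<integral>x. indicator ?B x * g d x \<partial>lborel)" for d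
    proof (rule integral_dominated_convergence[where w="\<lambda>x. (L * norm d) * indicator (cball 0 R) x"])
      show "AE x in lborel. (\<lambda>n. indicator ?B x * Q d n x) \<longlonglongrightarrow> indicator ?B x * g d x"
        using lim[of d] by eventually_elim (intro tendsto_intros)
      show "AE x in lborel. norm (indicator ?B x * Q d n x) \<le> L * norm d * indicator (cball 0 R) x" for n
      proof (rule AE_I2)
        fix x
        show "norm (indicator ?B x * Q d n x) \<le> L * norm d * indicator (cball 0 R) x"
          using Qb[of d n x] R(1) lipschitz_on_nonneg[OF lip] by (cases "x \<in> ?B") (auto simp: indicator_def)
      qed
    qed (use intB in auto)
    have l2: "(\<lambda>n. \<integral>x. indicator ?B x * Q d n (x + (1 / real (Suc n)) *\<^sub>R d') \<partial>lborel)
        \<longlonglongrightarrow> (\<integral>x. indicator ?B x * g d x \<partial>lborel)"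
    proof -
      have shift: "(\<integral>x. indicator ?B x * Q d n (x + (1 / real (Suc n)) *\<^sub>R d') \<partial>lborel) =
          (\<integral>x. indicator ?B (x - (1 / real (Suc n)) *\<^sub>R d') * Q d n x \<partial>lborel)" for n
        using integral_lborel_translate[of "\<lambda>x. indicator ?B (x - (1 / real (Suc n)) *\<^sub>R d') * Q d n x" "(1 / real (Suc n)) *\<^sub>R d'"]
        by simp
      \<comment> \<open>Off the frontier of the box, the shifted indicators eventually agree with
        the unshifted one; the frontier of a convex set is a null set.\<close>
      have fr: "AE x in lborel. x \<notin> frontier ?B"
      proof -
        have "negligible (frontier ?B)" by (intro negligible_convex_frontier convex_box)
        then show ?thesis
          by (intro AE_not_in) (simp add: negligible_iff_null_sets null_sets_completion_iff)
      qed
      have "(\<lambda>n. \<integral>x. indicator ?B (x - (1 / real (Suc n)) *\<^sub>R d') * Q d n x \<partial>lborel) \<longlonglongrightarrow> (\<integral>x. indicator ?B x * g d x \<partial>lborel)"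
      proof (rule integral_dominated_convergence[where w="\<lambda>x. (L * norm d) * indicator (cball 0 (R + norm d')) x"])
        show "AE x in lborel. (\<lambda>n. indicator ?B (x - (1 / real (Suc n)) *\<^sub>R d') * Q d n x) \<longlonglongrightarrow> indicator ?B x * g d x"
          using lim[of d] fr
        proof eventually_elim
          case (elim x)
          have sl: "(\<lambda>n. x - (1 / real (Suc n)) *\<^sub>R d') \<longlonglongrightarrow> x"
            using tendsto_diff[OF tendsto_const tendsto_scaleR[OF LIMSEQ_inverse_real_of_nat tendsto_const], of x d']
            by (simp add: inverse_eq_divide)
          have "(\<lambda>n. indicator ?B (x - (1 / real (Suc n)) *\<^sub>R d') :: real) \<longlonglongrightarrow> indicator ?B x"
          proof (cases "x \<in> ?B")
            case True
            then have "\<forall>\<^sub>F n in sequentially. x - (1 / real (Suc n)) *\<^sub>R d' \<in> ?B"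
              using sl by (intro topological_tendstoD) auto
            then show ?thesis by (intro tendsto_eventually) (use True in \<open>auto elim: eventually_mono\<close>)
          next
            case False
            then have "x \<in> - closure ?B" using elim(2) by (auto simp: frontier_def interior_open[OF open_box] simp del: closure_box)
            then have "\<forall>\<^sub>F n in sequentially. x - (1 / real (Suc n)) *\<^sub>R d' \<in> - closure ?B"
              using sl by (intro topological_tendstoD[of _ x]) auto
            then have "\<forall>\<^sub>F n in sequentially. x - (1 / real (Suc n)) *\<^sub>R d' \<notin> ?B"
              by eventually_elim (use closure_subset in blast)
            then show ?thesis by (intro tendsto_eventually) (use False in \<open>auto elim: eventually_mono\<close>)
          qed
          with elim(1) show ?case by (intro tendsto_intros)
        qed
        show "AE x in lborel. norm (indicator ?B (x - (1 / real (Suc n)) *\<^sub>R d') * Q d n x) \<le> L * norm d * indicator (cball 0 (R + norm d')) x" for n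
        proof (rule AE_I2)
          fix x
          show "norm (indicator ?B (x - (1 / real (Suc n)) *\<^sub>R d') * Q d n x) \<le> L * norm d * indicator (cball 0 (R + norm d')) x"
          proof (cases "x - (1 / real (Suc n)) *\<^sub>R d' \<in> ?B")
            case True
            with R1[OF True] Qb[of d n x] show ?thesis by simp
          next
            case False
            then show ?thesis using lipschitz_on_nonneg[OF lip] by simp
          qed
        qed
      qed (use intB in auto)
      then show ?thesis by (simp only: shift)
    qed
    have split: "Q (d + d') n x = Q d n (x + (1 / real (Suc n)) *\<^sub>R d') + Q d' n x" for n x
      unfolding Q_def by (subst add_divide_distrib[symmetric]) (simp add: scaleR_add_right add_ac del: of_nat_Suc)
    have ib: "integrable lborel (\<lambda>x. indicator ?B x * q x)"
      if [measurable]: "q \<in> borel_measurable borel" and "\<And>x. \<bar>q x\<bar> \<le> c" for q :: "'a \<Rightarrow> real" and c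
    proof (rule Bochner_Integration.integrable_bound[OF intB[of c R]])
      show "AE x in lborel. norm (indicator ?B x * q x) \<le> norm (c * indicator (cball 0 R) x)"
      proof (rule AE_I2)
        fix x
        show "norm (indicator ?B x * q x) \<le> norm (c * indicator (cball 0 R) x)"
          using order_trans[OF that(2)[of x] abs_ge_self] R(1) by (cases "x \<in> ?B") (auto simp: indicator_def)
      qed
    qed measurable
    have "(\<integral>x. indicator ?B x * Q (d + d') n x \<partial>lborel) =
       (\<integral>x. indicator ?B x * Q d n (x + (1 / real (Suc n)) *\<^sub>R d') \<partial>lborel) + (\<integral>x. indicator ?B x * Q d' n x \<partial>lborel)" for n
      unfolding split distrib_left
      by (intro Bochner_Integration.integral_add ib[of _ "L * norm d"] ib[of _ "L * norm d'"] Qb) measurable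
    with tendsto_add[OF l2 l1[of d']] have "(\<lambda>n. \<integral>x. indicator ?B x * Q (d + d') n x \<partial>lborel)
       \<longlonglongrightarrow> (\<integral>x. indicator ?B x * g d x \<partial>lborel) + (\<integral>x. indicator ?B x * g d' x \<partial>lborel)"
      by simp
    with l1[of "d + d'"] have "(\<integral>x. indicator ?B x * g (d + d') x \<partial>lborel) =
       (\<integral>x. indicator ?B x * g d x \<partial>lborel) + (\<integral>x. indicator ?B x * g d' x \<partial>lborel)"
      by (rule LIMSEQ_unique)
    moreover have "(\<integral>x. indicator ?B x * (g (d + d') x - (g d x + g d' x)) \<partial>lborel) =
       (\<integral>x. indicator ?B x * g (d + d') x \<partial>lborel) -
       ((\<integral>x. indicator ?B x * g d x \<partial>lborel) + (\<integral>x. indicator ?B x * g d' x \<partial>lborel))"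
      using ib[OF _ gb] by (simp add: right_diff_distrib distrib_left)
    ultimately show ?thesis by simp
  qed
  have "AE x in lborel. g (d + d') x - (g d x + g d' x) = 0"
  proof (rule AE_eq_0_if_integral_boxes[OF _ _ box0])
    show "\<bar>g (d + d') x - (g d x + g d' x)\<bar> \<le> L * norm (d + d') + (L * norm d + L * norm d')" for x
      using gb[of "d + d'" x] gb[of d x] gb[of d' x] by linarith
  qed measurable
  with g_eq[of "d + d'"] g_eq[of d] g_eq[of d'] show ?thesis
    by eventually_elim simp
qed

text \<open>The vector of coordinate derivatives is the candidate for the gradient. The null set
  still depends on d, so only countably many directions can be treated simultaneously.\<close>

lemma AE_dirderiv_linear:
  "AE x in lborel. dirderiv \<phi> d x = d \<bullet> (\<Sum>b\<in>Basis. dirderiv \<phi> b x *\<^sub>R b)"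
proof -
  have scale: "AE x in lborel. dirderiv \<phi> (c *\<^sub>R b) x = c * dirderiv \<phi> b x" for c b
    using AE_dirderiv[of b]
  proof eventually_elim
    case (elim x)
    have "((\<lambda>t. \<phi> (x + (c * t) *\<^sub>R b)) has_real_derivative dirderiv \<phi> b x * c) (at 0)"
      by (rule DERIV_chain2[where f="\<lambda>t. \<phi> (x + t *\<^sub>R b)"]) (auto intro!: derivative_eq_intros elim)
    then have "GDERIV (\<lambda>t. \<phi> (x + t *\<^sub>R (c *\<^sub>R b))) 0 :> c * dirderiv \<phi> b x"
      by (simp add: mult.commute)
    then show ?case by (rule gradient_eq)
  qed
  have "finite A \<Longrightarrow> AE x in lborel. dirderiv \<phi> (\<Sum>b\<in>A. (d \<bullet> b) *\<^sub>R b) x = (\<Sum>b\<in>A. (d \<bullet> b) * dirderiv \<phi> b x)" for A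
  proof (induction A rule: finite_induct)
    case empty
    then show ?case using scale[of 0 0] by simp
  next
    case (insert b A)
    from insert.IH AE_dirderiv_add[of "(d \<bullet> b) *\<^sub>R b" "\<Sum>b\<in>A. (d \<bullet> b) *\<^sub>R b"] scale[of "d \<bullet> b" b]
    show ?case
      by eventually_elim (use insert.hyps in simp)
  qed
  from this[OF finite_Basis] show ?thesis
    by (simp add: euclidean_representation inner_sum_right mult.commute)
qed

text \<open>Outside one null set the linear formula holds for a countable dense set of directions.
  Finitely many of them are \<eta>-dense on the unit sphere, and the Lipschitz bound carries the
  estimate from these to all directions uniformly.\<close>

theorem rademacher: "AE x in lborel. GDERIV \<phi> x :> gradient \<phi> x"
proof -
  obtain Q :: "'a set" where Q: "countable Q" "\<And>X. open X \<Longrightarrow> X \<noteq> {} \<Longrightarrow> \<exists>q\<in>Q. q \<in> X"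
    using countable_dense_setE by auto
  have L0: "0 \<le> L" using lip by (rule lipschitz_on_nonneg)
  define G where "G x = (\<Sum>b\<in>Basis. dirderiv \<phi> b x *\<^sub>R b)" for x
  have "AE x in lborel. \<forall>q\<in>Q. DERIV (\<lambda>t. \<phi> (x + t *\<^sub>R q)) 0 :> q \<bullet> G x"
  proof (subst AE_ball_countable[OF Q(1)], intro ballI)
    fix q assume "q \<in> Q"
    from AE_dirderiv[of q] AE_dirderiv_linear[of q] show "AE x in lborel. DERIV (\<lambda>t. \<phi> (x + t *\<^sub>R q)) 0 :> q \<bullet> G x"
      by eventually_elim (simp add: G_def)
  qed
  then show ?thesis
  proof eventually_elim
    case (elim x)
    have "GDERIV \<phi> x :> G x"
      unfolding GDERIV_iff_eps
    proof (intro allI impI)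
      fix e :: real assume "e > 0"
      \<comment> \<open>Three errors of size \<eta> |h| add up: once from the quotient in a
        direction of the finite net, L times from replacing h by t q in \<phi>, and |G x| times from
        the same replacement in the linear form.\<close>
      define \<eta> where "\<eta> = e / (1 + L + norm (G x))"
      have den: "1 + L + norm (G x) > 0" using L0 norm_ge_zero[of "G x"] by linarith
      have \<eta>: "\<eta> > 0" using \<open>e > 0\<close> den by (simp add: \<eta>_def)
      have "sphere (0::'a) 1 \<subseteq> (\<Union>q\<in>Q. ball q \<eta>)"
      proof
        fix w :: 'a
        obtain q where "q \<in> Q" "q \<in> ball w \<eta>" using Q(2)[of "ball w \<eta>"] \<eta> by auto
        then show "w \<in> (\<Union>q\<in>Q. ball q \<eta>)" by (auto simp: dist_commute)
      qed
      then obtain F where F: "F \<subseteq> Q" "finite F" "sphere (0::'a) 1 \<subseteq> (\<Union>q\<in>F. ball q \<eta>)"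
        by (rule compactE_image[OF compact_sphere, rotated]) auto
      have "\<forall>\<^sub>F t in at 0. \<forall>q\<in>F. \<bar>(\<phi> (x + t *\<^sub>R q) - \<phi> x) / t - q \<bullet> G x\<bar> < \<eta>"
      proof (intro eventually_ball_finite F(2) ballI)
        fix q assume "q \<in> F"
        then have "((\<lambda>t. (\<phi> (x + t *\<^sub>R q) - \<phi> x) / t) \<longlongrightarrow> q \<bullet> G x) (at 0)"
          using elim F(1) by (auto simp: DERIV_def)
        then show "\<forall>\<^sub>F t in at 0. \<bar>(\<phi> (x + t *\<^sub>R q) - \<phi> x) / t - q \<bullet> G x\<bar> < \<eta>"
          using tendstoD[of _ "q \<bullet> G x" "at 0" \<eta>] \<eta> by (simp add: dist_real_def)
      qed
      then obtain \<delta> where \<delta>: "\<delta> > 0" "\<And>t q. t \<noteq> 0 \<Longrightarrow> \<bar>t\<bar> < \<delta> \<Longrightarrow> q \<in> F \<Longrightarrow> \<bar>(\<phi> (x + t *\<^sub>R q) - \<phi> x) / t - q \<bullet> G x\<bar> < \<eta>"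
        unfolding eventually_at by (auto simp: dist_real_def)
      have "\<bar>\<phi> (x + h) - \<phi> x - h \<bullet> G x\<bar> \<le> e * norm h" if h: "norm h < \<delta>" for h
      proof (cases "h = 0")
        case False
        define t where "t = norm h"
        have t: "t > 0" using False by (simp add: t_def)
        have "(1 / t) *\<^sub>R h \<in> sphere 0 1" using t by (simp add: t_def)
        then obtain q where q: "q \<in> F" "norm (q - (1 / t) *\<^sub>R h) < \<eta>"
          using F(3) by (auto simp only: subset_iff UN_iff mem_ball dist_norm)
        have "norm (t *\<^sub>R q - h) = norm (t *\<^sub>R (q - (1 / t) *\<^sub>R h))"
          using t by (simp add: scaleR_diff_right)
        also have "\<dots> \<le> t * \<eta>" using q(2) t by simp
        finally have nq: "norm (t *\<^sub>R q - h) \<le> t * \<eta>" .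
        have a1: "\<bar>\<phi> (x + h) - \<phi> (x + t *\<^sub>R q)\<bar> \<le> L * (t * \<eta>)"
        proof -
          have "\<bar>\<phi> (x + h) - \<phi> (x + t *\<^sub>R q)\<bar> \<le> L * norm ((x + h) - (x + t *\<^sub>R q))" by (rule lip_abs)
          also have "norm ((x + h) - (x + t *\<^sub>R q)) = norm (t *\<^sub>R q - h)"
            by (simp add: norm_minus_commute)
          also have "L * \<dots> \<le> L * (t * \<eta>)" using nq L0 by (intro mult_left_mono)
          finally show ?thesis .
        qed
        have a2: "\<bar>\<phi> (x + t *\<^sub>R q) - \<phi> x - t * (q \<bullet> G x)\<bar> \<le> t * \<eta>"
        proof -
          have "\<bar>\<phi> (x + t *\<^sub>R q) - \<phi> x - t * (q \<bullet> G x)\<bar> = t * \<bar>(\<phi> (x + t *\<^sub>R q) - \<phi> x) / t - q \<bullet> G x\<bar>"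
          proof -
            have "t * ((\<phi> (x + t *\<^sub>R q) - \<phi> x) / t - q \<bullet> G x) = \<phi> (x + t *\<^sub>R q) - \<phi> x - t * (q \<bullet> G x)"
              using t by (simp add: field_simps)
            then show ?thesis using t by (metis abs_mult abs_of_pos)
          qed
          also have "\<dots> \<le> t * \<eta>"
            using \<delta>(2)[of t q] t h q(1) by (intro mult_left_mono) (auto simp: t_def)
          finally show ?thesis .
        qed
        have a3: "\<bar>t * (q \<bullet> G x) - h \<bullet> G x\<bar> \<le> (t * \<eta>) * norm (G x)"
        proof -
          have "t * (q \<bullet> G x) - h \<bullet> G x = (t *\<^sub>R q - h) \<bullet> G x" by (simp add: inner_diff_left)
          also have "\<bar>\<dots>\<bar> \<le> norm (t *\<^sub>R q - h) * norm (G x)" by (rule Cauchy_Schwarz_ineq2)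
          also have "\<dots> \<le> (t * \<eta>) * norm (G x)" using nq by (intro mult_right_mono) auto
          finally show ?thesis .
        qed
        have "\<bar>\<phi> (x + h) - \<phi> x - h \<bullet> G x\<bar> \<le> L * (t * \<eta>) + t * \<eta> + (t * \<eta>) * norm (G x)"
          using a1 a2 a3 by linarith
        also have "\<dots> = \<eta> * (1 + L + norm (G x)) * t" by (simp add: algebra_simps)
        also have "\<dots> = e * norm h" using den by (simp add: \<eta>_def t_def)
        finally show ?thesis .
      qed simp
      then show "\<exists>\<delta>>0. \<forall>h. norm h < \<delta> \<longrightarrow> \<bar>\<phi> (x + h) - \<phi> x - h \<bullet> G x\<bar> \<le> e * norm h"
        using \<delta>(1) by blast
    qed
    then show ?case by (rule GDERIV_gradient)
  qed
qed

lemma sets_GDERIV_phi: "{x. \<exists>D. GDERIV \<phi> x :> D} \<in> sets borel"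
  unfolding GDERIV_shift[of \<phi>] by (intro sets_GDERIV_exists continuous_on_translate)

lemma gradient_measurable: "gradient \<phi> \<in> borel_measurable borel"
proof -
  have "gradient \<phi> = (\<lambda>x. gradient (\<lambda>h. \<phi> (x + h)) 0)"
    by (intro ext) (simp add: gradient_def GDERIV_shift[of \<phi>])
  then show ?thesis using borel_measurable_gradient_param[of "\<lambda>x h. \<phi> (x + h)"] continuous_on_translate by simp
qed

text \<open>The derivative in the direction D itself is D . D, which the Lipschitz bound limits to L
  |D|.\<close>

lemma norm_GDERIV_le:
  assumes "GDERIV \<phi> x :> D"
  shows "norm D \<le> L"
proof -
  have "\<bar>D \<bullet> D\<bar> \<le> L * norm D"
  proof (rule tendsto_upperbound)
    show "((\<lambda>t. \<bar>(\<phi> (x + t *\<^sub>R D) - \<phi> x) / t\<bar>) \<longlongrightarrow> \<bar>D \<bullet> D\<bar>) (at 0)"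
      by (intro tendsto_intros GDERIV_direction assms)
  qed (use quotient_bound in auto)
  then have "norm D * norm D \<le> L * norm D"
    by (simp add: power2_norm_eq_inner[symmetric] power2_eq_square)
  then show ?thesis using lipschitz_on_nonneg[OF lip] by (cases "D = 0") auto
qed

end

section \<open>Flux through a Lipschitz graph\<close>

text \<open>By the formula for nonnegative functions, Lebesgue measure is the image of slab times
  line under (x, t) \<mapsto> x + t d. The signed version is a change of variables followed by
  Fubini for this product.\<close>

lemma integral_slab:
  fixes f :: "'a::euclidean_space \<Rightarrow> real"
  assumes f: "integrable lborel f" and d: "d \<noteq> 0"
  shows "(\<integral>x. f x \<partial>lborel) =
    (\<integral>x. indicator {x. 0 \<le> x \<bullet> d \<and> x \<bullet> d \<le> d \<bullet> d} x * (\<integral>t. f (x + t *\<^sub>R d) \<partial>lborel) \<partial>lborel)"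
proof -
  let ?S = "{x. 0 \<le> x \<bullet> d \<and> x \<bullet> d \<le> d \<bullet> d}"
  let ?D = "density (lborel \<Otimes>\<^sub>M (lborel :: real measure)) (\<lambda>p. ennreal (indicator ?S (fst p)))"
  let ?T = "\<lambda>p. fst p + snd p *\<^sub>R d"
  have [measurable]: "?S \<in> sets borel" by measurable
  have [measurable]: "f \<in> borel_measurable borel" using f by auto
  have T[measurable]: "?T \<in> borel_measurable (lborel \<Otimes>\<^sub>M lborel)" by measurable
  have T': "?T \<in> ?D \<rightarrow>\<^sub>M borel" by (simp add: T)
  have eq: "lborel = distr ?D borel ?T"
  proof (rule measure_eqI)
    fix A :: "'a set" assume "A \<in> sets lborel"
    then have [measurable]: "A \<in> sets borel" by simp
    have "emeasure (distr ?D borel ?T) A = (\<integral>\<^sup>+y. indicator A y \<partial>distr ?D borel ?T)"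
      by simp
    also have "\<dots> = (\<integral>\<^sup>+p. indicator A (?T p) \<partial>?D)"
      by (intro nn_integral_distr T') simp
    also have "\<dots> = (\<integral>\<^sup>+p. ennreal (indicator ?S (fst p)) * indicator A (?T p) \<partial>(lborel \<Otimes>\<^sub>M lborel))"
      by (intro nn_integral_density) measurable
    also have "\<dots> = (\<integral>\<^sup>+x. (\<integral>\<^sup>+t. ennreal (indicator ?S x) * indicator A (x + t *\<^sub>R d) \<partial>lborel) \<partial>lborel)"
      by (subst lborel.nn_integral_fst[symmetric]) auto
    also have "\<dots> = (\<integral>\<^sup>+x. indicator ?S x * (\<integral>\<^sup>+t. indicator A (x + t *\<^sub>R d) \<partial>lborel) \<partial>lborel)"
      by (intro nn_integral_cong) (simp add: nn_integral_cmult ennreal_indicator)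
    also have "\<dots> = emeasure lborel A"
      by (subst nn_integral_slab[symmetric, OF _ d]) auto
    finally show "emeasure lborel A = emeasure (distr ?D borel ?T) A" ..
  qed simp
  have "integrable (distr ?D borel ?T) f" using f eq by simp
  then have "integrable ?D (\<lambda>p. f (?T p))"
    by (subst (asm) integrable_distr_eq[OF T']) auto
  then have int: "integrable (lborel \<Otimes>\<^sub>M lborel) (\<lambda>p. indicator ?S (fst p) * f (?T p))"
    by (subst (asm) integrable_density) auto
  have "(\<integral>x. f x \<partial>lborel) = (\<integral>x. f x \<partial>distr ?D borel ?T)" using eq by simp
  also have "\<dots> = (\<integral>p. f (?T p) \<partial>?D)" by (intro integral_distr T') simp
  also have "\<dots> = (\<integral>p. indicator ?S (fst p) * f (?T p) \<partial>(lborel \<Otimes>\<^sub>M lborel))"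
    by (subst integral_density) auto
  also have "\<dots> = (\<integral>x. (\<integral>t. indicator ?S x * f (x + t *\<^sub>R d) \<partial>lborel) \<partial>lborel)"
    using lborel_pair.integral_fst'[OF int] by simp
  finally show ?thesis by simp
qed

text \<open>The difference of the ray indicators is the signed indicator of the interval between a
  and b. With a and b the heights at which a line enters the translated and the original epigraph,
  this evaluates the flux along the line; with c = 0 it serves as a plain bound.\<close>

lemma integral_indicator_ray_diff:
  fixes g :: "real \<Rightarrow> real"
  assumes [measurable]: "g \<in> borel_measurable borel"
    and g: "\<And>s. min a b \<le> s \<Longrightarrow> s \<le> max a b \<Longrightarrow> \<bar>g s - c\<bar> \<le> \<epsilon>"
  shows "\<bar>(\<integral>s. g s * (indicator {a<..} s - indicator {b<..} s) \<partial>lborel) - c * (b - a)\<bar> \<le> \<epsilon> * \<bar>b - a\<bar>"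
proof -
  have main: "\<bar>(\<integral>s. g s * indicator {p<..q} s \<partial>lborel) - c * (q - p)\<bar> \<le> \<epsilon> * (q - p)"
    if "p \<le> q" and g': "\<And>s. p \<le> s \<Longrightarrow> s \<le> q \<Longrightarrow> \<bar>g s - c\<bar> \<le> \<epsilon>" for p q
  proof -
    have i: "integrable lborel (\<lambda>s. k * indicator {p<..q} s :: real)" for k
      using that by (intro integrable_mult_right integrable_real_indicator) auto
    have i2: "integrable lborel (\<lambda>s. (g s - c) * indicator {p<..q} s)"
    proof (rule Bochner_Integration.integrable_bound[OF i[of \<epsilon>]])
      show "AE s in lborel. norm ((g s - c) * indicator {p<..q} s) \<le> norm (\<epsilon> * indicator {p<..q} s)"
        using order_trans[OF g' abs_ge_self] by (intro AE_I2) (auto simp: indicator_def)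
    qed measurable
    have "(\<integral>s. g s * indicator {p<..q} s \<partial>lborel) = (\<integral>s. (g s - c) * indicator {p<..q} s + c * indicator {p<..q} s \<partial>lborel)"
      by (intro Bochner_Integration.integral_cong) (auto simp: algebra_simps)
    also have "\<dots> = (\<integral>s. (g s - c) * indicator {p<..q} s \<partial>lborel) + c * (q - p)"
      using that(1) by (subst Bochner_Integration.integral_add[OF i2 i]) simp
    finally have "\<bar>(\<integral>s. g s * indicator {p<..q} s \<partial>lborel) - c * (q - p)\<bar> =
       \<bar>\<integral>s. (g s - c) * indicator {p<..q} s \<partial>lborel\<bar>" by simp
    also have "\<dots> \<le> (\<integral>s. \<epsilon> * indicator {p<..q} s \<partial>lborel)"
      by (rule order_trans[OF integral_abs_bound integral_mono[OF integrable_abs[OF i2] i]])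
         (use g' in \<open>auto simp: indicator_def\<close>)
    also have "\<dots> = \<epsilon> * (q - p)" using that(1) by simp
    finally show ?thesis .
  qed
  show ?thesis
  proof (cases "a \<le> b")
    case True
    have "indicator {a<..} s - indicator {b<..} s = (indicator {a<..b} s :: real)" for s
      using True by (auto simp: indicator_def)
    then show ?thesis using main[of a b] g True by simp
  next
    case False
    have "indicator {a<..} s - indicator {b<..} s = (- indicator {b<..a} s :: real)" for s
      using False by (auto simp: indicator_def)
    then have "(\<integral>s. g s * (indicator {a<..} s - indicator {b<..} s) \<partial>lborel) = - (\<integral>s. g s * indicator {b<..a} s \<partial>lborel)"
      by simp
    moreover have "\<bar>(\<integral>s. g s * indicator {b<..a} s \<partial>lborel) - c * (a - b)\<bar> \<le> \<epsilon> * (a - b)"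
      using main[of b a] g False by simp
    ultimately show ?thesis using False by (simp add: abs_if right_diff_distrib split: if_splits)
  qed
qed

section \<open>Geometry and measure of a Lipschitz graph\<close>

text \<open>The point where the line through x in direction e meets the graph. Defining it on the
  whole space lets the slab stand in for the hyperplane.\<close>

definition graph_point :: "'a::euclidean_space \<Rightarrow> ('a \<Rightarrow> real) \<Rightarrow> 'a \<Rightarrow> 'a" where
  "graph_point e \<phi> x = x - (x \<bullet> e) *\<^sub>R e + \<phi> x *\<^sub>R e"

text \<open>Points out of the region above the graph. Where \<phi> has no gradient it is built from
  a default vector and need not have norm 1.\<close>

definition graph_normal :: "'a::euclidean_space \<Rightarrow> ('a \<Rightarrow> real) \<Rightarrow> 'a \<Rightarrow> 'a" where
  "graph_normal e \<phi> x = (gradient \<phi> x - e) /\<^sub>R sqrt (1 + (norm (gradient \<phi> x))\<^sup>2)"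

text \<open>This crude bound covers also the points where \<open>gradient\<close> is a default
  value, which may fail to be orthogonal to e.\<close>

lemma norm_graph_normal_le:
  assumes "norm e = 1"
  shows "norm (graph_normal e \<phi> x) \<le> 2"
proof -
  let ?D = "gradient \<phi> x" and ?w = "sqrt (1 + (norm (gradient \<phi> x))\<^sup>2)"
  have w: "1 \<le> ?w" "norm ?D \<le> ?w"
    by (auto intro: real_le_rsqrt)
  have "norm (?D - e) \<le> norm ?D + 1" using norm_triangle_ineq4[of ?D e] assms by simp
  also have "\<dots> \<le> 2 * ?w" using w by linarith
  finally have le: "norm (?D - e) \<le> 2 * ?w" .
  have "norm (graph_normal e \<phi> x) = norm (?D - e) / ?w"
    using w(1) unfolding graph_normal_def norm_scaleR by (simp add: divide_inverse mult.commute)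
  also have "\<dots> \<le> 2"
    using divide_right_mono[OF le, of ?w] w(1) by (auto split: if_splits)
  finally show ?thesis .
qed

locale graph_chart =
  fixes e :: "'a::euclidean_space" and \<phi> :: "'a \<Rightarrow> real" and L :: real
  assumes norm_e: "norm e = 1" and lip: "L-lipschitz_on UNIV \<phi>"
    and phi_shift: "\<And>x t. \<phi> (x + t *\<^sub>R e) = \<phi> x"
begin

lemma e_e[simp]: "e \<bullet> e = 1"
  using norm_e by (simp add: norm_eq_1)

lemma e_nz: "e \<noteq> 0" using norm_e by auto

lemma phi_shift'[simp]: "\<phi> (x - t *\<^sub>R e) = \<phi> x"
  using phi_shift[of x "-t"] by simp

lemma phi_shift''[simp]: "\<phi> (x + t *\<^sub>R e + h) = \<phi> (x + h)"
  using phi_shift[of "x + h" t] by (simp add: add_ac)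

lemma L_nonneg: "0 \<le> L" using lip by (rule lipschitz_on_nonneg)

lemmas phi_meas[measurable] = phi_measurable[OF lip]
lemmas grad_meas[measurable] = gradient_measurable[OF lip]

lemma GDERIV_shift_e: "GDERIV \<phi> (x + t *\<^sub>R e) :> D \<longleftrightarrow> GDERIV \<phi> x :> D"
  using phi_shift by (simp add: GDERIV_iff_eps)

lemma gradient_shift_e: "gradient \<phi> (x + t *\<^sub>R e) = gradient \<phi> x"
  by (simp add: gradient_def GDERIV_shift_e)

lemma graph_point_eq: "graph_point e \<phi> x = x + (\<phi> x - x \<bullet> e) *\<^sub>R e"
  by (simp add: graph_point_def algebra_simps)

lemma phi_graph_point[simp]: "\<phi> (graph_point e \<phi> x) = \<phi> x"
  by (simp add: graph_point_eq phi_shift)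

lemma graph_point_e[simp]: "graph_point e \<phi> x \<bullet> e = \<phi> x"
  by (simp add: graph_point_def inner_diff_left inner_add_left)

lemma gradient_graph_point[simp]: "gradient \<phi> (graph_point e \<phi> x) = gradient \<phi> x"
  by (simp add: graph_point_eq gradient_shift_e)

lemma GDERIV_graph_point[simp]: "GDERIV \<phi> (graph_point e \<phi> x) :> D \<longleftrightarrow> GDERIV \<phi> x :> D"
  by (simp add: graph_point_eq GDERIV_shift_e)

lemma GDERIV_orthogonal:
  assumes "GDERIV \<phi> x :> D" shows "D \<bullet> e = 0"
proof -
  have "((\<lambda>t. 0) \<longlongrightarrow> e \<bullet> D) (at (0::real))"
    using GDERIV_direction[OF assms, of e] phi_shift by simp
  then show ?thesis by (metis tendsto_const_iff at_neq_bot inner_commute)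
qed

text \<open>Pythagoras, since D is orthogonal to the unit vector e.\<close>

lemma norm_GDERIV_minus_e:
  assumes "GDERIV \<phi> x :> D"
  shows "norm (D - e) = sqrt (1 + (norm D)\<^sup>2)"
  using GDERIV_orthogonal[OF assms]
  by (simp add: norm_eq_sqrt_inner inner_diff_left inner_diff_right inner_commute)

lemma graph_normal_graph_point[simp]: "graph_normal e \<phi> (graph_point e \<phi> x) = graph_normal e \<phi> x"
  by (simp add: graph_normal_def)

lemma norm_graph_normal:
  assumes "GDERIV \<phi> x :> D"
  shows "norm (graph_normal e \<phi> x) = 1"
proof -
  have "1 + (norm D)\<^sup>2 > 0" by (simp add: add_pos_nonneg)
  then show ?thesis
    using norm_GDERIV_minus_e[OF assms] by (simp add: graph_normal_def gradient_eq[OF assms])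
qed

lemma graph_point_meas[measurable]: "graph_point e \<phi> \<in> borel_measurable borel"
  unfolding graph_point_def by measurable

lemma graph_normal_meas[measurable]: "graph_normal e \<phi> \<in> borel_measurable borel"
  unfolding graph_normal_def by measurable

abbreviation "slab \<equiv> {x. 0 \<le> x \<bullet> e \<and> x \<bullet> e \<le> 1}"
abbreviation "wt \<equiv> \<lambda>x. sqrt (1 + (norm (gradient \<phi> x))\<^sup>2)"

lemma slab_meas[measurable]: "slab \<in> sets borel" by measurable

lemma nn_integral_graph_measure_aux:
  assumes [measurable]: "f \<in> borel_measurable borel"
  shows "(\<integral>\<^sup>+y. f y \<partial>graph_measure e \<phi>) = (\<integral>\<^sup>+x. ennreal (indicator slab x * wt x) * f (graph_point e \<phi> x) \<partial>lborel)"
proof -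
  have H: "(\<integral>\<^sup>+y. h y \<partial>hyperplane_lebesgue e) = (\<integral>\<^sup>+x. indicator slab x * h (x - (x \<bullet> e) *\<^sub>R e) \<partial>lborel)"
    if [measurable]: "h \<in> borel_measurable borel" for h
  proof -
    have "(\<integral>\<^sup>+y. h y \<partial>hyperplane_lebesgue e) = (\<integral>\<^sup>+x. h (x - (x \<bullet> e) *\<^sub>R e) \<partial>restrict_space lborel slab)"
      unfolding hyperplane_lebesgue_def
      by (intro nn_integral_distr measurable_restrict_space1) measurable
    also have "\<dots> = (\<integral>\<^sup>+x. h (x - (x \<bullet> e) *\<^sub>R e) * indicator slab x \<partial>lborel)"
      by (subst nn_integral_restrict_space) auto
    finally show ?thesis by (simp add: mult.commute)
  qed
  have sets_H[measurable_cong]: "sets (hyperplane_lebesgue e) = sets borel" by (simp add: hyperplane_lebesgue_def)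
  have "(\<integral>\<^sup>+y. f y \<partial>graph_measure e \<phi>) = 
     (\<integral>\<^sup>+y. f (y + \<phi> y *\<^sub>R e) \<partial>density (hyperplane_lebesgue e) (\<lambda>y. ennreal (wt y)))"
    unfolding graph_measure_def by (intro nn_integral_distr) measurable
  also have "\<dots> = (\<integral>\<^sup>+y. ennreal (wt y) * f (y + \<phi> y *\<^sub>R e) \<partial>hyperplane_lebesgue e)"
    by (intro nn_integral_density) measurable
  also have "\<dots> = (\<integral>\<^sup>+x. indicator slab x * (ennreal (wt (x - (x \<bullet> e) *\<^sub>R e)) *
       f (x - (x \<bullet> e) *\<^sub>R e + \<phi> (x - (x \<bullet> e) *\<^sub>R e) *\<^sub>R e)) \<partial>lborel)"
    by (intro H) measurable
  also have "\<dots> = (\<integral>\<^sup>+x. ennreal (indicator slab x * wt x) * f (graph_point e \<phi> x) \<partial>lborel)"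
    using gradient_shift_e[of _ "- t" for t]
    by (intro nn_integral_cong) (simp add: graph_point_def[symmetric] ennreal_mult' ennreal_indicator mult_ac)
  finally show ?thesis .
qed

lemma graph_measure_eq:
  "graph_measure e \<phi> = distr (density lborel (\<lambda>x. ennreal (indicator slab x * wt x))) borel (graph_point e \<phi>)"
proof (rule measure_eqI)
  fix A assume "A \<in> sets (graph_measure e \<phi>)"
  then have A[measurable]: "A \<in> sets borel" by (simp add: graph_measure_def)
  have "emeasure (graph_measure e \<phi>) A = (\<integral>\<^sup>+y. indicator A y \<partial>graph_measure e \<phi>)"
    by (simp add: graph_measure_def)
  also have "\<dots> = (\<integral>\<^sup>+x. ennreal (indicator slab x * wt x) * indicator A (graph_point e \<phi> x) \<partial>lborel)"
    by (intro nn_integral_graph_measure_aux) simp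
  also have "\<dots> = (\<integral>\<^sup>+x. indicator A (graph_point e \<phi> x) \<partial>density lborel (\<lambda>x. ennreal (indicator slab x * wt x)))"
    by (intro nn_integral_density[symmetric]) measurable
  also have "\<dots> = (\<integral>\<^sup>+y. indicator A y \<partial>distr (density lborel (\<lambda>x. ennreal (indicator slab x * wt x))) borel (graph_point e \<phi>))"
    by (intro nn_integral_distr[symmetric]) auto
  finally show "emeasure (graph_measure e \<phi>) A = emeasure (distr (density lborel (\<lambda>x. ennreal (indicator slab x * wt x))) borel (graph_point e \<phi>)) A"
    by simp
qed (simp add: graph_measure_def)

lemma sets_graph_measure[simp, measurable_cong]: "sets (graph_measure e \<phi>) = sets borel"
  by (simp add: graph_measure_def)

lemma integral_graph_measure:
  fixes f :: "'a \<Rightarrow> real"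
  assumes [measurable]: "f \<in> borel_measurable borel"
  shows "(\<integral>y. f y \<partial>graph_measure e \<phi>) = (\<integral>x. indicator slab x * wt x * f (graph_point e \<phi> x) \<partial>lborel)"
proof -
  have "(\<integral>y. f y \<partial>graph_measure e \<phi>) = (\<integral>x. f (graph_point e \<phi> x) \<partial>density lborel (\<lambda>x. ennreal (indicator slab x * wt x)))"
    unfolding graph_measure_eq by (intro integral_distr) auto
  also have "\<dots> = (\<integral>x. indicator slab x * wt x * f (graph_point e \<phi> x) \<partial>lborel)"
    by (subst integral_density) auto
  finally show ?thesis .
qed

lemma AE_graph_measure:
  assumes [measurable]: "{y. P y} \<in> sets borel" and "AE x in lborel. P (graph_point e \<phi> x)"
  shows "AE y in graph_measure e \<phi>. P y"
proof -
  have [measurable]: "Measurable.pred borel P" by (simp add: pred_def)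
  have "AE x in density lborel (\<lambda>x. ennreal (indicator slab x * wt x)). P (graph_point e \<phi> x)"
    using assms(2) by (subst AE_density) auto
  then show ?thesis
    unfolding graph_measure_eq by (subst AE_distr_iff) auto
qed

text \<open>Differentiability is constant along e, so Rademacher's theorem in the full space passes
  to almost every point of the graph.\<close>

lemma AE_graph_measure_GDERIV:
  "AE y in graph_measure e \<phi>. GDERIV \<phi> y :> gradient \<phi> y \<and> \<phi> y = y \<bullet> e"
proof -
  have "{y. GDERIV \<phi> y :> gradient \<phi> y} = {y. \<exists>D. GDERIV \<phi> y :> D}"
    using GDERIV_gradient by blast
  then have "{y. GDERIV \<phi> y :> gradient \<phi> y} \<in> sets borel"
    using sets_GDERIV_phi[OF lip] by simp
  moreover have "{y. \<phi> y = y \<bullet> e} \<in> sets borel" by measurable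
  ultimately have "{y. GDERIV \<phi> y :> gradient \<phi> y \<and> \<phi> y = y \<bullet> e} \<in> sets borel"
    by (simp add: Collect_conj_eq sets.Int)
  then show ?thesis
    by (rule AE_graph_measure) (use rademacher[OF lip] in simp)
qed

text \<open>The component of x orthogonal to e is the shortest point on the line x + s e, and a
  point of the slab differs from it by at most 1.\<close>

lemma slab_support:
  assumes "x \<in> slab" "norm (x + s *\<^sub>R e) \<le> R"
  shows "norm x \<le> R + 1"
proof -
  have "norm (x - (x \<bullet> e) *\<^sub>R e) \<le> norm (x + s *\<^sub>R e)"
  proof -
    have "(norm (x - (x \<bullet> e) *\<^sub>R e))\<^sup>2 + (x \<bullet> e + s)\<^sup>2 = (norm (x + s *\<^sub>R e))\<^sup>2"
      unfolding power2_norm_eq_inner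
      by (simp add: inner_diff_left inner_diff_right inner_add_left inner_add_right inner_commute power2_eq_square algebra_simps)
    then have "(norm (x - (x \<bullet> e) *\<^sub>R e))\<^sup>2 \<le> (norm (x + s *\<^sub>R e))\<^sup>2"
      using zero_le_power2[of "x \<bullet> e + s"] by linarith
    then show ?thesis by (simp add: power2_le_iff_abs_le)
  qed
  moreover have "norm ((x \<bullet> e) *\<^sub>R e) \<le> 1" using assms(1) norm_e by simp
  ultimately show ?thesis
    using assms(2) norm_triangle_sub[of x "(x \<bullet> e) *\<^sub>R e"] by linarith
qed

text \<open>By Rademacher's theorem the weight is at most sqrt (1 + L^2) almost everywhere, and the
  slab points whose graph point lies in A stay in a ball.\<close>

lemma emeasure_graph_measure_bounded:
  assumes "bounded A" and [measurable]: "A \<in> sets borel"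
  shows "emeasure (graph_measure e \<phi>) A < \<infinity>"
proof -
  obtain R where R: "A \<subseteq> cball 0 R"
    using assms(1) bounded_subset_ballD[of A 0] by (metis ball_subset_cball order_trans)
  have "AE x in lborel. ennreal (indicator slab x * wt x) * indicator A (graph_point e \<phi> x) \<le>
      ennreal (sqrt (1 + L\<^sup>2)) * indicator (cball 0 (R + 1)) x"
    using rademacher[OF lip]
  proof eventually_elim
    case (elim x)
    have "norm (gradient \<phi> x) \<le> L" using norm_GDERIV_le[OF lip elim] .
    then have w: "wt x \<le> sqrt (1 + L\<^sup>2)" by (simp add: power_mono)
    show ?case
    proof (cases "x \<in> slab \<and> graph_point e \<phi> x \<in> A")
      case True
      then have "norm (graph_point e \<phi> x) \<le> R" using R by auto
      then have "norm x \<le> R + 1" using True slab_support[of x] by (simp add: graph_point_eq)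
      with True w show ?thesis by (simp add: ennreal_leI)
    qed auto
  qed
  then have "(\<integral>\<^sup>+y. indicator A y \<partial>graph_measure e \<phi>) \<le> (\<integral>\<^sup>+x. ennreal (sqrt (1 + L\<^sup>2)) * indicator (cball 0 (R + 1) :: 'a set) x \<partial>lborel)"
    by (subst nn_integral_graph_measure_aux) (simp, rule nn_integral_mono_AE)
  also have "\<dots> = ennreal (sqrt (1 + L\<^sup>2)) * emeasure lborel (cball 0 (R + 1) :: 'a set)"
    by (intro nn_integral_cmult_indicator) simp
  also have "\<dots> < \<infinity>"
    using emeasure_bounded_finite[of "cball (0::'a) (R+1)"]
    by (simp add: ennreal_mult_less_top)
  finally show ?thesis by simp
qed

text \<open>Rademacher's theorem turns the pointwise limit of the difference quotients of the graph function
  into the normal.\<close>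

lemma graph_flux:
  fixes f :: "'a \<Rightarrow> real"
  assumes f: "continuous_on UNIV f" and supp: "\<And>x. norm x > R \<Longrightarrow> f x = 0"
  shows "((\<lambda>t. (\<integral>x. f x * (indicator {x. \<phi> x < x \<bullet> e} (x - t *\<^sub>R d) - indicator {x. \<phi> x < x \<bullet> e} x) \<partial>lborel) / t)
           \<longlongrightarrow> (\<integral>y. f y * (d \<bullet> graph_normal e \<phi> y) \<partial>graph_measure e \<phi>)) (at 0)"
proof -
  let ?E = "{x. \<phi> x < x \<bullet> e}"
  have [measurable]: "f \<in> borel_measurable borel" using f by (rule borel_measurable_continuous_onI)
  have [measurable]: "?E \<in> sets borel" by measurable
  have "compact (f ` cball 0 R)" using f by (intro compact_continuous_image continuous_on_subset[OF f]) auto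
  then have "bounded (f ` cball 0 R)" by (rule compact_imp_bounded)
  then obtain M where "\<And>x. norm x \<le> R \<Longrightarrow> \<bar>f x\<bar> \<le> M"
    unfolding bounded_real by (metis image_eqI mem_cball_0)
  then have M: "\<bar>f x\<bar> \<le> \<bar>M\<bar>" for x using supp[of x] abs_ge_self[of M] by (cases "norm x \<le> R") (auto intro: order_trans)
  \<comment> \<open>The point x + s e lies in the epigraph translated by t d exactly if s >
    \<open>a t x\<close>; on each line, translating the set amounts to moving one number.\<close>
  define a where "a t x = \<phi> (x - t *\<^sub>R d) - x \<bullet> e + t * (d \<bullet> e)" for t x
  define C where "C = (L + 1) * norm d"
  have C0: "C \<ge> 0" using L_nonneg by (simp add: C_def)
  have a_diff: "\<bar>a 0 x - a t x\<bar> \<le> C * \<bar>t\<bar>" for t x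
  proof -
    have "\<bar>\<phi> x - \<phi> (x - t *\<^sub>R d)\<bar> \<le> L * norm (x - (x - t *\<^sub>R d))" by (rule lip_abs[OF lip])
    moreover have "\<bar>t * (d \<bullet> e)\<bar> \<le> \<bar>t\<bar> * norm d"
      using Cauchy_Schwarz_ineq2[of d e] norm_e by (simp add: abs_mult mult_left_mono)
    ultimately show ?thesis by (simp add: a_def C_def algebra_simps)
  qed
  define F where "F t x = f x * (indicator ?E (x - t *\<^sub>R d) - indicator ?E x)" for t x
  have F_line: "F t (x + s *\<^sub>R e) = f (x + s *\<^sub>R e) * (indicator {a t x<..} s - indicator {a 0 x<..} s)" for t x s
  proof -
    have "x + s *\<^sub>R e - t *\<^sub>R d \<in> ?E \<longleftrightarrow> s \<in> {a t x<..}"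
      using phi_shift''[of x s "- t *\<^sub>R d"] by (auto simp: a_def inner_diff_left inner_add_left)
    moreover have "x + s *\<^sub>R e \<in> ?E \<longleftrightarrow> s \<in> {a 0 x<..}"
      by (auto simp: a_def inner_add_left phi_shift)
    ultimately show ?thesis unfolding F_def indicator_def by presburger
  qed
  have [measurable]: "F t \<in> borel_measurable borel" for t unfolding F_def by measurable
  have intF: "integrable lborel (F t)" for t
  proof (rule Bochner_Integration.integrable_bound)
    show "integrable lborel (\<lambda>x. \<bar>M\<bar> * indicator (cball 0 R) x :: real)"
      by (intro integrable_mult_right integrable_real_indicator emeasure_bounded_finite) auto
    show "AE x in lborel. norm (F t x) \<le> norm (\<bar>M\<bar> * indicator (cball 0 R) x :: real)"
    proof (rule AE_I2)
      fix x show "norm (F t x) \<le> norm (\<bar>M\<bar> * indicator (cball 0 R) x :: real)"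
        using M[of x] supp[of x] by (cases "norm x \<le> R") (auto simp: F_def indicator_def)
    qed
  qed measurable
  define J where "J t x = (\<integral>s. f (x + s *\<^sub>R e) * (indicator {a t x<..} s - indicator {a 0 x<..} s) \<partial>lborel)" for t x
  have Jalt: "J t x = (\<integral>s. F t (x + s *\<^sub>R e) \<partial>lborel)" for t x
    unfolding J_def F_line ..
  have J_meas[measurable]: "J t \<in> borel_measurable borel" for t
    unfolding Jalt[abs_def] by measurable
  have IF: "(\<integral>x. F t x \<partial>lborel) = (\<integral>x. indicator slab x * J t x \<partial>lborel)" for t
    using integral_slab[OF intF e_nz, of t] by (simp add: Jalt)
  have Jb: "\<bar>J t x\<bar> \<le> \<bar>M\<bar> * (C * \<bar>t\<bar>)" for t x
  proof -
    have "\<bar>J t x\<bar> \<le> \<bar>M\<bar> * \<bar>a 0 x - a t x\<bar>"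
      using integral_indicator_ray_diff[of "\<lambda>s. f (x + s *\<^sub>R e)" "a t x" "a 0 x" 0 "\<bar>M\<bar>"] M by (simp add: J_def)
    also have "\<dots> \<le> \<bar>M\<bar> * (C * \<bar>t\<bar>)" using a_diff by (intro mult_left_mono) auto
    finally show ?thesis .
  qed
  have J0: "J t x = 0" if "x \<in> slab" "norm x > R + 1" for t x
  proof -
    have "f (x + s *\<^sub>R e) = 0" for s using slab_support[of x s R] that supp[of "x + s *\<^sub>R e"] by force
    then show ?thesis by (simp add: J_def)
  qed
  \<comment> \<open>The length gained on the line is \<open>a 0 x - a t x\<close>. Divided by t it
    tends to d . (grad \<phi> - e), the normal before normalisation.\<close>
  have Jlim: "((\<lambda>t. J t x / t) \<longlongrightarrow> f (graph_point e \<phi> x) * (d \<bullet> (gradient \<phi> x - e))) (at 0)"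
    if G: "GDERIV \<phi> x :> gradient \<phi> x" for x
  proof -
    have gp: "graph_point e \<phi> x = x + a 0 x *\<^sub>R e" by (simp add: graph_point_eq a_def)
    have cf: "isCont (\<lambda>s. f (x + s *\<^sub>R e)) (a 0 x)"
    proof -
      have "continuous_on UNIV (\<lambda>s. f (x + s *\<^sub>R e))"
        by (rule continuous_on_compose2[OF f]) (auto intro!: continuous_intros)
      then show ?thesis by (simp add: continuous_on_eq_continuous_at)
    qed
    have lim1: "((\<lambda>t. f (graph_point e \<phi> x) * ((a 0 x - a t x) / t)) \<longlongrightarrow> f (graph_point e \<phi> x) * (d \<bullet> (gradient \<phi> x - e))) (at 0)"
    proof (intro tendsto_mult tendsto_const)
      have "((\<lambda>t. - ((\<phi> (x + t *\<^sub>R (-d)) - \<phi> x) / t) - d \<bullet> e) \<longlongrightarrow> - ((-d) \<bullet> gradient \<phi> x) - d \<bullet> e) (at 0)"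
        by (intro tendsto_intros GDERIV_direction G)
      then have "((\<lambda>t. - ((\<phi> (x + t *\<^sub>R (-d)) - \<phi> x) / t) - d \<bullet> e) \<longlongrightarrow> d \<bullet> (gradient \<phi> x - e)) (at 0)"
        by (simp add: inner_diff_right)
      then show "((\<lambda>t. (a 0 x - a t x) / t) \<longlongrightarrow> d \<bullet> (gradient \<phi> x - e)) (at 0)"
        by (rule Lim_transform_eventually) (auto simp: eventually_at_filter a_def field_simps)
    qed
    have lim2: "((\<lambda>t. J t x / t - f (graph_point e \<phi> x) * ((a 0 x - a t x) / t)) \<longlongrightarrow> 0) (at 0)"
    proof (rule tendstoI)
      fix \<epsilon> :: real assume "\<epsilon> > 0"
      define \<eta> where "\<eta> = \<epsilon> / (C + 1)"
      have "\<eta> > 0" using \<open>\<epsilon> > 0\<close> C0 by (simp add: \<eta>_def)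
      then obtain r where r: "r > 0" "\<And>s. \<bar>s - a 0 x\<bar> < r \<Longrightarrow> \<bar>f (x + s *\<^sub>R e) - f (x + a 0 x *\<^sub>R e)\<bar> < \<eta>"
        using cf unfolding continuous_at_eps_delta dist_real_def by blast
      have bnd: "\<bar>J t x / t - f (graph_point e \<phi> x) * ((a 0 x - a t x) / t)\<bar> < \<epsilon>" if t: "t \<noteq> 0" "\<bar>t\<bar> < r / (C + 1)" for t
      proof -
        have "\<bar>a 0 x - a t x\<bar> \<le> C * \<bar>t\<bar>" by (rule a_diff)
        also have "\<dots> \<le> (C + 1) * \<bar>t\<bar>" by (simp add: distrib_right)
        also have "\<dots> < r" using t C0 by (simp add: field_simps)
        finally have near: "\<bar>a 0 x - a t x\<bar> < r" .
        have "\<bar>J t x - f (graph_point e \<phi> x) * (a 0 x - a t x)\<bar> \<le> \<eta> * \<bar>a 0 x - a t x\<bar>"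
          unfolding J_def gp
        proof (rule integral_indicator_ray_diff)
          fix s assume "min (a t x) (a 0 x) \<le> s" "s \<le> max (a t x) (a 0 x)"
          then have "\<bar>s - a 0 x\<bar> < r" using near by linarith
          then show "\<bar>f (x + s *\<^sub>R e) - f (x + a 0 x *\<^sub>R e)\<bar> \<le> \<eta>" using r(2) by force
        qed measurable
        also have "\<dots> \<le> \<eta> * (C * \<bar>t\<bar>)" using a_diff \<open>\<eta> > 0\<close> by (intro mult_left_mono) auto
        also have "\<dots> < \<epsilon> * \<bar>t\<bar>"
        proof -
          have "\<eta> * C < \<epsilon>" using \<open>\<epsilon> > 0\<close> C0 by (simp add: \<eta>_def divide_less_eq)
          then show ?thesis using t by (simp add: mult.assoc[symmetric])
        qed
        finally have "\<bar>J t x - f (graph_point e \<phi> x) * (a 0 x - a t x)\<bar> / \<bar>t\<bar> < \<epsilon>"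
          using t by (simp add: divide_less_eq)
        then show ?thesis
          by (simp add: abs_divide[symmetric] diff_divide_distrib right_diff_distrib)
      qed
      show "\<forall>\<^sub>F t in at 0. dist (J t x / t - f (graph_point e \<phi> x) * ((a 0 x - a t x) / t)) 0 < \<epsilon>"
        unfolding eventually_at using bnd r(1) C0 by (intro exI[of _ "r / (C + 1)"]) auto
    qed
    from tendsto_add[OF lim2 lim1] show ?thesis by simp
  qed
  \<comment> \<open>The weight of the graph measure is the very factor by which
    \<open>graph_normal\<close> divides, so the two cancel.\<close>
  have rhs: "(\<integral>y. f y * (d \<bullet> graph_normal e \<phi> y) \<partial>graph_measure e \<phi>) =
      (\<integral>x. indicator slab x * (f (graph_point e \<phi> x) * (d \<bullet> (gradient \<phi> x - e))) \<partial>lborel)"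
  proof (subst integral_graph_measure)
    have w: "wt x \<noteq> 0" for x using add_pos_nonneg[OF zero_less_one, of "(norm (gradient \<phi> x))\<^sup>2"] by simp
    show "(\<integral>x. indicator slab x * wt x * (f (graph_point e \<phi> x) * (d \<bullet> graph_normal e \<phi> (graph_point e \<phi> x))) \<partial>lborel) =
        (\<integral>x. indicator slab x * (f (graph_point e \<phi> x) * (d \<bullet> (gradient \<phi> x - e))) \<partial>lborel)"
    proof (intro Bochner_Integration.integral_cong refl)
      fix x
      have "wt x * (d \<bullet> graph_normal e \<phi> x) = d \<bullet> (gradient \<phi> x - e)"
        using w[of x] by (simp add: graph_normal_def)
      then show "indicator slab x * wt x * (f (graph_point e \<phi> x) * (d \<bullet> graph_normal e \<phi> (graph_point e \<phi> x))) =
        indicator slab x * (f (graph_point e \<phi> x) * (d \<bullet> (gradient \<phi> x - e)))"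
        by (simp add: mult_ac)
    qed
  qed measurable
  show ?thesis
    unfolding F_def[symmetric] IF rhs
  proof (subst tendsto_at_iff_sequentially, intro allI impI)
    fix X :: "nat \<Rightarrow> real" assume X: "\<forall>i. X i \<in> UNIV - {0}" "X \<longlonglongrightarrow> 0"
    have "(\<lambda>i. \<integral>x. indicator slab x * (J (X i) x / X i) \<partial>lborel) \<longlonglongrightarrow>
        (\<integral>x. indicator slab x * (f (graph_point e \<phi> x) * (d \<bullet> (gradient \<phi> x - e))) \<partial>lborel)"
    proof (rule integral_dominated_convergence[where w="\<lambda>x. (\<bar>M\<bar> * C) * indicator (cball 0 (R + 1)) x"])
      show "integrable lborel (\<lambda>x. (\<bar>M\<bar> * C) * indicator (cball 0 (R + 1)) x :: real)"
        by (intro integrable_mult_right integrable_real_indicator emeasure_bounded_finite) auto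
      show "AE x in lborel. (\<lambda>i. indicator slab x * (J (X i) x / X i)) \<longlonglongrightarrow>
         indicator slab x * (f (graph_point e \<phi> x) * (d \<bullet> (gradient \<phi> x - e)))"
        using rademacher[OF lip]
      proof eventually_elim
        case (elim x)
        have "filterlim X (at 0) sequentially" using X by (simp add: filterlim_at)
        from filterlim_compose[OF Jlim[OF elim] this] show ?case
          by (intro tendsto_mult tendsto_const) (simp add: o_def)
      qed
      show "AE x in lborel. norm (indicator slab x * (J (X i) x / X i)) \<le> \<bar>M\<bar> * C * indicator (cball 0 (R + 1)) x" for i
      proof (rule AE_I2)
        fix x
        have "X i \<noteq> 0" using X by auto
        then have "\<bar>J (X i) x / X i\<bar> \<le> \<bar>M\<bar> * C"
          using Jb[of "X i" x] by (simp add: abs_divide divide_le_eq mult_ac)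
        then show "norm (indicator slab x * (J (X i) x / X i)) \<le> \<bar>M\<bar> * C * indicator (cball 0 (R + 1)) x"
          using J0[of x "X i"] C0 by (cases "x \<in> slab"; cases "norm x \<le> R + 1") (auto simp: not_le)
      qed
    qed measurable
    then show "((\<lambda>t. (\<integral>x. indicator slab x * J t x \<partial>lborel) / t) \<circ> X) \<longlonglongrightarrow>
        (\<integral>x. indicator slab x * (f (graph_point e \<phi> x) * (d \<bullet> (gradient \<phi> x - e))) \<partial>lborel)"
      by (simp add: o_def)
  qed
qed

end

section \<open>Chart independence of the graph measure\<close>

lemma integrable_bounded_support:
  fixes f :: "'a \<Rightarrow> real"
  assumes "f \<in> borel_measurable M" "A \<in> sets M" "emeasure M A < \<infinity>"
    and "\<And>x. \<bar>f x\<bar> \<le> c" "\<And>x. x \<notin> A \<Longrightarrow> f x = 0"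
  shows "integrable M f"
proof (rule Bochner_Integration.integrable_bound)
  show "integrable M (\<lambda>x. c * indicator A x)"
    using assms(2,3) by (intro integrable_mult_right integrable_real_indicator)
  show "AE x in M. norm (f x) \<le> norm (c * indicator A x)"
  proof (rule AE_I2)
    fix x show "norm (f x) \<le> norm (c * indicator A x)"
      using assms(4)[of x] assms(5)[of x] by (cases "x \<in> A") auto
  qed
qed fact

text \<open>Models two charts on the overlap V: the vector measures n1 G1 and n2 G2 agree on
  continuous functions with compact support in V. The norms of n1 and n2 are at most 1 everywhere,
  not only almost everywhere, so that bounded functions on bounded sets are integrable without
  further exceptions.\<close>

locale same_flux =
  fixes G1 G2 :: "'a::euclidean_space measure" and n1 n2 :: "'a \<Rightarrow> 'a" and V :: "'a set"
  assumes sets1[simp, measurable_cong]: "sets G1 = sets borel" and sets2[simp, measurable_cong]: "sets G2 = sets borel"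
    and fin1: "\<And>A. bounded A \<Longrightarrow> A \<in> sets borel \<Longrightarrow> emeasure G1 A < \<infinity>"
    and fin2: "\<And>A. bounded A \<Longrightarrow> A \<in> sets borel \<Longrightarrow> emeasure G2 A < \<infinity>"
    and n1m[measurable]: "n1 \<in> borel_measurable borel" and n2m[measurable]: "n2 \<in> borel_measurable borel"
    and n1_le: "\<And>y. norm (n1 y) \<le> 1" and n2_le: "\<And>y. norm (n2 y) \<le> 1"
    and openV: "open V"
    and flux: "\<And>f d K. continuous_on UNIV f \<Longrightarrow> compact K \<Longrightarrow> K \<subseteq> V \<Longrightarrow> (\<And>x. x \<notin> K \<Longrightarrow> f x = 0) \<Longrightarrow>
      (\<integral>y. f y * (d \<bullet> n1 y) \<partial>G1) = (\<integral>y. f y * (d \<bullet> n2 y) \<partial>G2)"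
begin

lemma space12[simp]: "space G1 = UNIV" "space G2 = UNIV"
  using sets_eq_imp_space_eq[OF sets1] sets_eq_imp_space_eq[OF sets2] by auto

context
  fixes W :: "'a set"
  assumes W: "open W" "bounded W" "closure W \<subseteq> V"
begin

lemma sets_W[measurable]: "W \<in> sets borel" using W by simp

lemma bound_inner: "norm n \<le> 1 \<Longrightarrow> \<bar>d \<bullet> n\<bar> \<le> norm d" for n d :: 'a
  using Cauchy_Schwarz_ineq2[of d n] mult_left_mono[of "norm n" 1 "norm d"] by simp

lemma integrable_flux1: "(\<And>y. \<bar>g y\<bar> \<le> c) \<Longrightarrow> g \<in> borel_measurable borel \<Longrightarrow> integrable G1 (\<lambda>y. g y * indicator W y * (d \<bullet> n1 y))"
  using fin1[of W] W(2) order_trans[OF abs_ge_zero, of "g undefined" c]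
  by (intro integrable_bounded_support[where c="c * norm d" and A=W])
     (auto simp: abs_mult indicator_def intro!: mult_mono bound_inner n1_le)

lemma integrable_flux2: "(\<And>y. \<bar>g y\<bar> \<le> c) \<Longrightarrow> g \<in> borel_measurable borel \<Longrightarrow> integrable G2 (\<lambda>y. g y * indicator W y * (d \<bullet> n2 y))"
  using fin2[of W] W(2) order_trans[OF abs_ge_zero, of "g undefined" c]
  by (intro integrable_bounded_support[where c="c * norm d" and A=W])
     (auto simp: abs_mult indicator_def intro!: mult_mono bound_inner n2_le)

lemma flux_limit:
  assumes lim: "\<And>y. (\<lambda>i. g i y) \<longlonglongrightarrow> g' y" and b: "\<And>i y. \<bar>g i y\<bar> \<le> c"
    and m[measurable]: "\<And>i. g i \<in> borel_measurable borel" "g' \<in> borel_measurable borel"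
    and eq: "\<And>i. (\<integral>y. g i y * indicator W y * (d \<bullet> n1 y) \<partial>G1) = (\<integral>y. g i y * indicator W y * (d \<bullet> n2 y) \<partial>G2)"
  shows "(\<integral>y. g' y * indicator W y * (d \<bullet> n1 y) \<partial>G1) = (\<integral>y. g' y * indicator W y * (d \<bullet> n2 y) \<partial>G2)"
proof -
  have c: "0 \<le> c" using order_trans[OF abs_ge_zero b] .
  have "(\<lambda>i. \<integral>y. g i y * indicator W y * (d \<bullet> n1 y) \<partial>G1) \<longlonglongrightarrow> (\<integral>y. g' y * indicator W y * (d \<bullet> n1 y) \<partial>G1)"
  proof (rule integral_dominated_convergence[where w="\<lambda>y. c * norm d * indicator W y"])
    show "integrable G1 (\<lambda>y. c * norm d * indicator W y)"
      using fin1[of W] W by (intro integrable_mult_right integrable_real_indicator) auto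
    show "AE y in G1. norm (g i y * indicator W y * (d \<bullet> n1 y)) \<le> c * norm d * indicator W y" for i
      using b c by (intro AE_I2) (auto simp: abs_mult indicator_def intro!: mult_mono bound_inner n1_le)
  qed (auto intro!: AE_I2 tendsto_intros lim)
  moreover have "(\<lambda>i. \<integral>y. g i y * indicator W y * (d \<bullet> n2 y) \<partial>G2) \<longlonglongrightarrow> (\<integral>y. g' y * indicator W y * (d \<bullet> n2 y) \<partial>G2)"
  proof (rule integral_dominated_convergence[where w="\<lambda>y. c * norm d * indicator W y"])
    show "integrable G2 (\<lambda>y. c * norm d * indicator W y)"
      using fin2[of W] W by (intro integrable_mult_right integrable_real_indicator) auto
    show "AE y in G2. norm (g i y * indicator W y * (d \<bullet> n2 y)) \<le> c * norm d * indicator W y" for i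
      using b c by (intro AE_I2) (auto simp: abs_mult indicator_def intro!: mult_mono bound_inner n2_le)
  qed (auto intro!: AE_I2 tendsto_intros lim)
  ultimately show ?thesis unfolding eq by (rule LIMSEQ_unique)
qed

text \<open>The functions min 1 (i dist) increase to the indicator of the open set. Intersecting
  with the bounded set W makes the complement nonempty, so that the distance to it is
  meaningful.\<close>

lemma flux_open:
  assumes A: "open A"
  shows "(\<integral>y. indicator A y * indicator W y * (d \<bullet> n1 y) \<partial>G1) = (\<integral>y. indicator A y * indicator W y * (d \<bullet> n2 y) \<partial>G2)"
proof -
  let ?O = "A \<inter> W"
  have O: "open ?O" "bounded ?O" using A W by (auto intro: bounded_subset)
  have "?O \<noteq> UNIV" using O(2) not_bounded_UNIV by metis
  then have ne: "- ?O \<noteq> {}" by blast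
  define g where "g i y = min 1 (real i * infdist y (- ?O))" for i y
  have gc: "continuous_on UNIV (g i)" for i unfolding g_def by (intro continuous_intros)
  have g0: "g i y = 0" if "y \<notin> ?O" for i y using that by (simp add: g_def)
  have gW: "g i y * indicator W y = g i y" for i y using g0[of y i] by (auto simp: indicator_def)
  have lim: "(\<lambda>i. g i y) \<longlonglongrightarrow> indicator ?O y" for y
  proof (cases "y \<in> ?O")
    case True
    have "infdist y (- ?O) \<noteq> 0"
      using O(1) ne True by (subst in_closed_iff_infdist_zero[symmetric]) (auto simp: closed_def)
    then have pos: "infdist y (- ?O) > 0" using infdist_nonneg[of y "- ?O"] by linarith
    obtain N :: nat where N: "1 / infdist y (- ?O) < real N" using reals_Archimedean2 by blast
    have "\<forall>\<^sub>F i in sequentially. g i y = 1"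
    proof (rule eventually_sequentiallyI[of N])
      fix i assume "i \<ge> N"
      then have "1 / infdist y (- ?O) \<le> real i" using N by linarith
      then show "g i y = 1" using pos by (simp add: g_def divide_le_eq)
    qed
    then show ?thesis using True by (intro tendsto_eventually) (auto elim: eventually_mono)
  qed (simp add: g0)
  have ind: "indicator A y * indicator W y = (indicator ?O y * indicator W y :: real)" for y
    by (simp add: indicator_def)
  show ?thesis
    unfolding ind
  proof (rule flux_limit[where g=g and c=1, OF lim])
    show "g i \<in> borel_measurable borel" for i by (intro borel_measurable_continuous_onI gc)
    show "indicator ?O \<in> borel_measurable borel" using O by (intro borel_measurable_indicator) simp
    show "\<bar>g i y\<bar> \<le> 1" for i y by (simp add: g_def infdist_nonneg)
    show "(\<integral>y. g i y * indicator W y * (d \<bullet> n1 y) \<partial>G1) = (\<integral>y. g i y * indicator W y * (d \<bullet> n2 y) \<partial>G2)" for i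
      unfolding gW
    proof (rule flux[OF gc, where K="closure W"])
      show "x \<notin> closure W \<Longrightarrow> g i x = 0" for x using closure_subset g0 by blast
    qed (use W in \<open>auto simp: compact_closure\<close>)
  qed
qed

text \<open>Dynkin's argument: the open sets are stable under intersection, and the identity passes
  to complements and to countable disjoint unions.\<close>

lemma flux_set:
  assumes A: "A \<in> sets borel"
  shows "(\<integral>y. indicator A y * indicator W y * (d \<bullet> n1 y) \<partial>G1) = (\<integral>y. indicator A y * indicator W y * (d \<bullet> n2 y) \<partial>G2)"
proof -
  have bs: "sets (borel :: 'a measure) = sigma_sets UNIV {S. open S}"
    by (simp add: borel_def)
  have A': "A \<in> sigma_sets UNIV {S. open S}" using A bs by simp
  have st: "Int_stable {S::'a set. open S}" by (auto simp: Int_stable_def)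
  have "{S::'a set. open S} \<subseteq> Pow UNIV" by simp
  from st this A' show ?thesis
  proof (induct rule: sigma_sets_induct_disjoint)
    case (basic A) then show ?case by (intro flux_open) simp
  next
    case empty then show ?case by simp
  next
    case (compl A)
    then have [measurable]: "A \<in> sets borel" using bs by simp
    have ind: "indicator (UNIV - A) y * indicator W y * r = indicator UNIV y * indicator W y * r - indicator A y * indicator W y * (r::real)" for y r
      by (simp add: indicator_def)
    have "\<bar>indicator A y :: real\<bar> \<le> 1" "\<bar>indicator UNIV y :: real\<bar> \<le> 1" for A and y :: 'a by (auto simp: indicator_def)
    note b = this
    have "integrable G1 (\<lambda>y. indicator B y * indicator W y * (d \<bullet> n1 y))"
      "integrable G2 (\<lambda>y. indicator B y * indicator W y * (d \<bullet> n2 y))" if "B \<in> sets borel" for B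
      using that b by (auto intro!: integrable_flux1[where c=1] integrable_flux2[where c=1])
    note i = this
    show ?case
      unfolding ind using flux_open[OF open_UNIV, of d] compl.hyps(2)
      by (simp only: Bochner_Integration.integral_diff[OF i(1)[of UNIV] i(1)[of A]]
          Bochner_Integration.integral_diff[OF i(2)[of UNIV] i(2)[of A]] \<open>A \<in> sets borel\<close> sets.top[of borel, unfolded space_borel])
  next
    case (union A)
    then have Am[measurable]: "A i \<in> sets borel" for i using bs by auto
    define g where "g n y = (\<Sum>i<n. indicator (A i) y :: real)" for n y
    have g_ind: "g n y = indicator (\<Union>i<n. A i) y" for n y
      unfolding g_def using union.hyps(1)
      by (intro indicator_UN_disjoint[symmetric] disjoint_family_on_mono[of "{..<n}" UNIV]) auto
    show ?case
    proof (rule flux_limit[where g=g and c=1])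
      show "(\<lambda>i. g i y) \<longlonglongrightarrow> indicator (\<Union>i. A i) y" for y
        unfolding g_ind by (rule LIMSEQ_indicator_UN)
      show "\<bar>g i y\<bar> \<le> 1" for i y unfolding g_ind by (simp add: indicator_def)
      show "g i \<in> borel_measurable borel" for i unfolding g_def by measurable
      fix i
      have "\<bar>indicator (A j) y :: real\<bar> \<le> 1" for j and y :: 'a by (auto simp: indicator_def)
      then show "(\<integral>y. g i y * indicator W y * (d \<bullet> n1 y) \<partial>G1) = (\<integral>y. g i y * indicator W y * (d \<bullet> n2 y) \<partial>G2)"
        unfolding g_def sum_distrib_right using union.hyps
        by (subst (1 2) Bochner_Integration.integral_sum) (auto intro!: integrable_flux1 integrable_flux2)
    qed (use Am in auto)
  qed
qed

lemma flux_nonneg: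
  assumes "g \<in> borel_measurable borel" "\<And>y. 0 \<le> g y" "\<exists>c. \<forall>y. g y \<le> c"
  shows "(\<integral>y. g y * indicator W y * (d \<bullet> n1 y) \<partial>G1) = (\<integral>y. g y * indicator W y * (d \<bullet> n2 y) \<partial>G2)"
  using assms
proof (induction rule: borel_measurable_induct_real)
  case (set A)
  then show ?case by (intro flux_set) simp
next
  case (mult u c)
  show ?case
  proof (cases "c = 0")
    case False
    then have "c > 0" using mult by simp
    obtain C where "\<And>y. c * u y \<le> C" using mult.prems by auto
    then have "\<forall>y. u y \<le> C / c" using \<open>c > 0\<close> by (auto simp: field_simps)
    then show ?thesis using mult.IH by (auto simp: mult.assoc)
  qed simp
next
  case (add u v)
  obtain C where C: "\<And>y. v y + u y \<le> C" using add.prems by auto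
  have u: "u y \<le> C" and v: "v y \<le> C" for y using C[of y] add.hyps(2)[of y] add.hyps(4)[of y] by linarith+
  have eqs: "(\<integral>y. u y * indicator W y * (d \<bullet> n1 y) \<partial>G1) = (\<integral>y. u y * indicator W y * (d \<bullet> n2 y) \<partial>G2)"
     "(\<integral>y. v y * indicator W y * (d \<bullet> n1 y) \<partial>G1) = (\<integral>y. v y * indicator W y * (d \<bullet> n2 y) \<partial>G2)"
    using u v by (auto intro: add.IH)
  have au: "\<bar>u y\<bar> \<le> C" and av: "\<bar>v y\<bar> \<le> C" for y using u v add.hyps(2,4) by auto
  show ?case
    unfolding distrib_right using eqs
    by (subst (1 2) Bochner_Integration.integral_add) (auto intro!: integrable_flux1[OF au] integrable_flux2[OF au] integrable_flux1[OF av] integrable_flux2[OF av] add.hyps)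
next
  case (seq U)
  obtain C where C: "\<And>y. g y \<le> C" using seq.prems by auto
  have le: "U i y \<le> C" for i y
  proof -
    have "incseq (\<lambda>i. U i y)" using seq.hyps(3) by (auto simp: incseq_def le_fun_def)
    moreover have "(\<lambda>i. U i y) \<longlonglongrightarrow> g y" using seq.hyps(4) by simp
    ultimately have "U i y \<le> g y" by (rule incseq_le)
    then show ?thesis using C[of y] by linarith
  qed
  show ?case
  proof (rule flux_limit[where g=U and c=C])
    show "(\<lambda>i. U i y) \<longlonglongrightarrow> g y" for y using seq.hyps(4) by simp
    show "\<bar>U i y\<bar> \<le> C" for i y using le seq.hyps(2) by simp
    show "(\<integral>y. U i y * indicator W y * (d \<bullet> n1 y) \<partial>G1) = (\<integral>y. U i y * indicator W y * (d \<bullet> n2 y) \<partial>G2)" for i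
      using le by (intro seq.IH) auto
  qed (use seq.hyps assms(1) in auto)
qed

lemma flux_bounded:
  assumes [measurable]: "g \<in> borel_measurable borel" and c: "\<And>y. \<bar>g y\<bar> \<le> c"
  shows "(\<integral>y. g y * indicator W y * (d \<bullet> n1 y) \<partial>G1) = (\<integral>y. g y * indicator W y * (d \<bullet> n2 y) \<partial>G2)"
proof -
  have c0: "0 \<le> c" using order_trans[OF abs_ge_zero c] .
  have b: "\<bar>g y + c\<bar> \<le> 2 * c" "0 \<le> g y + c" "g y + c \<le> 2 * c" for y using c[of y] by linarith+
  have e: "g y * indicator W y * r = (g y + c) * indicator W y * r - c * indicator W y * r" for y r
    by (simp add: algebra_simps)
  have 1: "(\<integral>y. (g y + c) * indicator W y * (d \<bullet> n1 y) \<partial>G1) = (\<integral>y. (g y + c) * indicator W y * (d \<bullet> n2 y) \<partial>G2)"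
    using b by (intro flux_nonneg) (auto intro!: exI[of _ "2 * c"])
  have 2: "(\<integral>y. c * indicator W y * (d \<bullet> n1 y) \<partial>G1) = (\<integral>y. c * indicator W y * (d \<bullet> n2 y) \<partial>G2)"
    using c0 by (intro flux_nonneg) auto
  show ?thesis
    unfolding e using c0 1 2
    by (subst (1 2) Bochner_Integration.integral_diff) (auto intro!: integrable_flux1[OF b(1)] integrable_flux2[OF b(1)] integrable_flux1[of "\<lambda>_. c" c] integrable_flux2[of "\<lambda>_. c" c])
qed

text \<open>Testing the common vector measure against its own density recovers the total variation.\<close>

lemma measure_le_on_W:
  assumes A[measurable]: "A \<in> sets borel" "A \<subseteq> W" and n1: "AE y in G1. norm (n1 y) = 1"
  shows "emeasure G1 A \<le> emeasure G2 A"
proof -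
  have bA: "bounded A" using A W by (auto intro: bounded_subset)
  have f1: "emeasure G1 A < \<infinity>" and f2: "emeasure G2 A < \<infinity>" using fin1 fin2 bA A by auto
  have b: "\<bar>indicator A y * (b \<bullet> n1 y)\<bar> \<le> 1" if "b \<in> Basis" for b y
    using bound_inner[OF n1_le, of b y] that by (auto simp: indicator_def)
  have b2: "\<bar>indicator A y * (b \<bullet> n1 y) * indicator W y\<bar> \<le> 1" if "b \<in> Basis" for b y
    using b[OF that, of y] by (auto simp: indicator_def)
  have m[measurable]: "(\<lambda>y. indicator A y * (b \<bullet> n1 y)) \<in> borel_measurable borel" for b by measurable
  have "measure G1 A = (\<integral>y. indicator A y \<partial>G1)" by simp
  \<comment> \<open>Where n1 has norm 1, the squares of its coordinates add up to 1. One factor of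
    each square is kept as a bounded Borel test function and the other belongs to n1 G1, which may
    be exchanged for n2 G2; then n1 . n2 \<le> 1 finishes the estimate.\<close>
  also have "\<dots> = (\<integral>y. (\<Sum>b\<in>Basis. indicator A y * (b \<bullet> n1 y) * indicator W y * (b \<bullet> n1 y)) \<partial>G1)"
  proof (rule integral_cong_AE)
    show "AE y in G1. indicator A y = (\<Sum>b\<in>Basis. indicator A y * (b \<bullet> n1 y) * indicator W y * (b \<bullet> n1 y))"
      using n1
    proof eventually_elim
      case (elim y)
      have "(\<Sum>b\<in>Basis. indicator A y * (b \<bullet> n1 y) * indicator W y * (b \<bullet> n1 y)) =
         indicator A y * indicator W y * (\<Sum>b\<in>Basis. (n1 y \<bullet> b) * (n1 y \<bullet> b))"
        by (simp add: sum_distrib_left inner_commute mult_ac)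
      also have "(\<Sum>b\<in>Basis. (n1 y \<bullet> b) * (n1 y \<bullet> b)) = n1 y \<bullet> n1 y" by (rule euclidean_inner[symmetric])
      also have "\<dots> = 1" using elim by (simp add: norm_eq_1)
      finally show ?case using A(2) by (auto simp: indicator_def)
    qed
  qed measurable
  also have "\<dots> = (\<Sum>b\<in>Basis. \<integral>y. indicator A y * (b \<bullet> n1 y) * indicator W y * (b \<bullet> n1 y) \<partial>G1)"
    by (intro Bochner_Integration.integral_sum integrable_flux1[OF b] m)
  also have "\<dots> = (\<Sum>b\<in>Basis. \<integral>y. indicator A y * (b \<bullet> n1 y) * indicator W y * (b \<bullet> n2 y) \<partial>G2)"
    by (intro sum.cong refl flux_bounded[OF m b])
  also have "\<dots> = (\<integral>y. (\<Sum>b\<in>Basis. indicator A y * (b \<bullet> n1 y) * indicator W y * (b \<bullet> n2 y)) \<partial>G2)"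
    by (intro Bochner_Integration.integral_sum[symmetric] integrable_flux2[OF b] m)
  also have "\<dots> \<le> (\<integral>y. indicator A y \<partial>G2)"
  proof (rule integral_mono)
    show "integrable G2 (\<lambda>y. \<Sum>b\<in>Basis. indicator A y * (b \<bullet> n1 y) * indicator W y * (b \<bullet> n2 y))"
      by (intro Bochner_Integration.integrable_sum integrable_flux2[OF b] m)
    show "integrable G2 (indicator A :: 'a \<Rightarrow> real)" using f2 by (intro integrable_real_indicator) auto
    fix y
    have "(\<Sum>b\<in>Basis. indicator A y * (b \<bullet> n1 y) * indicator W y * (b \<bullet> n2 y)) =
         indicator A y * indicator W y * (\<Sum>b\<in>Basis. (n1 y \<bullet> b) * (n2 y \<bullet> b))"
      by (simp add: sum_distrib_left inner_commute mult_ac)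
    also have "(\<Sum>b\<in>Basis. (n1 y \<bullet> b) * (n2 y \<bullet> b)) = n1 y \<bullet> n2 y" by (rule euclidean_inner[symmetric])
    also have "indicator A y * indicator W y * (n1 y \<bullet> n2 y) \<le> indicator A y"
      using bound_inner[OF n2_le, of "n1 y" y] n1_le[of y] by (auto simp: indicator_def)
    finally show "(\<Sum>b\<in>Basis. indicator A y * (b \<bullet> n1 y) * indicator W y * (b \<bullet> n2 y)) \<le> indicator A y" .
  qed
  also have "\<dots> = measure G2 A" by simp
  finally show ?thesis
    using f1 f2 by (simp add: emeasure_eq_ennreal_measure less_top)
qed

end

text \<open>The interiors of an exhaustion of V by compact sets serve as W. Equality will follow by
  exchanging the roles of the two measures.\<close>

lemma measure_le:
  assumes A[measurable]: "A \<in> sets borel" "A \<subseteq> V" and n1: "AE y in G1. norm (n1 y) = 1"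
  shows "emeasure G1 A \<le> emeasure G2 A"
proof -
  obtain C where C: "\<And>n. compact (C n)" "\<And>n. C n \<subseteq> V" "\<And>n. C n \<subseteq> interior (C (Suc n))" "\<Union>(range C) = V"
    by (rule open_Union_compact_subsets[OF openV]) auto
  let ?W = "\<lambda>n. interior (C n)"
  have inc: "incseq ?W"
    using C(3) by (intro incseq_SucI) (rule order_trans[OF interior_subset])
  have UW: "(\<Union>n. ?W n) = V"
    using C(3,4) interior_subset by (fastforce intro: subset_antisym)
  have incA: "incseq (\<lambda>n. A \<inter> ?W n)" using inc by (auto simp: incseq_def)
  have "emeasure G1 A = emeasure G1 (\<Union>n. A \<inter> ?W n)"
    using UW A(2) by (intro arg_cong[where f="emeasure G1"]) auto
  also have "\<dots> = (SUP n. emeasure G1 (A \<inter> ?W n))"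
    using incA by (intro SUP_emeasure_incseq[symmetric]) auto
  also have "\<dots> \<le> emeasure G2 A"
  proof (rule SUP_least)
    fix n
    have "emeasure G1 (A \<inter> ?W n) \<le> emeasure G2 (A \<inter> ?W n)"
    proof (rule measure_le_on_W[of "?W n"])
      show "bounded (?W n)" using C(1) interior_subset by (meson bounded_subset compact_imp_bounded)
      show "closure (?W n) \<subseteq> V"
        using C(1,2)[of n] by (meson closure_minimal compact_imp_closed interior_subset order_trans)
    qed (use n1 in auto)
    also have "\<dots> \<le> emeasure G2 A" by (intro emeasure_mono) auto
    finally show "emeasure G1 (A \<inter> ?W n) \<le> emeasure G2 A" .
  qed
  finally show ?thesis .
qed

end

section \<open>Comparison of two charts on their overlap\<close>

lemma lipschitz_chart_graph_chart:
  assumes "lipschitz_chart \<Omega> U e \<phi>"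
  obtains L where "graph_chart e \<phi> L"
  using assms unfolding lipschitz_chart_def graph_chart_def by blast

text \<open>The part of U below the graph is open and misses \<Omega>, so it contains no boundary
  point; from a point of the graph, small steps in direction e lead into \<Omega>.\<close>

lemma frontier_chart_iff:
  assumes c: "lipschitz_chart \<Omega> U e \<phi>" and "open \<Omega>" and x: "x \<in> U"
  shows "x \<in> frontier \<Omega> \<longleftrightarrow> \<phi> x = x \<bullet> e"
proof -
  obtain L where "graph_chart e \<phi> L" using lipschitz_chart_graph_chart[OF c] .
  then interpret graph_chart e \<phi> L .
  have U: "open U" and in\<Omega>: "\<And>y. y \<in> U \<Longrightarrow> y \<in> \<Omega> \<longleftrightarrow> \<phi> y < y \<bullet> e"
    using c unfolding lipschitz_chart_def by auto
  have cont: "continuous_on UNIV \<phi>" using lip by (rule lipschitz_on_continuous_on)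
  show ?thesis
  proof
    assume fr: "x \<in> frontier \<Omega>"
    then have "\<not> \<phi> x < x \<bullet> e"
      using in\<Omega>[OF x] \<open>open \<Omega>\<close> by (simp add: frontier_def interior_open)
    moreover have "\<not> \<phi> x > x \<bullet> e"
    proof
      assume gt: "\<phi> x > x \<bullet> e"
      have "open (U \<inter> {y. \<phi> y > y \<bullet> e})"
        using U cont by (intro open_Int open_Collect_less continuous_intros) auto
      moreover have "x \<in> closure \<Omega>" using fr by (simp add: frontier_def)
      ultimately have "(U \<inter> {y. \<phi> y > y \<bullet> e}) \<inter> \<Omega> \<noteq> {}"
        using x gt by (simp add: closure_iff_nhds_not_empty) blast
      then show False using in\<Omega> by force
    qed
    ultimately show "\<phi> x = x \<bullet> e" by linarith
  next
    assume eq: "\<phi> x = x \<bullet> e"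
    have "((\<lambda>t. x + t *\<^sub>R e) \<longlongrightarrow> x + 0 *\<^sub>R e) (at_right 0)"
      by (intro tendsto_intros)
    then have lim: "((\<lambda>t. x + t *\<^sub>R e) \<longlongrightarrow> x) (at_right 0)" by simp
    then have "\<forall>\<^sub>F t in at_right 0. x + t *\<^sub>R e \<in> U" using U x by (rule topological_tendstoD)
    moreover have "\<forall>\<^sub>F t::real in at_right 0. t > 0" by (rule eventually_at_right_less)
    ultimately have "\<forall>\<^sub>F t in at_right 0. x + t *\<^sub>R e \<in> closure \<Omega>"
    proof eventually_elim
      case (elim t)
      then have "x + t *\<^sub>R e \<in> \<Omega>" using eq by (subst in\<Omega>) (auto simp: phi_shift inner_add_left)
      then show ?case using closure_subset by blast
    qed
    then have "x \<in> closure \<Omega>"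
      using lim by (intro Lim_in_closed_set[of "closure \<Omega>"]) auto
    moreover have "x \<notin> \<Omega>" using in\<Omega>[OF x] eq by simp
    ultimately show "x \<in> frontier \<Omega>" using \<open>open \<Omega>\<close> by (simp add: frontier_def interior_open)
  qed
qed

text \<open>For small t, translation by t d keeps the compact support inside U, where \<Omega>
  coincides with the epigraph.\<close>

lemma chart_flux:
  fixes f :: "'a::euclidean_space \<Rightarrow> real"
  assumes c: "lipschitz_chart \<Omega> U e \<phi>" and f: "continuous_on UNIV f"
    and K: "compact K" "K \<subseteq> U" "\<And>x. x \<notin> K \<Longrightarrow> f x = 0"
  shows "((\<lambda>t. (\<integral>x. f x * (indicator \<Omega> (x - t *\<^sub>R d) - indicator \<Omega> x) \<partial>lborel) / t)
           \<longlongrightarrow> (\<integral>y. f y * (d \<bullet> graph_normal e \<phi> y) \<partial>graph_measure e \<phi>)) (at 0)"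
proof -
  obtain L where "graph_chart e \<phi> L" using lipschitz_chart_graph_chart[OF c] .
  then interpret graph_chart e \<phi> L .
  have U: "open U" and in\<Omega>: "\<And>y. y \<in> U \<Longrightarrow> y \<in> \<Omega> \<longleftrightarrow> \<phi> y < y \<bullet> e"
    using c unfolding lipschitz_chart_def by auto
  obtain R where R: "K \<subseteq> cball 0 R"
    using compact_imp_bounded[OF K(1)] bounded_subset_ballD[of K 0] by (metis ball_subset_cball order_trans)
  obtain \<delta> where \<delta>: "\<delta> > 0" "(\<Union>x\<in>K. ball x \<delta>) \<subseteq> U"
    using compact_subset_open_imp_ball_epsilon_subset[OF K(1) U K(2)] by blast
  show ?thesis
  proof (rule Lim_transform_eventually)
    show "((\<lambda>t. (\<integral>x. f x * (indicator {x. \<phi> x < x \<bullet> e} (x - t *\<^sub>R d) - indicator {x. \<phi> x < x \<bullet> e} x) \<partial>lborel) / t)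
           \<longlongrightarrow> (\<integral>y. f y * (d \<bullet> graph_normal e \<phi> y) \<partial>graph_measure e \<phi>)) (at 0)"
    proof (rule graph_flux[OF f])
      show "norm x > R \<Longrightarrow> f x = 0" for x using K(3)[of x] R by force
    qed
    have "\<forall>\<^sub>F t in at 0. norm (t *\<^sub>R d) < \<delta>"
    proof -
      have "((\<lambda>t. norm (t *\<^sub>R d)) \<longlongrightarrow> norm (0 *\<^sub>R d)) (at 0)" by (intro tendsto_intros)
      then show ?thesis using \<delta>(1) by (intro order_tendstoD(2)) auto
    qed
    then show "\<forall>\<^sub>F t in at 0. (\<integral>x. f x * (indicator {x. \<phi> x < x \<bullet> e} (x - t *\<^sub>R d) - indicator {x. \<phi> x < x \<bullet> e} x) \<partial>lborel) / t
       = (\<integral>x. f x * (indicator \<Omega> (x - t *\<^sub>R d) - indicator \<Omega> x) \<partial>lborel) / t"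
    proof eventually_elim
      case (elim t)
      have "f x * (indicator {x. \<phi> x < x \<bullet> e} (x - t *\<^sub>R d) - indicator {x. \<phi> x < x \<bullet> e} x)
         = f x * (indicator \<Omega> (x - t *\<^sub>R d) - indicator \<Omega> x)" for x
      proof (cases "x \<in> K")
        case True
        then have "x \<in> U" using K by blast
        moreover have "x - t *\<^sub>R d \<in> ball x \<delta>" using elim by (simp add: dist_norm)
        then have "x - t *\<^sub>R d \<in> U" using \<delta>(2) True by blast
        ultimately show ?thesis by (simp add: indicator_def in\<Omega>)
      qed (simp add: K(3))
      then show ?case by (simp only:)
    qed
  qed
qed

lemma graph_measure_le:
  assumes c1: "lipschitz_chart \<Omega> U1 e1 \<phi>1" and c2: "lipschitz_chart \<Omega> U2 e2 \<phi>2"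
    and A: "A \<in> sets borel" "A \<subseteq> U1 \<inter> U2"
  shows "emeasure (graph_measure e1 \<phi>1) A \<le> emeasure (graph_measure e2 \<phi>2) A"
proof -
  obtain L1 where "graph_chart e1 \<phi>1 L1" using lipschitz_chart_graph_chart[OF c1] .
  then interpret C1: graph_chart e1 \<phi>1 L1 .
  obtain L2 where "graph_chart e2 \<phi>2 L2" using lipschitz_chart_graph_chart[OF c2] .
  then interpret C2: graph_chart e2 \<phi>2 L2 .
  \<comment> \<open>The cut-off acts only where the norm exceeds 1, hence only where \<phi>1 has no
    gradient, which is a null set of the graph measure.\<close>
  define n1 where "n1 y = (if norm (graph_normal e1 \<phi>1 y) \<le> 1 then graph_normal e1 \<phi>1 y else 0)" for y
  define n2 where "n2 y = (if norm (graph_normal e2 \<phi>2 y) \<le> 1 then graph_normal e2 \<phi>2 y else 0)" for y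
  have m1[measurable]: "n1 \<in> borel_measurable borel" unfolding n1_def by measurable
  have m2[measurable]: "n2 \<in> borel_measurable borel" unfolding n2_def by measurable
  have g1: "AE y in graph_measure e1 \<phi>1. norm (n1 y) = 1 \<and> n1 y = graph_normal e1 \<phi>1 y"
    using C1.AE_graph_measure_GDERIV
  proof eventually_elim
    case (elim y)
    then show ?case using C1.norm_graph_normal[of y] by (auto simp: n1_def)
  qed
  have g2: "AE y in graph_measure e2 \<phi>2. norm (n2 y) = 1 \<and> n2 y = graph_normal e2 \<phi>2 y"
    using C2.AE_graph_measure_GDERIV
  proof eventually_elim
    case (elim y)
    then show ?case using C2.norm_graph_normal[of y] by (auto simp: n2_def)
  qed
  have opens: "open U1" "open U2" using c1 c2 by (auto simp: lipschitz_chart_def)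
  interpret same_flux "graph_measure e1 \<phi>1" "graph_measure e2 \<phi>2" n1 n2 "U1 \<inter> U2"
  proof
    fix f :: "'a \<Rightarrow> real" and d :: 'a and K
    assume f: "continuous_on UNIV f" and K: "compact K" "K \<subseteq> U1 \<inter> U2" "\<And>x. x \<notin> K \<Longrightarrow> f x = 0"
    have [measurable]: "f \<in> borel_measurable borel" using f by (rule borel_measurable_continuous_onI)
    have "(\<integral>y. f y * (d \<bullet> graph_normal e1 \<phi>1 y) \<partial>graph_measure e1 \<phi>1) = (\<integral>y. f y * (d \<bullet> graph_normal e2 \<phi>2 y) \<partial>graph_measure e2 \<phi>2)"
      using chart_flux[OF c1 f K(1) _ K(3), of d] chart_flux[OF c2 f K(1) _ K(3), of d] K(2)
      by (auto intro: tendsto_unique[OF at_neq_bot])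
    moreover have "(\<integral>y. f y * (d \<bullet> n1 y) \<partial>graph_measure e1 \<phi>1) = (\<integral>y. f y * (d \<bullet> graph_normal e1 \<phi>1 y) \<partial>graph_measure e1 \<phi>1)"
      by (rule integral_cong_AE) (measurable, use g1 in \<open>eventually_elim, simp\<close>)
    moreover have "(\<integral>y. f y * (d \<bullet> n2 y) \<partial>graph_measure e2 \<phi>2) = (\<integral>y. f y * (d \<bullet> graph_normal e2 \<phi>2 y) \<partial>graph_measure e2 \<phi>2)"
      by (rule integral_cong_AE) (measurable, use g2 in \<open>eventually_elim, simp\<close>)
    ultimately show "(\<integral>y. f y * (d \<bullet> n1 y) \<partial>graph_measure e1 \<phi>1) = (\<integral>y. f y * (d \<bullet> n2 y) \<partial>graph_measure e2 \<phi>2)"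
      by simp
  qed (use opens C1.emeasure_graph_measure_bounded C2.emeasure_graph_measure_bounded in \<open>auto simp: n1_def n2_def\<close>)
  show ?thesis
    using A g1 by (intro measure_le) auto
qed

lemma graph_measure_unique:
  assumes "lipschitz_chart \<Omega> U1 e1 \<phi>1" "lipschitz_chart \<Omega> U2 e2 \<phi>2" "A \<in> sets borel" "A \<subseteq> U1 \<inter> U2"
  shows "emeasure (graph_measure e1 \<phi>1) A = emeasure (graph_measure e2 \<phi>2) A"
  using graph_measure_le[of \<Omega> U1 e1 \<phi>1 U2 e2 \<phi>2 A] graph_measure_le[of \<Omega> U2 e2 \<phi>2 U1 e1 \<phi>1 A] assms by (simp add: Int_commute antisym)

section \<open>Surface measure and exterior normal\<close>

text \<open>Compactness of the boundary. The balls of radius r cover it while twice the radius still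
  fits into the chart, so points within r of a covered boundary point remain in the same
  chart.\<close>

lemma lipschitz_chart_cover:
  fixes \<Omega> :: "'a::euclidean_space set"
  assumes "bounded_lipschitz_domain \<Omega>"
  obtains n :: nat and c :: "nat \<Rightarrow> 'a" and r :: "nat \<Rightarrow> real" and U :: "nat \<Rightarrow> 'a set"
    and e :: "nat \<Rightarrow> 'a" and \<phi> :: "nat \<Rightarrow> 'a \<Rightarrow> real"
  where "\<And>i. i < n \<Longrightarrow> lipschitz_chart \<Omega> (U i) (e i) (\<phi> i)"
    and "\<And>i. i < n \<Longrightarrow> 0 < r i" and "\<And>i. i < n \<Longrightarrow> cball (c i) (2 * r i) \<subseteq> U i"
    and "frontier \<Omega> \<subseteq> (\<Union>i<n. ball (c i) (r i))"
proof -
  have "\<exists>U e \<phi> r. lipschitz_chart \<Omega> U e \<phi> \<and> 0 < r \<and> cball x (2 * r) \<subseteq> U" if x: "x \<in> frontier \<Omega>" for x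
  proof -
    have "\<forall>x\<in>frontier \<Omega>. \<exists>U e \<phi>. x \<in> U \<and> lipschitz_chart \<Omega> U e \<phi>"
      using assms unfolding bounded_lipschitz_domain_def by (elim conjE)
    then obtain U e \<phi> where c: "x \<in> U" "lipschitz_chart \<Omega> U e \<phi>"
      using x by blast
    then have "open U" by (simp add: lipschitz_chart_def)
    then obtain \<rho> where "\<rho> > 0" "cball x \<rho> \<subseteq> U" using c(1) open_contains_cball by blast
    then show ?thesis using c(2) by (intro exI[of _ U] exI[of _ e] exI[of _ \<phi>] exI[of _ "\<rho> / 2"]) auto
  qed
  then obtain U e \<phi> r where ch: "\<And>x. x \<in> frontier \<Omega> \<Longrightarrow> lipschitz_chart \<Omega> (U x) (e x) (\<phi> x)"
      "\<And>x. x \<in> frontier \<Omega> \<Longrightarrow> 0 < r x" "\<And>x. x \<in> frontier \<Omega> \<Longrightarrow> cball x (2 * r x) \<subseteq> U x"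
    by metis
  have "compact (frontier \<Omega>)"
    using assms by (intro compact_frontier_bounded) (simp add: bounded_lipschitz_domain_def)
  moreover have "frontier \<Omega> \<subseteq> (\<Union>x\<in>frontier \<Omega>. ball x (r x))" using ch(2) by force
  ultimately obtain X where X: "X \<subseteq> frontier \<Omega>" "finite X" "frontier \<Omega> \<subseteq> (\<Union>x\<in>X. ball x (r x))"
    using compactE_image[of "frontier \<Omega>" "frontier \<Omega>" "\<lambda>x. ball x (r x)"] by (metis open_ball)
  obtain c :: "nat \<Rightarrow> 'a" where c: "bij_betw c {..<card X} X"
    using ex_bij_betw_nat_finite[OF X(2)] unfolding atLeast0LessThan by blast
  have cX: "c i \<in> X" if "i < card X" for i using c that by (auto simp: bij_betw_def)
  then have cf: "c i \<in> frontier \<Omega>" if "i < card X" for i using X(1) that by blast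
  have im: "c ` {..<card X} = X" using c by (rule bij_betw_imp_surj_on)
  have UN: "(\<Union>x\<in>c ` {..<k}. ball x (r x)) = (\<Union>i<k. ball (c i) (r (c i)))" for k by (simp only: image_image)
  have fr: "frontier \<Omega> \<subseteq> (\<Union>i<card X. ball (c i) (r (c i)))"
    unfolding UN[symmetric] im by (rule X(3))
  show thesis
  proof (rule that)
    fix i assume "i < card X"
    then show "lipschitz_chart \<Omega> (U (c i)) (e (c i)) (\<phi> (c i))" by (rule ch(1)[OF cf])
  next
    fix i assume "i < card X"
    then show "0 < r (c i)" by (rule ch(2)[OF cf])
  next
    fix i assume "i < card X"
    then show "cball (c i) (2 * r (c i)) \<subseteq> U (c i)" by (rule ch(3)[OF cf])
  qed (rule fr)
qed

text \<open>For existence, the boundary is cut into disjoint Borel pieces, each inside one chart and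
  carrying its graph measure; chart independence identifies the sum with the graph measure of any
  other chart. For uniqueness, a surface measure is determined on each piece and vanishes off the
  boundary.\<close>

lemma is_surface_measure_surface_measure:
  fixes \<Omega> :: "'a::euclidean_space set"
  assumes "bounded_lipschitz_domain \<Omega>"
  shows "is_surface_measure \<Omega> (surface_measure \<Omega>)"
proof -
  obtain n :: nat and c :: "nat \<Rightarrow> 'a" and r U e \<phi> where ch: "\<And>i. i < n \<Longrightarrow> lipschitz_chart \<Omega> (U i) (e i) (\<phi> i)"
    and cov: "\<And>i. i < n \<Longrightarrow> 0 < r i" "\<And>i. i < n \<Longrightarrow> cball (c i) (2 * r i) \<subseteq> U i"
      "frontier \<Omega> \<subseteq> (\<Union>i<n. ball (c i) (r i))"
    by (rule lipschitz_chart_cover[OF assms]) blast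
  let ?\<Gamma> = "frontier \<Omega>"
  have \<Gamma>m[measurable]: "?\<Gamma> \<in> sets borel" by simp
  have \<Gamma>U: "?\<Gamma> \<subseteq> (\<Union>i<n. U i)"
  proof
    fix x assume "x \<in> ?\<Gamma>"
    then obtain i where i: "i < n" "x \<in> ball (c i) (r i)" using cov(3) by auto
    then have "x \<in> cball (c i) (2 * r i)" using cov(1)[of i] by auto
    then show "x \<in> (\<Union>i<n. U i)" using i cov(2) by blast
  qed
  have Uo: "open (U i)" if "i < n" for i using ch[OF that] by (simp add: lipschitz_chart_def)
  \<comment> \<open>Each boundary point is assigned to the first chart that contains it.\<close>
  define B where "B i = ?\<Gamma> \<inter> (U i - (\<Union>j<i. U j))" for i
  have Bm[measurable]: "B i \<in> sets borel" if "i < n" for i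
    using that Uo unfolding B_def by (intro sets.Int sets.Diff sets.finite_UN borel_open[OF Uo] \<Gamma>m) auto
  have Bdisj: "disjoint_family_on B {..<n}"
  proof -
    have "B i \<inter> B j = {}" if "i < j" for i j using that by (auto simp: B_def)
    then show ?thesis unfolding disjoint_family_on_def by (metis Int_commute linorder_neqE_nat)
  qed
  have BU: "(\<Union>i<n. B i) = ?\<Gamma>"
  proof
    show "?\<Gamma> \<subseteq> (\<Union>i<n. B i)"
    proof
      fix x assume x: "x \<in> ?\<Gamma>"
      then obtain i where "i < n" "x \<in> U i" using \<Gamma>U by blast
      define k where "k = (LEAST i. x \<in> U i)"
      have "x \<in> U k" unfolding k_def using \<open>x \<in> U i\<close> by (rule LeastI)
      moreover have "x \<notin> U j" if "j < k" for j using that unfolding k_def by (rule not_less_Least)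
      moreover have "k \<le> i" unfolding k_def using \<open>x \<in> U i\<close> by (rule Least_le)
      ultimately show "x \<in> (\<Union>i<n. B i)" using x \<open>i < n\<close> by (auto simp: B_def intro!: bexI[of _ k])
    qed
  qed (auto simp: B_def)
  let ?G = "\<lambda>i. graph_measure (e i) (\<phi> i)"
  have Gs[simp]: "sets (graph_measure a b) = sets borel" for a :: 'a and b by (simp add: graph_measure_def)
  define \<mu> where "\<mu> A = (\<Sum>i<n. emeasure (?G i) (A \<inter> B i))" for A
  define \<sigma> where "\<sigma> = measure_of UNIV (sets (borel :: 'a measure)) \<mu>"
  have \<sigma>s: "sets \<sigma> = sets borel" unfolding \<sigma>_def by (simp add: sets.sigma_sets_eq[of borel, simplified])
  have sa: "sigma_algebra UNIV (sets (borel :: 'a measure))"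
    using sets.sigma_algebra_axioms[of "borel :: 'a measure"] by simp
  have em: "emeasure \<sigma> A = \<mu> A" if "A \<in> sets borel" for A
    unfolding \<sigma>_def
  proof (rule emeasure_measure_of_sigma[OF sa])
    show "positive (sets borel) \<mu>" by (simp add: positive_def \<mu>_def)
    show "countably_additive (sets borel) \<mu>"
    proof (rule countably_additiveI)
      fix A :: "nat \<Rightarrow> 'a set" assume A: "range A \<subseteq> sets borel" "disjoint_family A"
      have "(\<Sum>k. \<mu> (A k)) = (\<Sum>i<n. \<Sum>k. emeasure (?G i) (A k \<inter> B i))"
        unfolding \<mu>_def by (intro suminf_sum) auto
      also have "\<dots> = (\<Sum>i<n. emeasure (?G i) (\<Union>k. A k \<inter> B i))"
      proof (intro sum.cong refl suminf_emeasure)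
        fix i assume i: "i \<in> {..<n}"
        show "range (\<lambda>k. A k \<inter> B i) \<subseteq> sets (?G i)" using A i by auto
        show "disjoint_family (\<lambda>k. A k \<inter> B i)" using A(2) by (auto simp: disjoint_family_on_def)
      qed
      also have "\<dots> = \<mu> (\<Union>k. A k)" unfolding \<mu>_def by (intro sum.cong refl arg_cong2[where f=emeasure]) auto
      finally show "(\<Sum>k. \<mu> (A k)) = \<mu> (\<Union>k. A k)" .
    qed
  qed fact
  have is_sig: "is_surface_measure \<Omega> \<sigma>"
    unfolding is_surface_measure_def
  proof (intro conjI allI impI \<sigma>s)
    have "(- ?\<Gamma>) \<inter> B i = {}" for i by (auto simp: B_def)
    then show "emeasure \<sigma> (- ?\<Gamma>) = 0" by (subst em) (auto simp: \<mu>_def)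
    fix V e' \<phi>' A assume a: "lipschitz_chart \<Omega> V e' \<phi>' \<and> A \<in> sets borel \<and> A \<subseteq> V \<inter> ?\<Gamma>"
    then have [measurable]: "A \<in> sets borel" by simp
    have "emeasure \<sigma> A = (\<Sum>i<n. emeasure (graph_measure e' \<phi>') (A \<inter> B i))"
    proof (subst em)
      show "\<mu> A = (\<Sum>i<n. emeasure (graph_measure e' \<phi>') (A \<inter> B i))"
        unfolding \<mu>_def
      proof (intro sum.cong refl graph_measure_unique)
        fix i assume i: "i \<in> {..<n}"
        show "A \<inter> B i \<in> sets borel" using i by (intro sets.Int Bm) auto
        show "lipschitz_chart \<Omega> (U i) (e i) (\<phi> i)" using ch i by simp
      qed (use a in \<open>auto simp: B_def\<close>)
    qed simp
    also have "\<dots> = emeasure (graph_measure e' \<phi>') (\<Union>i<n. A \<inter> B i)"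
      using Bdisj by (intro sum_emeasure) (auto simp: disjoint_family_on_def)
    also have "(\<Union>i<n. A \<inter> B i) = A" using a BU by auto
    finally show "emeasure \<sigma> A = emeasure (graph_measure e' \<phi>') A" .
  qed
  moreover have "\<sigma>' = \<sigma>" if s: "is_surface_measure \<Omega> \<sigma>'" for \<sigma>'
  proof (rule measure_eqI)
    have s': "sets \<sigma>' = sets borel" using s by (simp add: is_surface_measure_def)
    then show "sets \<sigma>' = sets \<sigma>" using \<sigma>s by simp
    fix A assume "A \<in> sets \<sigma>'"
    then have A[measurable]: "A \<in> sets borel" using s' by simp
    have "emeasure \<sigma>' (A - ?\<Gamma>) \<le> emeasure \<sigma>' (- ?\<Gamma>)" using s' by (intro emeasure_mono) auto
    also have "\<dots> = 0" using s by (simp add: is_surface_measure_def)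
    finally have z: "emeasure \<sigma>' (A - ?\<Gamma>) = 0" by simp
    have "emeasure \<sigma>' A = emeasure \<sigma>' (A \<inter> ?\<Gamma>) + emeasure \<sigma>' (A - ?\<Gamma>)"
      using s' A by (subst plus_emeasure) (auto intro!: arg_cong[where f="emeasure \<sigma>'"])
    also have "\<dots> = emeasure \<sigma>' (\<Union>i<n. A \<inter> B i)" using z BU by (simp add: Int_UN_distrib[symmetric])
    also have "\<dots> = (\<Sum>i<n. emeasure \<sigma>' (A \<inter> B i))"
      using Bdisj s' by (intro sum_emeasure[symmetric]) (auto simp: disjoint_family_on_def)
    also have "\<dots> = (\<Sum>i<n. emeasure (?G i) (A \<inter> B i))"
    proof (intro sum.cong refl)
      fix i assume "i \<in> {..<n}"
      then have "lipschitz_chart \<Omega> (U i) (e i) (\<phi> i)" "A \<inter> B i \<subseteq> U i \<inter> ?\<Gamma>" and "B i \<in> sets borel"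
        using ch Bm[of i] by (simp_all, auto simp: B_def[of i])
      moreover from this(3) have "A \<inter> B i \<in> sets borel" by simp
      ultimately have "lipschitz_chart \<Omega> (U i) (e i) (\<phi> i)" "A \<inter> B i \<subseteq> U i \<inter> ?\<Gamma>" "A \<inter> B i \<in> sets borel"
        by blast+
      then show "emeasure \<sigma>' (A \<inter> B i) = emeasure (?G i) (A \<inter> B i)"
        using s unfolding is_surface_measure_def by blast
    qed
    also have "\<dots> = emeasure \<sigma> A" by (simp add: em \<mu>_def)
    finally show "emeasure \<sigma>' A = emeasure \<sigma> A" .
  qed
  ultimately show ?thesis
    unfolding surface_measure_def by (rule theI)
qed

section \<open>Tangent cones and the exterior normal\<close>

text \<open>A chart-free form of the exterior normal: near x, every cone strictly inside the half
  space opposite to \<nu> lies in \<Omega>, and every cone strictly inside the half space of \<nu>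
  lies outside.\<close>

definition tangent_normal :: "'a::euclidean_space set \<Rightarrow> 'a \<Rightarrow> 'a \<Rightarrow> bool" where
  "tangent_normal \<Omega> x \<nu> \<longleftrightarrow> norm \<nu> = 1 \<and> (\<forall>\<epsilon>>0. \<exists>\<delta>>0. \<forall>w. norm w < \<delta> \<longrightarrow>
     (w \<bullet> \<nu> < - \<epsilon> * norm w \<longrightarrow> x + w \<in> \<Omega>) \<and> (w \<bullet> \<nu> > \<epsilon> * norm w \<longrightarrow> x + w \<notin> \<Omega>))"

text \<open>With w = \<nu>' - \<nu> and \<kappa> = 1 - \<nu> . \<nu>' > 0 one has w . \<nu> = -
  \<kappa> and w . \<nu>' = \<kappa>, so small multiples of w would lead both into and out of
  \<Omega>.\<close>

lemma tangent_normal_unique: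
  assumes "tangent_normal \<Omega> x \<nu>" "tangent_normal \<Omega> x \<nu>'"
  shows "\<nu> = \<nu>'"
proof (rule ccontr)
  assume ne: "\<nu> \<noteq> \<nu>'"
  have n: "\<nu> \<bullet> \<nu> = 1" "\<nu>' \<bullet> \<nu>' = 1" using assms by (auto simp: tangent_normal_def norm_eq_1)
  define w where "w = \<nu>' - \<nu>"
  have w: "norm w > 0" using ne by (simp add: w_def)
  define \<kappa> where "\<kappa> = 1 - \<nu> \<bullet> \<nu>'"
  have "(norm w)\<^sup>2 = 2 * \<kappa>"
    using n by (simp add: power2_norm_eq_inner w_def \<kappa>_def inner_diff_left inner_diff_right inner_commute)
  then have \<kappa>: "\<kappa> > 0" using w by (metis zero_less_power mult_pos_pos zero_less_mult_pos zero_less_numeral)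
  define \<epsilon> where "\<epsilon> = \<kappa> / (2 * norm w)"
  have \<epsilon>: "\<epsilon> > 0" "\<epsilon> * norm w < \<kappa>" using w \<kappa> by (auto simp: \<epsilon>_def)
  obtain \<delta>1 where \<delta>1: "\<delta>1 > 0" "\<And>w. norm w < \<delta>1 \<Longrightarrow> w \<bullet> \<nu> < - \<epsilon> * norm w \<Longrightarrow> x + w \<in> \<Omega>"
    using assms(1) \<epsilon>(1) unfolding tangent_normal_def by meson
  obtain \<delta>2 where \<delta>2: "\<delta>2 > 0" "\<And>w. norm w < \<delta>2 \<Longrightarrow> w \<bullet> \<nu>' > \<epsilon> * norm w \<Longrightarrow> x + w \<notin> \<Omega>"
    using assms(2) \<epsilon>(1) unfolding tangent_normal_def by meson
  define t where "t = min \<delta>1 \<delta>2 / (2 * norm w)"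
  have t: "t > 0" "norm (t *\<^sub>R w) < \<delta>1" "norm (t *\<^sub>R w) < \<delta>2"
    using w \<delta>1(1) \<delta>2(1) by (auto simp: t_def min_def)
  have "w \<bullet> \<nu> = - \<kappa>" "w \<bullet> \<nu>' = \<kappa>"
    using n by (auto simp: w_def \<kappa>_def inner_diff_left inner_diff_right inner_commute[of \<nu>' \<nu>])
  then have "(t *\<^sub>R w) \<bullet> \<nu> < - \<epsilon> * norm (t *\<^sub>R w)" "(t *\<^sub>R w) \<bullet> \<nu>' > \<epsilon> * norm (t *\<^sub>R w)"
    using t(1) mult_strict_left_mono[OF \<epsilon>(2) t(1)] by (auto simp: mult_ac)
  then show False using \<delta>1(2)[OF t(2)] \<delta>2(2)[OF t(3)] by blast
qed

lemma tangent_normal_graph_normal: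
  assumes c: "lipschitz_chart \<Omega> U e \<phi>" and "open \<Omega>" and x: "x \<in> U" "x \<in> frontier \<Omega>"
    and D: "GDERIV \<phi> x :> D"
  shows "tangent_normal \<Omega> x (graph_normal e \<phi> x)"
proof -
  obtain L where "graph_chart e \<phi> L" using lipschitz_chart_graph_chart[OF c] .
  then interpret graph_chart e \<phi> L .
  have U: "open U" and in\<Omega>: "\<And>y. y \<in> U \<Longrightarrow> y \<in> \<Omega> \<longleftrightarrow> \<phi> y < y \<bullet> e"
    using c unfolding lipschitz_chart_def by auto
  have \<phi>x: "\<phi> x = x \<bullet> e" using frontier_chart_iff[OF c \<open>open \<Omega>\<close> x(1)] x(2) by simp
  obtain \<rho> where \<rho>: "\<rho> > 0" "ball x \<rho> \<subseteq> U" using U x(1) open_contains_ball by blast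
  let ?s = "sqrt (1 + (norm D)\<^sup>2)"
  have s: "?s \<ge> 1" by simp
  have \<nu>: "w \<bullet> graph_normal e \<phi> x = (w \<bullet> D - w \<bullet> e) / ?s" for w
    by (simp add: graph_normal_def gradient_eq[OF D] inner_diff_right divide_inverse mult.commute)
  show ?thesis
    unfolding tangent_normal_def
  proof (intro conjI allI impI)
    show "norm (graph_normal e \<phi> x) = 1" using D by (rule norm_graph_normal)
    fix \<epsilon> :: real assume \<epsilon>: "\<epsilon> > 0"
    obtain \<delta> where \<delta>: "\<delta> > 0" "\<And>h. norm h < \<delta> \<Longrightarrow> \<bar>\<phi> (x + h) - \<phi> x - h \<bullet> D\<bar> \<le> \<epsilon> * norm h"
      using D \<epsilon> unfolding GDERIV_iff_eps by meson
    have "(w \<bullet> graph_normal e \<phi> x < - \<epsilon> * norm w \<longrightarrow> x + w \<in> \<Omega>) \<and> (w \<bullet> graph_normal e \<phi> x > \<epsilon> * norm w \<longrightarrow> x + w \<notin> \<Omega>)"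
      if w: "norm w < min \<delta> \<rho>" for w
    proof -
      have "x + w \<in> U" using w \<rho>(2) by (auto simp: dist_norm)
      then have iff: "x + w \<in> \<Omega> \<longleftrightarrow> \<phi> (x + w) < x \<bullet> e + w \<bullet> e" by (simp add: in\<Omega> inner_add_left)
      have b: "\<bar>\<phi> (x + w) - \<phi> x - w \<bullet> D\<bar> \<le> \<epsilon> * norm w" using \<delta>(2)[of w] w by simp
      \<comment> \<open>Clearing the denominator of the normal, which is at least 1, turns the cone
        condition into an inequality that beats the first order error of \<phi> for the same
        \<epsilon>.\<close>
      have se: "\<epsilon> * norm w \<le> \<epsilon> * norm w * ?s" using s \<epsilon> by (intro mult_left_mono[of 1 ?s "\<epsilon> * norm w", simplified]) auto
      have "w \<bullet> D - w \<bullet> e < - \<epsilon> * norm w" if "w \<bullet> graph_normal e \<phi> x < - \<epsilon> * norm w"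
      proof -
        have "w \<bullet> D - w \<bullet> e < (- \<epsilon> * norm w) * ?s"
          using that s unfolding \<nu> by (subst (asm) pos_divide_less_eq) (linarith, simp)
        then show ?thesis using se by linarith
      qed
      moreover have "w \<bullet> D - w \<bullet> e > \<epsilon> * norm w" if "w \<bullet> graph_normal e \<phi> x > \<epsilon> * norm w"
      proof -
        have "w \<bullet> D - w \<bullet> e > (\<epsilon> * norm w) * ?s"
          using that s unfolding \<nu> by (subst (asm) pos_less_divide_eq) (linarith, simp)
        then show ?thesis using se by linarith
      qed
      ultimately show ?thesis unfolding iff using b \<phi>x by force
    qed
    then show "\<exists>\<delta>>0. \<forall>w. norm w < \<delta> \<longrightarrow> (w \<bullet> graph_normal e \<phi> x < - \<epsilon> * norm w \<longrightarrow> x + w \<in> \<Omega>) \<and>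
        (w \<bullet> graph_normal e \<phi> x > \<epsilon> * norm w \<longrightarrow> x + w \<notin> \<Omega>)"
      using \<delta>(1) \<rho>(1) by (intro exI[of _ "min \<delta> \<rho>"]) auto
  qed
qed

text \<open>The existence of a tangent normal does not refer to charts, so this converse makes the
  differentiability of the chart function at a boundary point independent of the chart. Solving
  \<nu> = (D - e) / sqrt (1 + |D|^2) for D gives e + \<nu> / \<kappa> with \<kappa> = - (e . \<nu>),
  and the cones enclose \<phi> (x + h) between two nearby heights.\<close>

lemma GDERIV_if_tangent_normal:
  assumes c: "lipschitz_chart \<Omega> U e \<phi>" and "open \<Omega>" and x: "x \<in> U" "x \<in> frontier \<Omega>"
    and \<nu>: "tangent_normal \<Omega> x \<nu>"
  shows "\<exists>D. GDERIV \<phi> x :> D"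
proof -
  obtain L where "graph_chart e \<phi> L" using lipschitz_chart_graph_chart[OF c] .
  then interpret graph_chart e \<phi> L .
  have U: "open U" and in\<Omega>: "\<And>y. y \<in> U \<Longrightarrow> y \<in> \<Omega> \<longleftrightarrow> \<phi> y < y \<bullet> e"
    using c unfolding lipschitz_chart_def by auto
  have \<phi>x: "\<phi> x = x \<bullet> e" using frontier_chart_iff[OF c \<open>open \<Omega>\<close> x(1)] x(2) by simp
  obtain \<rho> where \<rho>: "\<rho> > 0" "ball x \<rho> \<subseteq> U" using U x(1) open_contains_ball by blast
  have n\<nu>: "norm \<nu> = 1" and \<nu>\<nu>: "\<nu> \<bullet> \<nu> = 1" using \<nu> by (auto simp: tangent_normal_def norm_eq_1)
  have tn: "\<exists>\<delta>>0. \<forall>w. norm w < \<delta> \<longrightarrow> (w \<bullet> \<nu> < - \<epsilon> * norm w \<longrightarrow> x + w \<in> \<Omega>) \<and> (w \<bullet> \<nu> > \<epsilon> * norm w \<longrightarrow> x + w \<notin> \<Omega>)"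
    if "\<epsilon> > 0" for \<epsilon> using \<nu> that unfolding tangent_normal_def by blast
  define \<kappa> where "\<kappa> = - (e \<bullet> \<nu>)"
  \<comment> \<open>If e . \<nu> were nonnegative, w = e + \<theta> \<nu> would point out of
    \<Omega>; but since (L + 1) \<theta> < 1, moving along w climbs faster than \<phi> can, hence
    into \<Omega>.\<close>
  have \<kappa>: "\<kappa> > 0"
  proof (rule ccontr)
    assume neg: "\<not> \<kappa> > 0"
    define \<theta> where "\<theta> = 1 / (L + 2)"
    have \<theta>: "\<theta> > 0" "(L + 1) * \<theta> < 1" using L_nonneg by (auto simp: \<theta>_def)
    define w where "w = e + \<theta> *\<^sub>R \<nu>"
    have w\<nu>: "w \<bullet> \<nu> > 0" using neg \<theta>(1) \<nu>\<nu> by (simp add: w_def inner_add_left \<kappa>_def)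
    then have w0: "norm w > 0" by auto
    define \<epsilon> where "\<epsilon> = w \<bullet> \<nu> / (2 * norm w)"
    have \<epsilon>: "\<epsilon> > 0" "\<epsilon> * norm w < w \<bullet> \<nu>" using w\<nu> w0 by (auto simp: \<epsilon>_def)
    obtain \<delta> where \<delta>: "\<delta> > 0" "\<And>w. norm w < \<delta> \<Longrightarrow> w \<bullet> \<nu> > \<epsilon> * norm w \<Longrightarrow> x + w \<notin> \<Omega>"
      using tn[OF \<epsilon>(1)] by blast
    define t where "t = min \<delta> \<rho> / (2 * norm w)"
    have t: "t > 0" "norm (t *\<^sub>R w) < \<delta>" "norm (t *\<^sub>R w) < \<rho>"
      using w0 \<delta>(1) \<rho>(1) by (auto simp: t_def min_def)
    have "(t *\<^sub>R w) \<bullet> \<nu> > \<epsilon> * norm (t *\<^sub>R w)"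
      using t(1) mult_strict_left_mono[OF \<epsilon>(2) t(1)] by (auto simp: mult_ac)
    then have "x + t *\<^sub>R w \<notin> \<Omega>" using \<delta>(2) t(2) by blast
    moreover have "x + t *\<^sub>R w \<in> U" using t(3) \<rho>(2) by (auto simp: dist_norm)
    ultimately have ge: "\<phi> (x + t *\<^sub>R w) \<ge> x \<bullet> e + t * (w \<bullet> e)" by (simp add: in\<Omega> inner_add_left not_less)
    have "x + t *\<^sub>R w = x + (t * \<theta>) *\<^sub>R \<nu> + t *\<^sub>R e" by (simp add: w_def scaleR_add_right add_ac)
    then have "\<phi> (x + t *\<^sub>R w) = \<phi> (x + (t * \<theta>) *\<^sub>R \<nu>)" by (simp only: phi_shift)
    also have "\<dots> \<le> \<phi> x + L * (t * \<theta>)"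
      using lip_abs[OF lip, of "x + (t * \<theta>) *\<^sub>R \<nu>" x] t(1) \<theta>(1) n\<nu> by simp
    finally have "t * (w \<bullet> e) \<le> L * (t * \<theta>)" using ge \<phi>x by linarith
    then have "t * (w \<bullet> e) \<le> t * (L * \<theta>)" by (simp add: mult_ac)
    then have "w \<bullet> e \<le> L * \<theta>" using t(1) by simp
    moreover have "\<nu> \<bullet> e \<ge> -1" using Cauchy_Schwarz_ineq2[of \<nu> e] n\<nu> norm_e by simp
    then have "\<theta> * (\<nu> \<bullet> e) \<ge> \<theta> * (-1)" using \<theta>(1) by (intro mult_left_mono) auto
    ultimately show False using \<theta>(2) by (simp add: w_def inner_add_left distrib_right)
  qed
  have "GDERIV \<phi> x :> e + (1 / \<kappa>) *\<^sub>R \<nu>"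
    unfolding GDERIV_iff_eps
  proof (intro allI impI)
    fix \<epsilon> :: real assume \<epsilon>: "\<epsilon> > 0"
    \<comment> \<open>K |h| bounds every vector h + \<tau> e used below, since |\<tau>| \<le> |h| /
      \<kappa> + \<epsilon> |h|. The cone parameter \<kappa> \<epsilon> / (2 K) then leaves the
      required inequalities strict.\<close>
    define K where "K = 1 + 1 / \<kappa> + \<epsilon>"
    have K: "K > 0" using \<kappa> \<epsilon> by (simp add: K_def add_pos_pos)
    obtain \<delta> where \<delta>: "\<delta> > 0" "\<And>w. norm w < \<delta> \<Longrightarrow> w \<bullet> \<nu> < - (\<kappa> * \<epsilon> / (2 * K)) * norm w \<Longrightarrow> x + w \<in> \<Omega>"
        "\<And>w. norm w < \<delta> \<Longrightarrow> w \<bullet> \<nu> > (\<kappa> * \<epsilon> / (2 * K)) * norm w \<Longrightarrow> x + w \<notin> \<Omega>"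
      using tn[of "\<kappa> * \<epsilon> / (2 * K)"] \<kappa> \<epsilon> K by auto
    have "\<bar>\<phi> (x + h) - \<phi> x - h \<bullet> (e + (1 / \<kappa>) *\<^sub>R \<nu>)\<bar> \<le> \<epsilon> * norm h" if h: "norm h < min \<delta> \<rho> / K" for h
    proof (cases "h = 0")
      case False
      have bnd: "norm w \<le> K * norm h" "norm w < \<delta>" "x + w \<in> U" "(\<kappa> * \<epsilon> / (2 * K)) * norm w < \<kappa> * \<epsilon> * norm h"
        if w: "w = h + \<tau> *\<^sub>R e" "\<bar>\<tau>\<bar> \<le> norm h / \<kappa> + \<epsilon> * norm h" for w \<tau>
      proof -
        have "norm w \<le> norm h + \<bar>\<tau>\<bar>" using norm_triangle_ineq[of h "\<tau> *\<^sub>R e"] norm_e w(1) by simp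
        then show 1: "norm w \<le> K * norm h" using w(2) by (simp add: K_def algebra_simps)
        have "K * norm h < min \<delta> \<rho>" using h K by (simp add: less_divide_eq mult.commute)
        with 1 have "norm w < min \<delta> \<rho>" by linarith
        then show "norm w < \<delta>" "x + w \<in> U" using \<rho>(2) by (auto simp: dist_norm)
        have "(\<kappa> * \<epsilon> / (2 * K)) * norm w \<le> (\<kappa> * \<epsilon> / (2 * K)) * (K * norm h)"
          using 1 \<kappa> \<epsilon> K by (intro mult_left_mono) auto
        also have "\<dots> = \<kappa> * \<epsilon> * norm h / 2" using K by simp
        also have "\<dots> < \<kappa> * \<epsilon> * norm h" using \<kappa> \<epsilon> False by simp
        finally show "(\<kappa> * \<epsilon> / (2 * K)) * norm w < \<kappa> * \<epsilon> * norm h" .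
      qed
      have h\<nu>: "\<bar>h \<bullet> \<nu> / \<kappa>\<bar> \<le> norm h / \<kappa>"
        using Cauchy_Schwarz_ineq2[of h \<nu>] n\<nu> \<kappa> by (simp add: abs_divide divide_right_mono)
      have dot: "(h + \<tau> *\<^sub>R e) \<bullet> \<nu> = h \<bullet> \<nu> - \<kappa> * \<tau>" for \<tau> by (simp add: inner_add_left \<kappa>_def)
      have mem: "x + (h + \<tau> *\<^sub>R e) \<in> \<Omega> \<longleftrightarrow> \<phi> (x + h) < x \<bullet> e + h \<bullet> e + \<tau>" if "x + (h + \<tau> *\<^sub>R e) \<in> U" for \<tau>
        using in\<Omega>[OF that] phi_shift[of "x + h" \<tau>] by (simp add: inner_add_left add.assoc)
      \<comment> \<open>The tangent plane predicts \<tau> = h . \<nu> / \<kappa>. Raised by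
        \<epsilon> |h| the point lies in \<Omega>, lowered by \<epsilon> |h| it lies outside, which
        brackets \<phi> (x + h).\<close>
      define \<tau>1 where "\<tau>1 = h \<bullet> \<nu> / \<kappa> + \<epsilon> * norm h"
      have \<tau>1: "\<bar>\<tau>1\<bar> \<le> norm h / \<kappa> + \<epsilon> * norm h"
        using h\<nu> \<epsilon> abs_triangle_ineq[of "h \<bullet> \<nu> / \<kappa>" "\<epsilon> * norm h"] by (simp add: \<tau>1_def)
      note b1 = bnd[OF refl \<tau>1]
      have "(h + \<tau>1 *\<^sub>R e) \<bullet> \<nu> = - (\<kappa> * \<epsilon> * norm h)" unfolding dot using \<kappa> by (simp add: \<tau>1_def distrib_left)
      then have "x + (h + \<tau>1 *\<^sub>R e) \<in> \<Omega>" using b1(4) by (intro \<delta>(2) b1(2)) simp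
      then have u: "\<phi> (x + h) < x \<bullet> e + h \<bullet> e + \<tau>1" using mem[OF b1(3)] by simp
      define \<tau>2 where "\<tau>2 = h \<bullet> \<nu> / \<kappa> - \<epsilon> * norm h"
      have \<tau>2: "\<bar>\<tau>2\<bar> \<le> norm h / \<kappa> + \<epsilon> * norm h"
        using h\<nu> \<epsilon> abs_triangle_ineq4[of "h \<bullet> \<nu> / \<kappa>" "\<epsilon> * norm h"] by (simp add: \<tau>2_def)
      note b2 = bnd[OF refl \<tau>2]
      have "(h + \<tau>2 *\<^sub>R e) \<bullet> \<nu> = \<kappa> * \<epsilon> * norm h" unfolding dot using \<kappa> by (simp add: \<tau>2_def right_diff_distrib)
      then have "x + (h + \<tau>2 *\<^sub>R e) \<notin> \<Omega>" using b2(4) by (intro \<delta>(3) b2(2)) simp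
      then have l: "\<phi> (x + h) \<ge> x \<bullet> e + h \<bullet> e + \<tau>2" using mem[OF b2(3)] by simp
      show ?thesis using u l \<phi>x by (simp add: \<tau>1_def \<tau>2_def inner_add_right abs_le_iff)
    qed simp
    then show "\<exists>\<delta>>0. \<forall>h. norm h < \<delta> \<longrightarrow> \<bar>\<phi> (x + h) - \<phi> x - h \<bullet> (e + (1 / \<kappa>) *\<^sub>R \<nu>)\<bar> \<le> \<epsilon> * norm h"
      using \<delta>(1) \<rho>(1) K by (intro exI[of _ "min \<delta> \<rho> / K"]) auto
  qed
  then show ?thesis by blast
qed

text \<open>Where \<phi> has no gradient, no tangent normal exists, so no other chart provides a
  normal either, and the definite description takes its default value
  \<open>THE \<nu>. False\<close>. The formula thus holds at every boundary point in U, as Borel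
  measurability requires.\<close>

lemma exterior_normal_chart:
  assumes c: "lipschitz_chart \<Omega> U e \<phi>" and "open \<Omega>" and x: "x \<in> U" "x \<in> frontier \<Omega>"
  shows "exterior_normal \<Omega> x = (if \<exists>D. GDERIV \<phi> x :> D then graph_normal e \<phi> x else (THE \<nu>. False))"
proof -
  have tn: "tangent_normal \<Omega> x \<nu>" if "is_exterior_normal \<Omega> x \<nu>" for \<nu>
  proof -
    obtain U' e' \<phi>' D where 1: "lipschitz_chart \<Omega> U' e' \<phi>'" "x \<in> U'" "GDERIV \<phi>' x :> D"
        "\<nu> = (D - e') /\<^sub>R sqrt (1 + (norm D)\<^sup>2)"
      using \<open>is_exterior_normal \<Omega> x \<nu>\<close> unfolding is_exterior_normal_def by blast
    have "\<nu> = graph_normal e' \<phi>' x" using 1(4) by (simp add: graph_normal_def gradient_eq[OF 1(3)])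
    then show ?thesis using tangent_normal_graph_normal[OF 1(1) \<open>open \<Omega>\<close> 1(2) x(2) 1(3)] by simp
  qed
  show ?thesis
  proof (cases "\<exists>D. GDERIV \<phi> x :> D")
    case True
    then obtain D where D: "GDERIV \<phi> x :> D" by blast
    have "is_exterior_normal \<Omega> x (graph_normal e \<phi> x)"
      unfolding is_exterior_normal_def using c x D
      by (intro exI[of _ U] exI[of _ e] exI[of _ \<phi>] exI[of _ D]) (simp add: graph_normal_def gradient_eq[OF D])
    then have "exterior_normal \<Omega> x = graph_normal e \<phi> x"
      unfolding exterior_normal_def using tn tangent_normal_unique by (intro the_equality) blast+
    with True show ?thesis by simp
  next
    case False
    then have "is_exterior_normal \<Omega> x = (\<lambda>\<nu>. False)"
      using tn GDERIV_if_tangent_normal[OF c \<open>open \<Omega>\<close> x] by blast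
    then show ?thesis using False by (simp add: exterior_normal_def)
  qed
qed

section \<open>Flux through the boundary of a Lipschitz domain\<close>

context graph_chart
begin

section \<open>Volume of boundary layers\<close>

text \<open>Every line of direction e meets the layer in length at most h, and only lines through
  slab points of norm at most R + 1 reach the ball of radius R.\<close>

lemma graph_layer_measure:
  assumes h: "0 \<le> h"
  shows "emeasure lborel {y. norm y \<le> R \<and> \<phi> y < y \<bullet> e \<and> y \<bullet> e \<le> \<phi> y + h} \<le>
     ennreal (h * measure lborel (cball (0::'a) (R + 1)))"
proof -
  let ?S = "{y. norm y \<le> R \<and> \<phi> y < y \<bullet> e \<and> y \<bullet> e \<le> \<phi> y + h}"
  have [measurable]: "?S \<in> sets borel" by measurable
  have "emeasure lborel ?S = (\<integral>\<^sup>+y. indicator ?S y \<partial>lborel)" by simp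
  also have "\<dots> = (\<integral>\<^sup>+x. indicator slab x * (\<integral>\<^sup>+t. indicator ?S (x + t *\<^sub>R e) \<partial>lborel) \<partial>lborel)"
    using nn_integral_slab[of "indicator ?S" e] e_nz by simp
  also have "\<dots> \<le> (\<integral>\<^sup>+x. ennreal h * indicator (cball 0 (R + 1) :: 'a set) x \<partial>lborel)"
  proof (rule nn_integral_mono)
    fix x :: 'a
    show "indicator slab x * (\<integral>\<^sup>+t. indicator ?S (x + t *\<^sub>R e) \<partial>lborel) \<le> ennreal h * indicator (cball 0 (R + 1)) x"
    proof (cases "x \<in> slab \<and> (\<exists>t. x + t *\<^sub>R e \<in> ?S)")
      case True
      then obtain t where "norm (x + t *\<^sub>R e) \<le> R" by blast
      then have nx: "norm x \<le> R + 1" using slab_support True by blast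
      have "(\<integral>\<^sup>+t. indicator ?S (x + t *\<^sub>R e) \<partial>lborel) \<le> (\<integral>\<^sup>+t. indicator {\<phi> x - x \<bullet> e..\<phi> x - x \<bullet> e + h} t \<partial>lborel)"
        by (intro nn_integral_mono) (auto simp: indicator_def phi_shift inner_add_left)
      also have "\<dots> = ennreal h" using h by simp
      finally show ?thesis using True nx by simp
    next
      case False
      then have "x \<in> slab \<Longrightarrow> (\<lambda>t. indicator ?S (x + t *\<^sub>R e) :: ennreal) = (\<lambda>t. 0)"
        by (intro ext indicator_simps(2)) blast
      then have "indicator slab x * (\<integral>\<^sup>+t. indicator ?S (x + t *\<^sub>R e) \<partial>lborel) = (0::ennreal)"
        by (cases "x \<in> slab") (simp_all only: indicator_simps nn_integral_const mult_zero_left mult_zero_right mult_1 not_False_eq_True)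
      then show ?thesis by (simp only: zero_le)
    qed
  qed
  also have "\<dots> = ennreal h * emeasure lborel (cball (0::'a) (R + 1))"
    by (intro nn_integral_cmult_indicator) simp
  also have "\<dots> = ennreal (h * measure lborel (cball (0::'a) (R + 1)))"
    using h emeasure_lborel_cball_finite[of "0::'a" "R + 1"]
    by (simp add: emeasure_eq_ennreal_measure ennreal_mult less_top)
  finally show ?thesis .
qed

end

lemma frontier_between:
  fixes x y :: "'a::real_normed_vector"
  assumes "x \<in> \<Omega>" "y \<notin> \<Omega>"
  obtains p where "p \<in> frontier \<Omega>" "norm (p - x) \<le> norm (y - x)" "norm (p - y) \<le> norm (y - x)"
proof -
  have "closed_segment x y \<inter> frontier \<Omega> \<noteq> {}"
    using assms by (intro connected_Int_frontier) auto
  then obtain p where p: "p \<in> closed_segment x y" "p \<in> frontier \<Omega>" by blast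
  have "norm (p - x) \<le> norm (y - x)" "norm (p - y) \<le> norm (y - x)"
    using segment_bound[OF p(1)] by (auto simp: norm_minus_commute)
  with p(2) show thesis by (rule that)
qed

text \<open>The segment from y in \<Omega> to y + z outside meets the boundary within |z| of both
  ends. For small z both ends therefore lie in one chart, and y is at height at most (L + 1) |z|
  above the graph: L |z| from the variation of \<phi>, and |z| from the step itself.\<close>

lemma exit_measure_bound:
  fixes \<Omega> :: "'a::euclidean_space set"
  assumes \<Omega>: "bounded_lipschitz_domain \<Omega>"
  obtains C where "0 \<le> C" "\<And>z. emeasure lborel {y \<in> \<Omega>. y + z \<notin> \<Omega>} \<le> ennreal (C * norm z)"
proof -
  have o: "open \<Omega>" and b: "bounded \<Omega>" using \<Omega> by (auto simp: bounded_lipschitz_domain_def)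
  obtain n :: nat and c :: "nat \<Rightarrow> 'a" and r U e \<phi> where ch: "\<And>i. i < n \<Longrightarrow> lipschitz_chart \<Omega> (U i) (e i) (\<phi> i)"
    and cov: "\<And>i. i < n \<Longrightarrow> 0 < r i" "\<And>i. i < n \<Longrightarrow> cball (c i) (2 * r i) \<subseteq> U i"
      "frontier \<Omega> \<subseteq> (\<Union>i<n. ball (c i) (r i))"
    by (rule lipschitz_chart_cover[OF \<Omega>]) blast
  have "\<exists>L. i < n \<longrightarrow> graph_chart (e i) (\<phi> i) L" for i
    using lipschitz_chart_graph_chart[OF ch] by blast
  then obtain L where L: "\<And>i. i < n \<Longrightarrow> graph_chart (e i) (\<phi> i) (L i)" by metis
  \<comment> \<open>The element 1 makes the set nonempty when n = 0.\<close>
  define \<delta> where "\<delta> = Min (insert 1 (r ` {..<n}))"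
  have \<delta>: "\<delta> > 0" "\<And>i. i < n \<Longrightarrow> \<delta> \<le> r i" using cov(1) by (auto simp: \<delta>_def)
  define R where "R i = norm (c i) + 2 * r i" for i
  define C1 where "C1 = (\<Sum>i<n. (L i + 1) * measure lborel (cball (0::'a) (R i + 1)))"
  \<comment> \<open>The trivial bound by the volume of \<Omega>, made linear in |z| for |z| \<ge>
    \<delta>.\<close>
  define C2 where "C2 = measure lborel \<Omega> / \<delta>"
  have L0: "L i \<ge> 0" if "i < n" for i using graph_chart.L_nonneg[OF L[OF that]] .
  have C1: "0 \<le> C1" unfolding C1_def using L0 by (intro sum_nonneg mult_nonneg_nonneg) auto
  have C2: "0 \<le> C2" using \<delta>(1) by (simp add: C2_def)
  let ?E = "\<lambda>z. {y \<in> \<Omega>. y + z \<notin> \<Omega>}"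
  have "emeasure lborel (?E z) \<le> ennreal ((C1 + C2) * norm z)" for z
  proof (cases "norm z < \<delta>")
    case True
    let ?S = "\<lambda>i. {y. norm y \<le> R i \<and> \<phi> i y < y \<bullet> e i \<and> y \<bullet> e i \<le> \<phi> i y + (L i + 1) * norm z}"
    have [measurable]: "?S i \<in> sets borel" if "i < n" for i
    proof -
      interpret graph_chart "e i" "\<phi> i" "L i" using L[OF that] .
      show ?thesis by measurable
    qed
    have sub: "?E z \<subseteq> (\<Union>i<n. ?S i)"
    proof
      fix y assume y: "y \<in> ?E z"
      then obtain p where p: "p \<in> frontier \<Omega>" "norm (p - y) \<le> norm z" "norm (p - (y + z)) \<le> norm z"
        using frontier_between[of y \<Omega> "y + z"] by auto
      then obtain i where i: "i < n" "p \<in> ball (c i) (r i)" using cov(3) by blast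
      interpret graph_chart "e i" "\<phi> i" "L i" using L[OF i(1)] .
      have rz: "norm z \<le> r i" using True \<delta>(2)[OF i(1)] by linarith
      have d: "dist (c i) y \<le> 2 * r i" "dist (c i) (y + z) \<le> 2 * r i"
        using dist_triangle[of "c i" y p] dist_triangle[of "c i" "y + z" p] p(2,3) i(2) rz
        by (auto simp: dist_norm)
      then have U: "y \<in> U i" "y + z \<in> U i" using cov(2)[OF i(1)] by auto
      have "y \<in> \<Omega> \<longleftrightarrow> \<phi> i y < y \<bullet> e i" "y + z \<in> \<Omega> \<longleftrightarrow> \<phi> i (y + z) < (y + z) \<bullet> e i"
        using ch[OF i(1)] U unfolding lipschitz_chart_def by auto
      then have 1: "\<phi> i y < y \<bullet> e i" "y \<bullet> e i + z \<bullet> e i \<le> \<phi> i (y + z)" using y by (auto simp: inner_add_left)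
      have "\<phi> i (y + z) \<le> \<phi> i y + L i * norm z" using lip_abs[OF lip, of "y + z" y] by simp
      moreover have "\<bar>z \<bullet> e i\<bar> \<le> norm z" using Cauchy_Schwarz_ineq2[of z "e i"] norm_e by simp
      ultimately have 2: "y \<bullet> e i \<le> \<phi> i y + (L i + 1) * norm z" using 1(2) by (simp add: distrib_right)
      have "norm y \<le> R i" using d(1) norm_triangle_sub[of y "c i"] by (simp add: R_def dist_norm norm_minus_commute)
      with 1(1) 2 i(1) show "y \<in> (\<Union>i<n. ?S i)" by blast
    qed
    have "emeasure lborel (?E z) \<le> emeasure lborel (\<Union>i<n. ?S i)"
      using sub by (intro emeasure_mono) auto
    also have "\<dots> \<le> (\<Sum>i<n. emeasure lborel (?S i))"
      by (intro emeasure_subadditive_finite) auto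
    also have "\<dots> \<le> (\<Sum>i<n. ennreal ((L i + 1) * norm z * measure lborel (cball (0::'a) (R i + 1))))"
    proof (rule sum_mono)
      fix i assume i: "i \<in> {..<n}"
      then interpret graph_chart "e i" "\<phi> i" "L i" using L by simp
      show "emeasure lborel (?S i) \<le> ennreal ((L i + 1) * norm z * measure lborel (cball (0::'a) (R i + 1)))"
        using L_nonneg by (intro graph_layer_measure) simp
    qed
    also have "\<dots> = ennreal (C1 * norm z)"
      using L0 by (subst sum_ennreal) (auto simp: C1_def sum_distrib_left mult_ac)
    also have "\<dots> \<le> ennreal ((C1 + C2) * norm z)" using C2 by (intro ennreal_leI mult_right_mono) auto
    finally show ?thesis .
  next
    case False
    have "emeasure lborel (?E z) \<le> emeasure lborel \<Omega>" using o by (intro emeasure_mono) auto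
    also have "\<dots> = ennreal (C2 * \<delta>)"
      using emeasure_bounded_finite[OF b] \<delta>(1) by (simp add: C2_def emeasure_eq_ennreal_measure less_top)
    also have "\<dots> \<le> ennreal ((C1 + C2) * norm z)"
      using False C1 C2 \<delta>(1) by (intro ennreal_leI mult_mono) auto
    finally show ?thesis .
  qed
  with C1 C2 show thesis by (intro that[of "C1 + C2"]) auto
qed

text \<open>Finitely many Borel pieces suffice: in each covering ball the chart formula is Borel,
  with its default value on the Borel set where the chart function is not differentiable.\<close>

lemma exterior_normal_measurable:
  fixes \<Omega> :: "'a::euclidean_space set"
  assumes \<Omega>: "bounded_lipschitz_domain \<Omega>"
  shows "(\<lambda>x. if x \<in> frontier \<Omega> then exterior_normal \<Omega> x else 0) \<in> borel_measurable borel"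
    (is "?N \<in> _")
proof -
  have o: "open \<Omega>" using \<Omega> by (auto simp: bounded_lipschitz_domain_def)
  obtain n :: nat and c :: "nat \<Rightarrow> 'a" and r U e \<phi> where ch: "\<And>i. i < n \<Longrightarrow> lipschitz_chart \<Omega> (U i) (e i) (\<phi> i)"
    and cov: "\<And>i. i < n \<Longrightarrow> 0 < r i" "\<And>i. i < n \<Longrightarrow> cball (c i) (2 * r i) \<subseteq> U i"
      "frontier \<Omega> \<subseteq> (\<Union>i<n. ball (c i) (r i))"
    by (rule lipschitz_chart_cover[OF \<Omega>]) blast
  define W where "W i = frontier \<Omega> \<inter> ball (c i) (r i)" for i
  \<comment> \<open>The last piece collects everything outside the covered part of the boundary; it
    contains no boundary point.\<close>
  define X where "X i = (if i < n then W i else - (\<Union>j<n. W j))" for i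
  show ?thesis
  proof (rule measurable_piecewise_restrict[where C="X ` {..n}"])
    have "X i \<in> sets borel" for i
    proof -
      have W: "W j \<in> sets borel" for j by (simp add: W_def)
      then have "- (\<Union>j<n. W j) \<in> sets borel" by (intro borel_comp sets.finite_UN) auto
      with W show ?thesis by (simp only: X_def) simp
    qed
    then show "\<Omega>' \<inter> space borel \<in> sets borel" if "\<Omega>' \<in> X ` {..n}" for \<Omega>'
      using that by auto
    show "space borel \<subseteq> \<Union>(X ` {..n})"
    proof
      fix x :: 'a
      show "x \<in> \<Union>(X ` {..n})"
      proof (cases "x \<in> (\<Union>j<n. W j)")
        case True
        then obtain j where "j < n" "x \<in> W j" by blast
        then show ?thesis by (auto simp: X_def intro!: bexI[of _ j])
      next
        case False
        then have "x \<in> X n" by (simp add: X_def)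
        then show ?thesis by blast
      qed
    qed
    fix \<Omega>' assume "\<Omega>' \<in> X ` {..n}"
    then obtain i where i: "\<Omega>' = X i" by blast
    show "?N \<in> borel_measurable (restrict_space borel \<Omega>')"
    proof (cases "i < n")
      case True
      obtain L where "graph_chart (e i) (\<phi> i) L" using lipschitz_chart_graph_chart[OF ch[OF True]] .
      then interpret graph_chart "e i" "\<phi> i" L .
      have [measurable]: "{x. \<exists>D. GDERIV (\<phi> i) x :> D} \<in> sets borel" using sets_GDERIV_phi[OF lip] .
      have "(\<lambda>x. if x \<in> {x. \<exists>D. GDERIV (\<phi> i) x :> D} then graph_normal (e i) (\<phi> i) x else (THE \<nu>. False)) \<in> borel_measurable borel"
        by measurable
      then have "(\<lambda>x. if x \<in> {x. \<exists>D. GDERIV (\<phi> i) x :> D} then graph_normal (e i) (\<phi> i) x else (THE \<nu>. False)) \<in> borel_measurable (restrict_space borel \<Omega>')"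
        by (rule measurable_restrict_space1)
      moreover have "?N x = (if x \<in> {x. \<exists>D. GDERIV (\<phi> i) x :> D} then graph_normal (e i) (\<phi> i) x else (THE \<nu>. False))"
        if "x \<in> \<Omega>'" for x
      proof -
        have x: "x \<in> frontier \<Omega>" "x \<in> ball (c i) (r i)" using that i True by (auto simp: X_def W_def)
        then have "x \<in> cball (c i) (2 * r i)" using cov(1)[OF True] by auto
        then have "x \<in> U i" using cov(2)[OF True] by blast
        then show ?thesis using exterior_normal_chart[OF ch[OF True] o _ x(1)] x(1) by simp
      qed
      ultimately show ?thesis
        by (subst measurable_cong) (auto simp: space_restrict_space)
    next
      case False
      have "x \<notin> frontier \<Omega>" if "x \<in> \<Omega>'" for x
        using that False cov(3) unfolding i X_def W_def by auto
      then show ?thesis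
        by (subst measurable_cong[where g="\<lambda>_. 0"]) (auto simp: space_restrict_space)
    qed
  qed auto
qed

text \<open>In other words, the distributional gradient of the indicator of the domain is minus the normal times
  the surface measure. The charts are glued with a continuous partition of unity near the boundary.\<close>

lemma domain_flux:
  fixes \<Omega> :: "'a::euclidean_space set" and f :: "'a \<Rightarrow> real"
  assumes \<Omega>: "bounded_lipschitz_domain \<Omega>"
    and f: "continuous_on UNIV f" and supp: "\<And>x. norm x > R \<Longrightarrow> f x = 0"
  defines "\<sigma> \<equiv> surface_measure \<Omega>"
  shows "((\<lambda>t. (\<integral>x. f x * (indicator \<Omega> (x - t *\<^sub>R d) - indicator \<Omega> x) \<partial>lborel) / t)
      \<longlongrightarrow> (\<integral>y. indicator (frontier \<Omega>) y * (f y * (d \<bullet> exterior_normal \<Omega> y)) \<partial>\<sigma>)) (at 0)"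
    and "integrable \<sigma> (\<lambda>y. indicator (frontier \<Omega>) y * (f y * (d \<bullet> exterior_normal \<Omega> y)))"
proof -
  have o: "open \<Omega>" and b: "bounded \<Omega>" using \<Omega> by (auto simp: bounded_lipschitz_domain_def)
  have [measurable]: "\<Omega> \<in> sets borel" using o by simp
  have [measurable]: "f \<in> borel_measurable borel" using f by (rule borel_measurable_continuous_onI)
  let ?\<Gamma> = "frontier \<Omega>"
  have \<Gamma>m[measurable]: "?\<Gamma> \<in> sets borel" by simp
  have \<Gamma>c: "compact ?\<Gamma>" using b by (rule compact_frontier_bounded)
  have s: "is_surface_measure \<Omega> \<sigma>" unfolding \<sigma>_def using \<Omega> by (rule is_surface_measure_surface_measure)
  have \<sigma>s[simp, measurable_cong]: "sets \<sigma> = sets borel" using s by (simp add: is_surface_measure_def)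
  define N where "N x = (if x \<in> ?\<Gamma> then exterior_normal \<Omega> x else 0)" for x
  have Nm[measurable]: "N \<in> borel_measurable borel" unfolding N_def using \<Omega> by (rule exterior_normal_measurable)
  have "bounded (f ` cball 0 R)"
    using f by (intro compact_imp_bounded compact_continuous_image continuous_on_subset[OF f]) auto
  then obtain M where "\<And>x. norm x \<le> R \<Longrightarrow> \<bar>f x\<bar> \<le> M"
    unfolding bounded_real by (metis image_eqI mem_cball_0)
  then have M: "\<bar>f x\<bar> \<le> \<bar>M\<bar>" for x using supp[of x] abs_ge_self[of M] by (cases "norm x \<le> R") (auto intro: order_trans)
  obtain n :: nat and c :: "nat \<Rightarrow> 'a" and r U e \<phi> where ch: "\<And>i. i < n \<Longrightarrow> lipschitz_chart \<Omega> (U i) (e i) (\<phi> i)"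
    and cov: "\<And>i. i < n \<Longrightarrow> 0 < r i" "\<And>i. i < n \<Longrightarrow> cball (c i) (2 * r i) \<subseteq> U i"
      "frontier \<Omega> \<subseteq> (\<Union>i<n. ball (c i) (r i))"
    by (rule lipschitz_chart_cover[OF \<Omega>]) blast
  have KU: "cball (c i) (r i) \<subseteq> U i" if "i < n" for i
    using cov(1,2)[OF that] subset_cball[of "r i" "2 * r i" "c i"] by auto
  \<comment> \<open>Tent functions on the covering balls. A continuous partition is enough, because
    \<open>chart_flux\<close> asks only for continuous integrands.\<close>
  define g where "g i x = max 0 (r i - dist (c i) x)" for i x
  define S where "S x = (\<Sum>i<n. g i x)" for x
  have gc: "continuous_on UNIV (g i)" for i unfolding g_def by (intro continuous_intros)
  have Sc: "continuous_on A S" for A unfolding S_def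
    using gc continuous_on_subset by (intro continuous_on_sum) blast
  have g0: "0 \<le> g i x" for i x by (simp add: g_def)
  have S_pos: "0 < S x" if "x \<in> ?\<Gamma>" for x
  proof -
    obtain i where "i < n" "x \<in> ball (c i) (r i)" using cov(3) \<open>x \<in> ?\<Gamma>\<close> by blast
    then have "g i x > 0" "i \<in> {..<n}" by (auto simp: g_def)
    then show ?thesis unfolding S_def using g0 by (intro sum_pos2[of _ i]) auto
  qed
  obtain m where m: "m > 0" "\<And>x. x \<in> ?\<Gamma> \<Longrightarrow> 2 * m \<le> S x"
  proof (cases "?\<Gamma> = {}")
    case True
    then show ?thesis by (intro that[of 1]) auto
  next
    case False
    obtain x0 where "x0 \<in> ?\<Gamma>" "\<And>y. y \<in> ?\<Gamma> \<Longrightarrow> S x0 \<le> S y"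
      using continuous_attains_inf[OF \<Gamma>c False Sc] by blast
    then show ?thesis using S_pos by (intro that[of "S x0 / 2"]) auto
  qed
  have S_lip: "\<bar>S x - S y\<bar> \<le> real n * norm (x - y)" for x y
  proof -
    have "\<bar>S x - S y\<bar> \<le> (\<Sum>i<n. \<bar>g i x - g i y\<bar>)" unfolding S_def sum_subtractf[symmetric] by (rule sum_abs)
    also have "\<dots> \<le> (\<Sum>i<n. norm (x - y))"
    proof (rule sum_mono)
      fix i
      have "\<bar>dist (c i) x - dist (c i) y\<bar> \<le> norm (x - y)"
        using norm_triangle_ineq3[of "c i - x" "c i - y"] by (simp add: dist_norm norm_minus_commute)
      then show "\<bar>g i x - g i y\<bar> \<le> norm (x - y)" by (auto simp: g_def max_def)
    qed
    finally show ?thesis by simp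
  qed
  \<comment> \<open>S is at least 2 m on the boundary. The maximum with m makes the quotient
    continuous everywhere, and the functions F i still add up to 1 wherever S \<ge> m.\<close>
  define F where "F i x = g i x / max (S x) m" for i x
  have Fc: "continuous_on UNIV (F i)" for i
    unfolding F_def using m(1) by (intro continuous_intros gc Sc) auto
  have F0: "F i x = 0" if "x \<notin> cball (c i) (r i)" for i x using that by (simp add: F_def g_def)
  have F1: "(\<Sum>i<n. F i x) = 1" if "S x \<ge> m" for x
    using that m(1) by (simp add: F_def sum_divide_distrib[symmetric] S_def[symmetric] max_def)
  define h where "h i x = f x * F i x" for i x
  have hc: "continuous_on UNIV (h i)" for i unfolding h_def by (intro continuous_intros f Fc)
  have [measurable]: "h i \<in> borel_measurable borel" for i by (intro borel_measurable_continuous_onI hc)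
  have h0: "h i x = 0" if "x \<notin> cball (c i) (r i)" for i x using F0[OF that] by (simp add: h_def)
  have chart: "integrable \<sigma> (\<lambda>y. indicator ?\<Gamma> y * (h i y * (d \<bullet> N y))) \<and>
     (\<integral>y. h i y * (d \<bullet> graph_normal (e i) (\<phi> i) y) \<partial>graph_measure (e i) (\<phi> i)) =
     (\<integral>y. indicator ?\<Gamma> y * (h i y * (d \<bullet> N y)) \<partial>\<sigma>)" if i: "i < n" for i
  proof -
    obtain L where "graph_chart (e i) (\<phi> i) L" using lipschitz_chart_graph_chart[OF ch[OF i]] .
    then interpret graph_chart "e i" "\<phi> i" L .
    let ?G = "graph_measure (e i) (\<phi> i)" and ?K = "cball (c i) (r i) \<inter> ?\<Gamma>"
    have Km[measurable]: "?K \<in> sets borel" by simp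
    \<comment> \<open>Surface measure and graph measure have the same restriction to the boundary
      part in the ball, so integrals can be exchanged there.\<close>
    have dens: "density ?G (indicator ?K) = density \<sigma> (indicator ?K)"
    proof (rule measure_eqI)
      fix A assume "A \<in> sets (density ?G (indicator ?K))"
      then have [measurable]: "A \<in> sets borel" by simp
      have "lipschitz_chart \<Omega> (U i) (e i) (\<phi> i) \<and> ?K \<inter> A \<in> sets borel \<and> ?K \<inter> A \<subseteq> U i \<inter> ?\<Gamma>"
        using ch[OF i] KU[OF i] by auto
      then have "emeasure \<sigma> (?K \<inter> A) = emeasure ?G (?K \<inter> A)"
        using s unfolding is_surface_measure_def by blast
      then show "emeasure (density ?G (indicator ?K)) A = emeasure (density \<sigma> (indicator ?K)) A"
        by (simp add: emeasure_density indicator_inter_arith[symmetric] del: Int_iff)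
    qed simp
    have AE_eq: "AE y in ?G. h i y * (d \<bullet> graph_normal (e i) (\<phi> i) y) = indicator ?K y * (h i y * (d \<bullet> N y))"
      using AE_graph_measure_GDERIV
    proof eventually_elim
      case (elim y)
      show ?case
      proof (cases "y \<in> cball (c i) (r i)")
        case True
        then have yU: "y \<in> U i" using KU[OF i] by blast
        then have y\<Gamma>: "y \<in> ?\<Gamma>" using frontier_chart_iff[OF ch[OF i] o yU] elim by simp
        have "exterior_normal \<Omega> y = graph_normal (e i) (\<phi> i) y"
          using exterior_normal_chart[OF ch[OF i] o yU y\<Gamma>] elim by auto
        then show ?thesis using y\<Gamma> True by (simp add: N_def)
      qed (simp add: h0)
    qed
    have ind: "indicator ?\<Gamma> y * (h i y * (d \<bullet> N y)) = indicator ?K y * (h i y * (d \<bullet> N y))" for y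
      using h0[of y i] by (auto simp: indicator_def)
    have fin: "emeasure ?G ?K < \<infinity>" by (intro emeasure_graph_measure_bounded) (auto intro: bounded_subset)
    have hb: "\<bar>h i y\<bar> \<le> \<bar>M\<bar>" for y
    proof -
      have "F i y \<le> 1"
      proof -
        have "g i y \<le> S y" unfolding S_def using i g0 by (intro member_le_sum) auto
        then have "g i y \<le> max (S y) m" by simp
        then show ?thesis using m(1) by (simp add: F_def)
      qed
      moreover have "F i y \<ge> 0" using g0 m(1) by (simp add: F_def)
      ultimately have "\<bar>f y\<bar> * \<bar>F i y\<bar> \<le> \<bar>M\<bar> * 1" using M by (intro mult_mono) auto
      then show ?thesis by (simp add: h_def abs_mult)
    qed
    have "integrable ?G (\<lambda>y. h i y * (d \<bullet> graph_normal (e i) (\<phi> i) y))"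
    proof (rule integrable_bounded_support[where A="cball (c i) (r i)" and c="\<bar>M\<bar> * (norm d * 2)"])
      show "emeasure ?G (cball (c i) (r i)) < \<infinity>" by (intro emeasure_graph_measure_bounded) auto
      fix y
      have "\<bar>d \<bullet> graph_normal (e i) (\<phi> i) y\<bar> \<le> norm d * norm (graph_normal (e i) (\<phi> i) y)"
        by (rule Cauchy_Schwarz_ineq2)
      also have "\<dots> \<le> norm d * 2" using norm_graph_normal_le[OF norm_e] by (intro mult_left_mono) auto
      finally show "\<bar>h i y * (d \<bullet> graph_normal (e i) (\<phi> i) y)\<bar> \<le> \<bar>M\<bar> * (norm d * 2)"
        using hb unfolding abs_mult by (intro mult_mono) auto
    qed (auto simp: h0)
    then have "integrable ?G (\<lambda>y. indicator ?K y * (h i y * (d \<bullet> N y)))"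
      by (rule integrable_cong_AE_imp[OF _ _ AE_eq]) measurable
    then have "integrable (density ?G (\<lambda>y. ennreal (indicator ?K y))) (\<lambda>y. h i y * (d \<bullet> N y))"
      by (subst integrable_density) auto
    then have "integrable (density \<sigma> (\<lambda>y. ennreal (indicator ?K y))) (\<lambda>y. h i y * (d \<bullet> N y))"
      using dens by (simp add: ennreal_indicator)
    then have 1: "integrable \<sigma> (\<lambda>y. indicator ?\<Gamma> y * (h i y * (d \<bullet> N y)))"
      unfolding ind by (subst (asm) integrable_density) auto
    have "(\<integral>y. h i y * (d \<bullet> graph_normal (e i) (\<phi> i) y) \<partial>?G) = (\<integral>y. indicator ?K y * (h i y * (d \<bullet> N y)) \<partial>?G)"
      using AE_eq by (intro integral_cong_AE) auto
    also have "\<dots> = (\<integral>y. h i y * (d \<bullet> N y) \<partial>density ?G (\<lambda>y. ennreal (indicator ?K y)))"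
      by (subst integral_density) auto
    also have "\<dots> = (\<integral>y. h i y * (d \<bullet> N y) \<partial>density \<sigma> (\<lambda>y. ennreal (indicator ?K y)))"
      using dens by (simp add: ennreal_indicator)
    also have "\<dots> = (\<integral>y. indicator ?K y * (h i y * (d \<bullet> N y)) \<partial>\<sigma>)"
      by (subst integral_density) auto
    finally show ?thesis using 1 unfolding ind by simp
  qed
  have N_eq: "indicator ?\<Gamma> y * (f y * (d \<bullet> exterior_normal \<Omega> y)) = (\<Sum>i<n. indicator ?\<Gamma> y * (h i y * (d \<bullet> N y)))" for y
  proof (cases "y \<in> ?\<Gamma>")
    case True
    then have "(\<Sum>i<n. F i y) = 1" using m by (intro F1) force
    then have "(\<Sum>i<n. h i y) = f y" by (simp add: h_def sum_distrib_left[symmetric])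
    then show ?thesis using True by (simp add: N_def sum_distrib_right[symmetric])
  qed simp
  show "integrable \<sigma> (\<lambda>y. indicator (frontier \<Omega>) y * (f y * (d \<bullet> exterior_normal \<Omega> y)))"
    unfolding N_eq using chart by (intro Bochner_Integration.integrable_sum) auto
  have rhs: "(\<integral>y. indicator (frontier \<Omega>) y * (f y * (d \<bullet> exterior_normal \<Omega> y)) \<partial>\<sigma>) =
      (\<Sum>i<n. \<integral>y. h i y * (d \<bullet> graph_normal (e i) (\<phi> i) y) \<partial>graph_measure (e i) (\<phi> i))"
    unfolding N_eq using chart by (subst Bochner_Integration.integral_sum) auto
  have lim: "((\<lambda>t. \<Sum>i<n. (\<integral>x. h i x * (indicator \<Omega> (x - t *\<^sub>R d) - indicator \<Omega> x) \<partial>lborel) / t)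
     \<longlongrightarrow> (\<Sum>i<n. \<integral>y. h i y * (d \<bullet> graph_normal (e i) (\<phi> i) y) \<partial>graph_measure (e i) (\<phi> i))) (at 0)"
  proof (intro tendsto_sum)
    fix i assume "i \<in> {..<n}"
    then show "((\<lambda>t. (\<integral>x. h i x * (indicator \<Omega> (x - t *\<^sub>R d) - indicator \<Omega> x) \<partial>lborel) / t)
     \<longlongrightarrow> (\<integral>y. h i y * (d \<bullet> graph_normal (e i) (\<phi> i) y) \<partial>graph_measure (e i) (\<phi> i))) (at 0)"
      using KU[of i] h0 by (intro chart_flux[OF ch hc, where K="cball (c i) (r i)"]) auto
  qed
  \<comment> \<open>The integrand vanishes unless exactly one of x and x - t d lies in \<Omega>, so
    only x within |t d| of the boundary count. Since S has Lipschitz constant n, it drops there from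
    2 m to no less than m, and the partition adds up to 1.\<close>
  have ev: "\<forall>\<^sub>F t in at 0. norm (t *\<^sub>R d) < m / (real n + 1)"
  proof -
    have "((\<lambda>t. norm (t *\<^sub>R d)) \<longlongrightarrow> norm (0 *\<^sub>R d)) (at 0)" by (intro tendsto_intros)
    then show ?thesis using m(1) by (intro order_tendstoD(2)) auto
  qed
  show "((\<lambda>t. (\<integral>x. f x * (indicator \<Omega> (x - t *\<^sub>R d) - indicator \<Omega> x) \<partial>lborel) / t)
      \<longlongrightarrow> (\<integral>y. indicator (frontier \<Omega>) y * (f y * (d \<bullet> exterior_normal \<Omega> y)) \<partial>\<sigma>)) (at 0)"
    unfolding rhs
  proof (rule Lim_transform_eventually[OF lim])
    show "\<forall>\<^sub>F t in at 0. (\<Sum>i<n. (\<integral>x. h i x * (indicator \<Omega> (x - t *\<^sub>R d) - indicator \<Omega> x) \<partial>lborel) / t) =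
       (\<integral>x. f x * (indicator \<Omega> (x - t *\<^sub>R d) - indicator \<Omega> x) \<partial>lborel) / t"
      using ev
    proof eventually_elim
      case (elim t)
      have pt: "f x * (indicator \<Omega> (x - t *\<^sub>R d) - indicator \<Omega> x) =
         (\<Sum>i<n. h i x * (indicator \<Omega> (x - t *\<^sub>R d) - indicator \<Omega> x))" for x
      proof (cases "x - t *\<^sub>R d \<in> \<Omega> \<longleftrightarrow> x \<in> \<Omega>")
        case True
        then show ?thesis by (simp add: indicator_def)
      next
        case False
        have "\<exists>p. p \<in> ?\<Gamma> \<and> norm (p - x) \<le> norm (t *\<^sub>R d)"
        proof (cases "x \<in> \<Omega>")
          case True
          with False show ?thesis using frontier_between[of x \<Omega> "x - t *\<^sub>R d"] by (metis add_diff_cancel_left' diff_add_cancel norm_minus_commute)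
        next
          case False
          with \<open>\<not> (x - t *\<^sub>R d \<in> \<Omega> \<longleftrightarrow> x \<in> \<Omega>)\<close> show ?thesis
            using frontier_between[of "x - t *\<^sub>R d" \<Omega> x] by (metis diff_diff_eq2 add_diff_cancel_left')
        qed
        then obtain p where p: "p \<in> ?\<Gamma>" "norm (p - x) \<le> norm (t *\<^sub>R d)" by blast
        have "real n * norm (p - x) \<le> real n * (m / (real n + 1))"
          using p(2) elim by (intro mult_left_mono) auto
        also have "\<dots> \<le> m" using m(1) by (simp add: divide_le_eq mult.commute mult_left_mono)
        finally have "S x \<ge> m" using S_lip[of p x] m(2)[OF p(1)] by linarith
        then have "(\<Sum>i<n. h i x) = f x" using F1 by (simp add: h_def sum_distrib_left[symmetric])
        then show ?thesis by (simp add: sum_distrib_right[symmetric])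
      qed
      have "integrable lborel (\<lambda>x. h i x * (indicator \<Omega> (x - t *\<^sub>R d) - indicator \<Omega> x))" for i
      proof -
        have "bounded (h i ` cball (c i) (r i))"
          by (intro compact_imp_bounded compact_continuous_image continuous_on_subset[OF hc]) auto
        then obtain B where B: "\<And>x. x \<in> cball (c i) (r i) \<Longrightarrow> \<bar>h i x\<bar> \<le> B" unfolding bounded_real by blast
        have "\<bar>h i x * (indicator \<Omega> (x - t *\<^sub>R d) - indicator \<Omega> x)\<bar> \<le> \<bar>B\<bar>" for x
          using B[of x] h0[of x i] abs_ge_self[of B] by (cases "x \<in> cball (c i) (r i)") (auto simp: indicator_def)
        then show ?thesis
          using emeasure_lborel_cball_finite[of "c i" "r i"]
          by (intro integrable_bounded_support[where A="cball (c i) (r i)" and c="\<bar>B\<bar>"]) (auto simp: h0)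
      qed
      then show ?case
        unfolding pt sum_divide_distrib[symmetric] by (subst Bochner_Integration.integral_sum) auto
    qed
  qed
qed

section \<open>The kernel of the fractional Laplacian\<close>

text \<open>Polar coordinates for radial functions. Both measures agree on the half-lines, by the
  volume of balls on one side and by integrating its derivative in the radius on the other.\<close>

lemma distr_norm_lborel:
  "distr lborel borel (norm :: 'a::euclidean_space \<Rightarrow> real) =
    density lborel (\<lambda>r. ennreal (indicator {0..} r * (real DIM('a) * unit_ball_vol DIM('a) * r ^ (DIM('a) - 1))))"
    (is "?L = ?R")
proof (rule measure_eqI_generator_eq)
  let ?E = "range (\<lambda>a::real. {..a})"
  let ?N = "DIM('a)"
  show "Int_stable ?E" by (auto simp: Int_stable_def)
  show "?E \<subseteq> Pow UNIV" by simp
  show "sets ?L = sigma_sets UNIV ?E" "sets ?R = sigma_sets UNIV ?E" by (simp_all add: borel_eq_atMost)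
  show "range (\<lambda>i. {..real i}) \<subseteq> ?E" "(\<Union>i. {..real i}) = (UNIV :: real set)"
    by (auto intro: real_arch_simple)
  have L: "emeasure ?L {..a} = (if a < 0 then 0 else ennreal (unit_ball_vol ?N * a ^ ?N))" for a
  proof -
    have "norm -` {..a} = cball (0::'a) a" by (auto simp: dist_norm)
    then show ?thesis by (simp add: emeasure_distr emeasure_cball not_less)
  qed
  show "emeasure ?L {..real i} \<noteq> \<infinity>" for i by (simp add: L)
  fix X assume "X \<in> ?E"
  then obtain a where X: "X = {..a}" by blast
  have "emeasure ?R {..a} = (\<integral>\<^sup>+r. ennreal (real ?N * unit_ball_vol ?N * r ^ (?N - 1)) * indicator {0..a} r \<partial>lborel)"
    by (subst emeasure_density) (auto intro!: nn_integral_cong simp: indicator_def)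
  also have "\<dots> = (if a < 0 then 0 else ennreal (unit_ball_vol ?N * a ^ ?N))"
  proof (cases "a < 0")
    case False
    have "(\<integral>\<^sup>+r. ennreal (real ?N * unit_ball_vol ?N * r ^ (?N - 1)) * indicator {0..a} r \<partial>lborel) =
        ennreal (unit_ball_vol ?N * a ^ ?N - unit_ball_vol ?N * 0 ^ ?N)"
      using False
      by (intro nn_integral_FTC_Icc) (auto intro!: derivative_eq_intros mult_nonneg_nonneg simp: unit_ball_vol_nonneg)
    then show ?thesis using False by (simp add: zero_power)
  qed simp
  finally show "emeasure ?L X = emeasure ?R X" unfolding X L ..
qed

lemma nn_integral_radial:
  assumes [measurable]: "g \<in> borel_measurable borel"
  shows "(\<integral>\<^sup>+z. g (norm (z::'a::euclidean_space)) \<partial>lborel) =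
    (\<integral>\<^sup>+r. ennreal (indicator {0..} r * (real DIM('a) * unit_ball_vol DIM('a) * r ^ (DIM('a) - 1))) * g r \<partial>lborel)"
proof -
  have "(\<integral>\<^sup>+z. g (norm (z::'a)) \<partial>lborel) = (\<integral>\<^sup>+r. g r \<partial>distr lborel borel (norm :: 'a \<Rightarrow> real))"
    by (intro nn_integral_distr[symmetric]) auto
  then show ?thesis unfolding distr_norm_lborel by (subst (asm) nn_integral_density) auto
qed

lemma nn_integral_norm_powr_ball:
  fixes \<beta> :: real
  assumes "\<beta> < real DIM('a)"
  shows "(\<integral>\<^sup>+z. ennreal (indicator (ball 0 1) z * norm (z::'a::euclidean_space) powr (- \<beta>)) \<partial>lborel) =
     ennreal (real DIM('a) * unit_ball_vol DIM('a) / (real DIM('a) - \<beta>))"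
proof -
  let ?N = "DIM('a)"
  let ?c = "real ?N * unit_ball_vol ?N"
  have c: "?c \<ge> 0" by (simp add: unit_ball_vol_nonneg)
  have "(\<integral>\<^sup>+z. ennreal (indicator (ball 0 1) z * norm (z::'a) powr (- \<beta>)) \<partial>lborel) =
     (\<integral>\<^sup>+z. ennreal (indicator {..<1} (norm z) * norm (z::'a) powr (- \<beta>)) \<partial>lborel)"
    by (intro nn_integral_cong) (auto simp: indicator_def)
  also have "\<dots> = (\<integral>\<^sup>+r. ennreal (indicator {0..} r * (?c * r ^ (?N - 1))) * ennreal (indicator {..<1} r * r powr (- \<beta>)) \<partial>lborel)"
    by (intro nn_integral_radial[of "\<lambda>r. ennreal (indicator {..<1} r * r powr (- \<beta>))"]) measurable
  also have "\<dots> = (\<integral>\<^sup>+r. ennreal (?c * r powr (real ?N - 1 - \<beta>)) * indicator {0..1} r \<partial>lborel)"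
  proof (rule nn_integral_cong_AE)
    have "AE r in lborel. r \<noteq> (0::real)" "AE r in lborel. r \<noteq> (1::real)"
      using AE_lborel_singleton by auto
    then show "AE r in lborel. ennreal (indicator {0..} r * (?c * r ^ (?N - 1))) * ennreal (indicator {..<1} r * r powr (- \<beta>)) =
        ennreal (?c * r powr (real ?N - 1 - \<beta>)) * indicator {0..1} r"
    proof eventually_elim
      case (elim r)
      show ?case
      proof (cases "0 < r \<and> r < 1")
        case True
        have "r ^ (?N - 1) = r powr (real ?N - 1)"
          using True by (simp add: powr_realpow[symmetric] of_nat_diff Suc_leI)
        then have "?c * r ^ (?N - 1) * r powr (- \<beta>) = ?c * r powr (real ?N - 1 - \<beta>)"
          by (simp add: powr_add[symmetric] mult.assoc)
        then show ?thesis using True c by (simp add: ennreal_mult'[symmetric])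
      qed (use elim in \<open>auto simp: indicator_def\<close>)
    qed
  qed
  also have "\<dots> = ennreal (?c * (1 powr (real ?N - 1 - \<beta> + 1) / (real ?N - 1 - \<beta> + 1)))"
    using assms c
    by (intro nn_integral_has_integral_lebesgue' has_integral_mult_right has_integral_powr_from_0) auto
  finally show ?thesis by simp
qed

lemma nn_integral_norm_powr_outside:
  fixes \<beta> :: real
  assumes "\<beta> > real DIM('a)"
  shows "(\<integral>\<^sup>+z. ennreal (indicator (- ball 0 1) z * norm (z::'a::euclidean_space) powr (- \<beta>)) \<partial>lborel) =
     ennreal (real DIM('a) * unit_ball_vol DIM('a) / (\<beta> - real DIM('a)))"
proof -
  let ?N = "DIM('a)"
  let ?c = "real ?N * unit_ball_vol ?N"
  have c: "?c \<ge> 0" by (simp add: unit_ball_vol_nonneg)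
  have "(\<integral>\<^sup>+z. ennreal (indicator (- ball 0 1) z * norm (z::'a) powr (- \<beta>)) \<partial>lborel) =
     (\<integral>\<^sup>+z. ennreal (indicator {1..} (norm z) * norm (z::'a) powr (- \<beta>)) \<partial>lborel)"
    by (intro nn_integral_cong) (auto simp: indicator_def)
  also have "\<dots> = (\<integral>\<^sup>+r. ennreal (indicator {0..} r * (?c * r ^ (?N - 1))) * ennreal (indicator {1..} r * r powr (- \<beta>)) \<partial>lborel)"
    by (intro nn_integral_radial[of "\<lambda>r. ennreal (indicator {1..} r * r powr (- \<beta>))"]) measurable
  also have "\<dots> = (\<integral>\<^sup>+r. ennreal (?c * r powr (real ?N - 1 - \<beta>)) * indicator {1..} r \<partial>lborel)"
  proof (rule nn_integral_cong)
    fix r :: real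
    show "ennreal (indicator {0..} r * (?c * r ^ (?N - 1))) * ennreal (indicator {1..} r * r powr (- \<beta>)) =
        ennreal (?c * r powr (real ?N - 1 - \<beta>)) * indicator {1..} r"
    proof (cases "1 \<le> r")
      case True
      have "r ^ (?N - 1) = r powr (real ?N - 1)"
        using True by (simp add: powr_realpow[symmetric] of_nat_diff Suc_leI)
      then have "?c * r ^ (?N - 1) * r powr (- \<beta>) = ?c * r powr (real ?N - 1 - \<beta>)"
        by (simp add: powr_add[symmetric] mult.assoc)
      then show ?thesis using True c by (simp add: ennreal_mult'[symmetric])
    qed (auto simp: indicator_def)
  qed
  also have "\<dots> = ennreal (?c * (- (1 powr (real ?N - 1 - \<beta> + 1)) / (real ?N - 1 - \<beta> + 1)))"
    using assms c
    by (intro nn_integral_has_integral_lebesgue' has_integral_mult_right has_integral_powr_to_inf) auto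
  also have "?c * (- (1 powr (real ?N - 1 - \<beta> + 1)) / (real ?N - 1 - \<beta> + 1)) = ?c / (\<beta> - real ?N)"
    using minus_divide_divide[of ?c "\<beta> - real ?N"] by simp
  finally show ?thesis .
qed

lemma unit_ball_measurable[measurable]: "ball (0::'a::euclidean_space) 1 \<in> sets borel"
  by simp

text \<open>At 0 the kernel has the junk value 1 / 0 = 0.\<close>

definition frac_kernel :: "real \<Rightarrow> 'a::euclidean_space \<Rightarrow> real" where
  "frac_kernel s z = 1 / norm z powr (real DIM('a) + 2 * s)"

text \<open>The integral of |z|^2 \<open>frac_kernel s z\<close> over the unit ball for s < 1. It
  tends to infinity as s \<rightarrow> 1 and is the scale on which all other terms are
  measured.\<close>

definition frac_mass :: "'a::euclidean_space itself \<Rightarrow> real \<Rightarrow> real" where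
  "frac_mass _ s = real DIM('a) * unit_ball_vol DIM('a) / (2 - 2 * s)"

lemma frac_kernel_nonneg[simp]: "0 \<le> frac_kernel s z" by (simp add: frac_kernel_def)

lemma frac_kernel_measurable[measurable]: "frac_kernel s \<in> borel_measurable borel"
  unfolding frac_kernel_def by measurable

lemma has_bochner_integral_nonneg:
  fixes f :: "'b \<Rightarrow> real"
  assumes "f \<in> borel_measurable M" "\<And>x. 0 \<le> f x" "(\<integral>\<^sup>+x. ennreal (f x) \<partial>M) = ennreal I" "0 \<le> I"
  shows "has_bochner_integral M f I"
  using assms by (intro has_bochner_integral_nn_integral) auto

lemma frac_kernel_ball:
  assumes "s < 1"
  shows "has_bochner_integral lborel (\<lambda>z::'a::euclidean_space. indicator (ball 0 1) z * ((norm z)\<^sup>2 * frac_kernel s z)) (frac_mass TYPE('a) s)"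
proof (rule has_bochner_integral_nonneg)
  have e: "(norm z)\<^sup>2 * frac_kernel s z = norm z powr (- (real DIM('a) + 2 * s - 2))" for z :: 'a
  proof (cases "z = 0")
    case False
    then have "(norm z)\<^sup>2 = norm z powr 2" by simp
    then have "(norm z)\<^sup>2 * frac_kernel s z = norm z powr (2 - (real DIM('a) + 2 * s))"
      by (simp only: frac_kernel_def powr_diff times_divide_eq_right mult_1_right)
    also have "2 - (real DIM('a) + 2 * s) = - (real DIM('a) + 2 * s - 2)" by simp
    finally show ?thesis .
  qed simp
  show "(\<integral>\<^sup>+z. ennreal (indicator (ball 0 1) z * ((norm z)\<^sup>2 * frac_kernel s (z::'a))) \<partial>lborel) = ennreal (frac_mass TYPE('a) s)"
    unfolding e using nn_integral_norm_powr_ball[of "real DIM('a) + 2 * s - 2", where 'a='a] assms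
    by (simp add: frac_mass_def)
  show "0 \<le> frac_mass TYPE('a) s" using assms by (simp add: frac_mass_def unit_ball_vol_nonneg)
  show "(\<lambda>z::'a. indicator (ball 0 1) z * ((norm z)\<^sup>2 * frac_kernel s z)) \<in> borel_measurable lborel" by measurable
qed simp

text \<open>Unlike the second moment, the fourth moment stays bounded as s \<rightarrow> 1, so
  fourth order errors are lost after division by \<open>frac_mass\<close>.\<close>

lemma frac_kernel_ball4:
  assumes "s < 2"
  shows "has_bochner_integral lborel (\<lambda>z::'a::euclidean_space. indicator (ball 0 1) z * ((norm z)^4 * frac_kernel s z))
     (real DIM('a) * unit_ball_vol DIM('a) / (4 - 2 * s))"
proof (rule has_bochner_integral_nonneg)
  have e: "(norm z)^4 * frac_kernel s z = norm z powr (- (real DIM('a) + 2 * s - 4))" for z :: 'a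
  proof (cases "z = 0")
    case False
    then have "(norm z)^4 = norm z powr 4" by simp
    then have "(norm z)^4 * frac_kernel s z = norm z powr (4 - (real DIM('a) + 2 * s))"
      by (simp only: frac_kernel_def powr_diff times_divide_eq_right mult_1_right)
    also have "4 - (real DIM('a) + 2 * s) = - (real DIM('a) + 2 * s - 4)" by simp
    finally show ?thesis .
  qed simp
  show "(\<integral>\<^sup>+z. ennreal (indicator (ball 0 1) z * ((norm z)^4 * frac_kernel s (z::'a))) \<partial>lborel) =
      ennreal (real DIM('a) * unit_ball_vol DIM('a) / (4 - 2 * s))"
    unfolding e using nn_integral_norm_powr_ball[of "real DIM('a) + 2 * s - 4", where 'a='a] assms
    by simp
  show "0 \<le> real DIM('a) * unit_ball_vol DIM('a) / (4 - 2 * s)" using assms by (simp add: unit_ball_vol_nonneg)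
  show "(\<lambda>z::'a. indicator (ball 0 1) z * ((norm z)^4 * frac_kernel s z)) \<in> borel_measurable lborel" by measurable
qed simp

lemma frac_kernel_outside:
  assumes "s > 0"
  shows "has_bochner_integral lborel (\<lambda>z::'a::euclidean_space. indicator (- ball 0 1) z * frac_kernel s z)
     (real DIM('a) * unit_ball_vol DIM('a) / (2 * s))"
proof (rule has_bochner_integral_nonneg)
  have e: "frac_kernel s z = norm z powr (- (real DIM('a) + 2 * s))" for z :: 'a
    unfolding frac_kernel_def powr_minus_divide ..
  show "(\<integral>\<^sup>+z. ennreal (indicator (- ball 0 1) z * frac_kernel s (z::'a)) \<partial>lborel) =
      ennreal (real DIM('a) * unit_ball_vol DIM('a) / (2 * s))"
    unfolding e using nn_integral_norm_powr_outside[of "real DIM('a) + 2 * s", where 'a='a] assms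
    by simp
  show "0 \<le> real DIM('a) * unit_ball_vol DIM('a) / (2 * s)" using assms by (simp add: unit_ball_vol_nonneg)
  show "(\<lambda>z::'a. indicator (- ball 0 1) z * frac_kernel s z) \<in> borel_measurable lborel" by measurable
qed simp

lemma frac_mass_at_top: "filterlim (frac_mass TYPE('a::euclidean_space)) at_top (at 1 within {0<..<1})"
proof -
  have "filterlim (\<lambda>s::real. 2 - 2 * s) (at_right 0) (at 1 within {0<..<1})"
    unfolding filterlim_at
    by (auto simp: eventually_at_filter intro!: tendsto_eq_intros)
  then have "filterlim (\<lambda>s::real. inverse (2 - 2 * s)) at_top (at 1 within {0<..<1})"
    by (rule filterlim_compose[OF filterlim_inverse_at_top_right])
  then have "filterlim (\<lambda>s::real. (real DIM('a) * unit_ball_vol DIM('a)) * inverse (2 - 2 * s)) at_top (at 1 within {0<..<1})"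
    by (intro filterlim_tendsto_pos_mult_at_top[OF tendsto_const]) (auto simp: unit_ball_vol_pos)
  then show ?thesis by (simp add: frac_mass_def[abs_def] divide_inverse)
qed

section \<open>Symmetries and second moments of the kernel\<close>

lemma integral_reflect_coordinate:
  fixes f :: "'a::euclidean_space \<Rightarrow> real"
  assumes [measurable]: "f \<in> borel_measurable borel" and b: "b \<in> Basis"
  shows "(\<integral>z. f (z - (2 * (z \<bullet> b)) *\<^sub>R b) \<partial>lborel) = (\<integral>z. f z \<partial>lborel)"
proof -
  let ?c = "\<lambda>j. if j = b then -1 else 1 :: real"
  let ?T = "\<lambda>x. 0 + (\<Sum>j\<in>Basis. (?c j * (x \<bullet> j)) *\<^sub>R j)"
  have T: "?T x = x - (2 * (x \<bullet> b)) *\<^sub>R b" for x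
  proof (rule euclidean_eqI)
    fix j :: 'a assume "j \<in> Basis"
    then show "?T x \<bullet> j = (x - (2 * (x \<bullet> b)) *\<^sub>R b) \<bullet> j"
      using b by (simp add: inner_diff_left inner_Basis)
  qed
  have "lborel = density (distr lborel borel ?T) (\<lambda>_. ennreal (\<Prod>j\<in>Basis. \<bar>?c j\<bar>))"
    by (rule lborel_affine_euclidean) auto
  also have "(\<Prod>j\<in>(Basis::'a set). \<bar>?c j\<bar>) = 1" by (intro prod.neutral) auto
  finally have "(lborel :: 'a measure) = distr lborel borel ?T" by (simp add: density_1)
  then have "(lborel :: 'a measure) = distr lborel borel (\<lambda>x. x - (2 * (x \<bullet> b)) *\<^sub>R b)" unfolding T .
  then have "(\<integral>z. f z \<partial>lborel) = (\<integral>z. f z \<partial>distr lborel borel (\<lambda>x. x - (2 * (x \<bullet> b)) *\<^sub>R b))" by simp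
  also have "\<dots> = (\<integral>z. f (z - (2 * (z \<bullet> b)) *\<^sub>R b) \<partial>lborel)" by (intro integral_distr) auto
  finally show ?thesis ..
qed

lemma integral_swap_coordinates:
  fixes f :: "'a::euclidean_space \<Rightarrow> real"
  assumes [measurable]: "f \<in> borel_measurable borel" and b: "b \<in> Basis" "b' \<in> Basis"
  shows "(\<integral>z. f (\<Sum>j\<in>Basis. (z \<bullet> Transposition.transpose b b' j) *\<^sub>R j) \<partial>lborel) = (\<integral>z. f z \<partial>lborel)"
proof -
  let ?\<pi> = "Transposition.transpose b b'"
  let ?T = "\<lambda>z. (\<Sum>j\<in>Basis. (z \<bullet> ?\<pi> j) *\<^sub>R j)"
  have \<pi>: "?\<pi> j \<in> Basis \<longleftrightarrow> j \<in> Basis" for j using b by (auto simp: Transposition.transpose_def)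
  have T: "?T z \<bullet> j = z \<bullet> ?\<pi> j" if "j \<in> Basis" for z j
    using that by simp
  have bij: "bij_betw ?\<pi> Basis Basis"
    by (rule bij_betw_byWitness[where f'="?\<pi>"]) (auto simp: \<pi>)
  have "lborel = distr lborel borel ?T"
  proof (rule lborel_eqI)
    fix l u :: 'a assume lu: "\<And>b. b \<in> Basis \<Longrightarrow> l \<bullet> b \<le> u \<bullet> b"
    have "?T -` box l u = box (?T l) (?T u)"
    proof (intro set_eqI)
      fix z
      have "z \<in> ?T -` box l u \<longleftrightarrow> (\<forall>j\<in>Basis. l \<bullet> j < z \<bullet> ?\<pi> j \<and> z \<bullet> ?\<pi> j < u \<bullet> j)"
        by (simp add: mem_box T)
      also have "\<dots> \<longleftrightarrow> (\<forall>j\<in>Basis. l \<bullet> ?\<pi> j < z \<bullet> j \<and> z \<bullet> j < u \<bullet> ?\<pi> j)"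
        using \<pi> by (metis transpose_involutory)
      finally show "z \<in> ?T -` box l u \<longleftrightarrow> z \<in> box (?T l) (?T u)" by (simp add: mem_box T)
    qed
    then have "emeasure (distr lborel borel ?T) (box l u) = emeasure lborel (box (?T l) (?T u))"
      by (simp add: emeasure_distr)
    also have "\<dots> = ennreal (\<Prod>j\<in>Basis. (?T u - ?T l) \<bullet> j)"
      using lu \<pi> by (subst emeasure_lborel_box) (auto simp: T)
    also have "(\<Prod>j\<in>Basis. (?T u - ?T l) \<bullet> j) = (\<Prod>j\<in>Basis. (u - l) \<bullet> ?\<pi> j)"
      by (intro prod.cong) (auto simp: inner_diff_left T)
    also have "\<dots> = (\<Prod>j\<in>Basis. (u - l) \<bullet> j)"
      by (rule prod.reindex_bij_betw[OF bij])
    finally show "emeasure (distr lborel borel ?T) (box l u) = (\<Prod>j\<in>Basis. (u - l) \<bullet> j)" .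
  qed simp
  then have "(\<integral>z. f z \<partial>lborel) = (\<integral>z. f z \<partial>distr lborel borel ?T)" by simp
  also have "\<dots> = (\<integral>z. f (?T z) \<partial>lborel)" by (intro integral_distr) auto
  finally show ?thesis ..
qed

text \<open>Near 0 the factor |z|^2 makes the singularity integrable because s < 1; at infinity
  boundedness suffices because s > 0.\<close>

lemma integrable_times_frac_kernel:
  fixes h :: "'a::euclidean_space \<Rightarrow> real"
  assumes s: "0 < s" "s < 1" and [measurable]: "h \<in> borel_measurable borel"
    and b1: "\<And>z. \<bar>h z\<bar> \<le> C" and b2: "\<And>z. \<bar>h z\<bar> \<le> C * (norm z)\<^sup>2"
  shows "integrable lborel (\<lambda>z. h z * frac_kernel s z)"
proof (rule Bochner_Integration.integrable_bound)
  show "integrable lborel (\<lambda>z::'a. C * (indicator (ball 0 1) z * ((norm z)\<^sup>2 * frac_kernel s z)) +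
      C * (indicator (- ball 0 1) z * frac_kernel s z))"
    using frac_kernel_ball[OF s(2), where 'a='a] frac_kernel_outside[OF s(1), where 'a='a]
    by (intro Bochner_Integration.integrable_add integrable_mult_right) (auto dest: integrable.intros)
  show "AE z in lborel. norm (h z * frac_kernel s z) \<le> norm (C * (indicator (ball 0 1) z * ((norm z)\<^sup>2 * frac_kernel s z)) +
      C * (indicator (- ball 0 1) z * frac_kernel s z))"
  proof (rule AE_I2)
    fix z :: 'a
    have "\<bar>h z\<bar> * frac_kernel s z \<le> C * (norm z)\<^sup>2 * frac_kernel s z" "\<bar>h z\<bar> * frac_kernel s z \<le> C * frac_kernel s z"
      using b1 b2 by (auto intro: mult_right_mono)
    then have "\<bar>h z\<bar> * frac_kernel s z \<le> \<bar>C * ((norm z)\<^sup>2 * frac_kernel s z)\<bar>" "\<bar>h z\<bar> * frac_kernel s z \<le> \<bar>C * frac_kernel s z\<bar>"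
      by (auto simp: mult.assoc intro: order_trans[OF _ abs_ge_self])
    then show "norm (h z * frac_kernel s z) \<le> norm (C * (indicator (ball 0 1) z * ((norm z)\<^sup>2 * frac_kernel s z)) +
      C * (indicator (- ball 0 1) z * frac_kernel s z))"
      by (cases "z \<in> ball 0 1") (auto simp: abs_mult)
  qed
qed measurable

text \<open>Reflecting one coordinate preserves the kernel and changes the sign of the mixed
  products. Exchanging coordinates makes the n diagonal moments equal, and together they add up to
  \<open>frac_mass\<close>.\<close>

lemma frac_kernel_quadratic:
  fixes b b' :: "'a::euclidean_space"
  assumes s: "0 < s" "s < 1" and b: "b \<in> Basis" "b' \<in> Basis"
  shows "has_bochner_integral lborel (\<lambda>z::'a. indicator (ball 0 1) z * ((z \<bullet> b) * (z \<bullet> b')) * frac_kernel s z)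
     (if b = b' then frac_mass TYPE('a) s / real DIM('a) else 0)"
proof -
  let ?f = "\<lambda>b b' z::'a. indicator (ball 0 1) z * ((z \<bullet> b) * (z \<bullet> b')) * frac_kernel s z"
  have le: "\<bar>(z \<bullet> b) * (z \<bullet> b')\<bar> \<le> (norm z)\<^sup>2" if "b \<in> Basis" "b' \<in> Basis" for z b b' :: 'a
    using Basis_le_norm[OF that(1), of z] Basis_le_norm[OF that(2), of z]
    unfolding abs_mult power2_eq_square by (intro mult_mono) auto
  have int: "integrable lborel (?f b b')" if "b \<in> Basis" "b' \<in> Basis" for b b'
  proof (rule integrable_times_frac_kernel[OF s, where C=1])
    fix z :: 'a
    show "\<bar>indicator (ball 0 1) z * ((z \<bullet> b) * (z \<bullet> b'))\<bar> \<le> 1 * (norm z)\<^sup>2"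
      using le[OF that, of z] by (auto simp: indicator_def)
    show "\<bar>indicator (ball 0 1) z * ((z \<bullet> b) * (z \<bullet> b'))\<bar> \<le> 1"
      using le[OF that, of z] power_mono[of "norm z" 1 2] by (auto simp: indicator_def)
  qed measurable
  have m[measurable]: "?f b b' \<in> borel_measurable borel" for b b' by measurable
  show ?thesis
  proof (cases "b = b'")
    case False
    let ?R = "\<lambda>z. z - (2 * (z \<bullet> b)) *\<^sub>R b"
    have nR: "norm (?R z) = norm z" for z
    proof -
      have "(norm (?R z))\<^sup>2 = (norm z)\<^sup>2"
        using b inner_Basis[OF b(1) b(1)] unfolding power2_norm_eq_inner
        by (simp add: inner_diff_left inner_diff_right inner_commute[of b z] algebra_simps)
      then show ?thesis by (simp add: power2_eq_iff_nonneg)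
    qed
    have Rb: "?R z \<bullet> b = - (z \<bullet> b)" "?R z \<bullet> b' = z \<bullet> b'" for z
      using b \<open>b \<noteq> b'\<close> inner_Basis[OF b(1) b(1)] inner_Basis[OF b] by (simp_all add: inner_diff_left)
    have "?f b b' (?R z) = - ?f b b' z" for z
      using nR[of z] unfolding Rb by (simp add: frac_kernel_def indicator_def)
    then have "(\<integral>z. ?f b b' z \<partial>lborel) = (\<integral>z. - ?f b b' z \<partial>lborel)"
      using integral_reflect_coordinate[OF m b(1), of b b'] by (simp only:)
    then have "(\<integral>z. ?f b b' z \<partial>lborel) = 0" by simp
    with int[OF b] False show ?thesis by (auto simp: has_bochner_integral_iff)
  next
    case True
    have same: "(\<integral>z. ?f j j z \<partial>lborel) = (\<integral>z. ?f b b z \<partial>lborel)" if j: "j \<in> Basis" for j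
    proof -
      let ?T = "\<lambda>z::'a. \<Sum>i\<in>Basis. (z \<bullet> Transposition.transpose b j i) *\<^sub>R i"
      have \<pi>: "Transposition.transpose b j i \<in> Basis \<longleftrightarrow> i \<in> Basis" for i using b j by (auto simp: Transposition.transpose_def)
      have bij: "bij_betw (Transposition.transpose b j) Basis Basis"
        by (rule bij_betw_byWitness[where f'="Transposition.transpose b j"]) (auto simp: \<pi>)
      have T: "?T z \<bullet> i = z \<bullet> Transposition.transpose b j i" if "i \<in> Basis" for z i
        using that by simp
      have nT: "norm (?T z) = norm z" for z
      proof -
        have "(norm (?T z))\<^sup>2 = (\<Sum>i\<in>Basis. (z \<bullet> Transposition.transpose b j i) * (z \<bullet> Transposition.transpose b j i))"
          unfolding power2_norm_eq_inner by (subst euclidean_inner) (simp add: T)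
        also have "\<dots> = (\<Sum>i\<in>Basis. (z \<bullet> i) * (z \<bullet> i))"
          by (rule sum.reindex_bij_betw[OF bij])
        also have "\<dots> = (norm z)\<^sup>2"
          unfolding power2_norm_eq_inner by (subst euclidean_inner[of z z]) simp
        finally show ?thesis by (simp add: power2_eq_iff_nonneg)
      qed
      have "?f b b (?T z) = ?f j j z" for z
        using nT[of z] T[OF b(1), of z] by (simp add: frac_kernel_def indicator_def)
      then show ?thesis using integral_swap_coordinates[OF m b(1) j, of b b] by simp
    qed
    have "(\<Sum>j\<in>Basis. ?f j j z) = indicator (ball 0 1) z * ((norm z)\<^sup>2 * frac_kernel s z)" for z
    proof -
      have "(\<Sum>j\<in>Basis. ?f j j z) = indicator (ball 0 1) z * ((\<Sum>j\<in>Basis. (z \<bullet> j) * (z \<bullet> j)) * frac_kernel s z)"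
        by (simp add: sum_distrib_left sum_distrib_right mult.assoc)
      then show ?thesis by (simp add: euclidean_inner[symmetric] power2_norm_eq_inner)
    qed
    then have "frac_mass TYPE('a) s = (\<integral>z. (\<Sum>j\<in>Basis. ?f j j z) \<partial>lborel)"
      using frac_kernel_ball[OF s(2), where 'a='a] by (simp add: has_bochner_integral_integral_eq)
    also have "\<dots> = (\<Sum>j\<in>Basis. \<integral>z. ?f j j z \<partial>lborel)"
      by (intro Bochner_Integration.integral_sum int)
    also have "\<dots> = (\<Sum>j\<in>(Basis::'a set). \<integral>z. ?f b b z \<partial>lborel)"
      by (intro sum.cong refl same)
    also have "\<dots> = real DIM('a) * (\<integral>z. ?f b b z \<partial>lborel)" by simp
    finally have "(\<integral>z. ?f b b z \<partial>lborel) = frac_mass TYPE('a) s / real DIM('a)" by (simp add: field_simps)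
    with int[OF b] True show ?thesis by (auto simp: has_bochner_integral_iff)
  qed
qed

section \<open>Asymptotics as s tends to 1\<close>

text \<open>With y = t / 2 the difference equals 2 (sin y - y) (sin y + y); the first factor is of
  third order, the second of first order.\<close>

lemma one_minus_cos_approx: "\<bar>1 - cos t - t\<^sup>2 / 2\<bar> \<le> (t::real) ^ 4"
proof -
  define y where "y = t / 2"
  have "(\<Sum>m<3. sin_coeff m * y ^ m) = y" by (simp add: numeral_3_eq_3 sin_coeff_def)
  then have "\<bar>sin y - y\<bar> \<le> inverse (fact 3) * \<bar>y\<bar> ^ 3" using Maclaurin_sin_bound[of y 3] by simp
  also have "\<dots> \<le> \<bar>y\<bar> ^ 3" by (simp add: fact_numeral)
  finally have 1: "\<bar>sin y - y\<bar> \<le> \<bar>y\<bar> ^ 3" .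
  have 2: "\<bar>sin y + y\<bar> \<le> 2 * \<bar>y\<bar>" using abs_sin_x_le_abs_x[of y] by linarith
  have "1 - cos t = 2 * (sin y)\<^sup>2" using cos_double_sin[of y] by (simp add: y_def)
  then have "1 - cos t - t\<^sup>2 / 2 = 2 * ((sin y - y) * (sin y + y))"
    by (simp add: y_def power2_eq_square algebra_simps)
  then have "\<bar>1 - cos t - t\<^sup>2 / 2\<bar> = 2 * (\<bar>sin y - y\<bar> * \<bar>sin y + y\<bar>)" by (simp add: abs_mult)
  also have "\<dots> \<le> 2 * (\<bar>y\<bar> ^ 3 * (2 * \<bar>y\<bar>))" using 1 2 by (intro mult_left_mono mult_mono) auto
  also have "\<dots> = 4 * \<bar>y\<bar> ^ 4" by (simp add: power_numeral_reduce)
  also have "\<dots> = t ^ 4 / 4" by (simp add: y_def power_divide)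
  also have "\<dots> \<le> t ^ 4" by simp
  finally show ?thesis .
qed

lemma tendsto_bounded_over_frac_mass:
  fixes g :: "real \<Rightarrow> real"
  assumes "\<And>s. 1/2 \<le> s \<Longrightarrow> s < 1 \<Longrightarrow> \<bar>g s\<bar> \<le> B"
  shows "((\<lambda>s. g s / frac_mass TYPE('a::euclidean_space) s) \<longlongrightarrow> 0) (at 1 within {0<..<1})"
proof (rule Lim_null_comparison)
  have ev1: "\<forall>\<^sub>F s in at 1 within {0<..<1}. 1/2 \<le> s \<and> s < (1::real)"
    unfolding eventually_at by (intro exI[of _ "1/2"]) (auto simp: dist_real_def)
  have ev2: "\<forall>\<^sub>F s in at 1 within {0<..<1}. 0 < frac_mass TYPE('a) s"
    using frac_mass_at_top[where 'a='a] by (simp add: filterlim_at_top_dense)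
  show "\<forall>\<^sub>F s in at 1 within {0<..<1}. norm (g s / frac_mass TYPE('a) s) \<le> B / frac_mass TYPE('a) s"
    using ev1 ev2 by eventually_elim (auto simp: abs_divide intro!: divide_right_mono assms)
  show "((\<lambda>s. B / frac_mass TYPE('a) s) \<longlongrightarrow> 0) (at 1 within {0<..<1})"
    by (rule real_tendsto_divide_at_top[OF tendsto_const frac_mass_at_top])
qed

text \<open>The restriction s \<ge> 1/2 keeps the factor 1 / (2 s) of the tail at most 1.\<close>

lemma frac_kernel_tail_bounds:
  assumes "1/2 \<le> s" "s < 1"
  shows "(\<integral>z. indicator (ball 0 1) z * ((norm z)^4 * frac_kernel s (z::'a::euclidean_space)) \<partial>lborel) \<le> real DIM('a) * unit_ball_vol DIM('a)"
    and "(\<integral>z. indicator (- ball 0 1) z * frac_kernel s (z::'a::euclidean_space) \<partial>lborel) \<le> real DIM('a) * unit_ball_vol DIM('a)"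
proof -
  have c: "0 \<le> real DIM('a) * unit_ball_vol DIM('a)" by simp
  have "real DIM('a) * unit_ball_vol DIM('a) / (4 - 2 * s) \<le> real DIM('a) * unit_ball_vol DIM('a) / 1"
    using assms c by (intro divide_left_mono) auto
  then show "(\<integral>z. indicator (ball 0 1) z * ((norm z)^4 * frac_kernel s (z::'a)) \<partial>lborel) \<le> real DIM('a) * unit_ball_vol DIM('a)"
    using frac_kernel_ball4[of s, where 'a='a] assms by (simp add: has_bochner_integral_integral_eq)
  have "real DIM('a) * unit_ball_vol DIM('a) / (2 * s) \<le> real DIM('a) * unit_ball_vol DIM('a) / 1"
    using assms c by (intro divide_left_mono) auto
  then show "(\<integral>z. indicator (- ball 0 1) z * frac_kernel s (z::'a) \<partial>lborel) \<le> real DIM('a) * unit_ball_vol DIM('a)"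
    using frac_kernel_outside[of s, where 'a='a] assms by (simp add: has_bochner_integral_integral_eq)
qed

text \<open>Only the term \<epsilon> |z|^2 feels the growing mass. The fourth moment and the tail
  are bounded uniformly in s, and each of them contributes one of the two multiples of B.\<close>

lemma abs_integral_frac_kernel_le:
  fixes g :: "'a::euclidean_space \<Rightarrow> real"
  assumes s: "1/2 \<le> s" "s < 1"
    and g: "\<And>z. \<bar>g z\<bar> \<le> indicator (ball 0 1) z * (\<epsilon> * (norm z)\<^sup>2 + B * (norm z)^4) + indicator (- ball 0 1) z * B"
    and B: "0 \<le> B"
    and int: "integrable lborel (\<lambda>z. g z * frac_kernel s z)"
  shows "\<bar>\<integral>z. g z * frac_kernel s z \<partial>lborel\<bar> \<le> \<epsilon> * frac_mass TYPE('a) s + 2 * B * (real DIM('a) * unit_ball_vol DIM('a))"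
proof -
  have s': "s < 2" "0 < s" using s by auto
  note h1 = frac_kernel_ball[OF s(2), where 'a='a] and h2 = frac_kernel_ball4[OF s'(1), where 'a='a]
    and h3 = frac_kernel_outside[OF s'(2), where 'a='a]
  let ?w = "\<lambda>z::'a. \<epsilon> * (indicator (ball 0 1) z * ((norm z)\<^sup>2 * frac_kernel s z)) +
     (B * (indicator (ball 0 1) z * ((norm z)^4 * frac_kernel s z)) + B * (indicator (- ball 0 1) z * frac_kernel s z))"
  have i: "integrable lborel (\<lambda>z::'a. indicator (ball 0 1) z * ((norm z)\<^sup>2 * frac_kernel s z))"
    "integrable lborel (\<lambda>z::'a. indicator (ball 0 1) z * ((norm z)^4 * frac_kernel s z))"
    "integrable lborel (\<lambda>z::'a. indicator (- ball 0 1) z * frac_kernel s z)"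
    using h1 h2 h3 by (auto intro: integrable.intros)
  have "\<bar>\<integral>z. g z * frac_kernel s z \<partial>lborel\<bar> \<le> (\<integral>z. ?w z \<partial>lborel)"
  proof (rule order_trans[OF integral_abs_bound integral_mono])
    show "integrable lborel (\<lambda>z. \<bar>g z * frac_kernel s z\<bar>)" using int by (rule integrable_abs)
    show "integrable lborel ?w" using i by (intro Bochner_Integration.integrable_add integrable_mult_right)
    fix z
    have "\<bar>g z * frac_kernel s z\<bar> = \<bar>g z\<bar> * frac_kernel s z" by (simp add: abs_mult)
    also have "\<dots> \<le> (indicator (ball 0 1) z * (\<epsilon> * (norm z)\<^sup>2 + B * (norm z)^4) + indicator (- ball 0 1) z * B) * frac_kernel s z"
      by (intro mult_right_mono g) simp
    also have "\<dots> = ?w z" by (simp add: algebra_simps)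
    finally show "\<bar>g z * frac_kernel s z\<bar> \<le> ?w z" .
  qed
  also have "\<dots> = \<epsilon> * frac_mass TYPE('a) s + (B * (\<integral>z. indicator (ball 0 1) z * ((norm z)^4 * frac_kernel s (z::'a)) \<partial>lborel) +
      B * (\<integral>z. indicator (- ball 0 1) z * frac_kernel s (z::'a) \<partial>lborel))"
    using i h1 by (simp add: has_bochner_integral_integral_eq)
  also have "\<dots> \<le> \<epsilon> * frac_mass TYPE('a) s + (B * (real DIM('a) * unit_ball_vol DIM('a)) + B * (real DIM('a) * unit_ball_vol DIM('a)))"
    using frac_kernel_tail_bounds[OF s, where 'a='a] B by (intro add_left_mono add_mono mult_left_mono) auto
  finally show ?thesis by simp
qed

text \<open>The value is half of the share 1 / n that a single coordinate has in the second moment;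
  the fourth order error of the cosine and the tail add only bounded terms.\<close>

lemma frac_kernel_cos_limit:
  assumes b: "b \<in> (Basis :: 'a::euclidean_space set)"
  shows "((\<lambda>s. (\<integral>z. (1 - cos (z \<bullet> b)) * frac_kernel s z \<partial>lborel) / frac_mass TYPE('a) s) \<longlongrightarrow> 1 / (2 * real DIM('a)))
    (at 1 within {0<..<1})"
proof -
  let ?I = "\<lambda>s. \<integral>z. (1 - cos (z \<bullet> b)) * frac_kernel s z \<partial>lborel"
  let ?m = "frac_mass TYPE('a)"
  have Ib: "\<bar>?I s - ?m s / (2 * real DIM('a))\<bar> \<le> 2 * 2 * (real DIM('a) * unit_ball_vol DIM('a))" if s: "1/2 \<le> s" "s < 1" for s
  proof -
    have s0: "0 < s" using s by simp
    have q: "has_bochner_integral lborel (\<lambda>z. (1/2) * (indicator (ball 0 1) z * ((z \<bullet> b) * (z \<bullet> b)) * frac_kernel s z)) ((1/2) * (?m s / real DIM('a)))"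
      using frac_kernel_quadratic[OF s0 s(2) b b] by (intro has_bochner_integral_mult_right) auto
    have zb: "\<bar>z \<bullet> b\<bar> \<le> norm z" for z :: 'a using b by (rule Basis_le_norm)
    have c2: "\<bar>1 - cos t\<bar> \<le> 2" for t :: real using cos_ge_minus_one[of t] cos_le_one[of t] by linarith
    have c3: "\<bar>1 - cos t\<bar> \<le> t\<^sup>2 / 2" for t :: real
    proof -
      have "1 - cos t = 2 * (sin (t / 2))\<^sup>2" using cos_double_sin[of "t / 2"] by simp
      moreover have "(sin (t / 2))\<^sup>2 \<le> (t / 2)\<^sup>2" using abs_sin_x_le_abs_x[of "t/2"] by (simp only: abs_le_square_iff)
      ultimately show ?thesis by (simp add: power_divide)
    qed
    have int1: "integrable lborel (\<lambda>z::'a. (1 - cos (z \<bullet> b)) * frac_kernel s z)"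
    proof (rule integrable_times_frac_kernel[OF s0 s(2), where C=2])
      show "\<bar>1 - cos (z \<bullet> b)\<bar> \<le> 2 * (norm z)\<^sup>2" for z :: 'a
      proof -
        have "(z \<bullet> b)\<^sup>2 \<le> (norm z)\<^sup>2" using power_mono[OF zb[of z], of 2] by simp
        then show ?thesis using c3[of "z \<bullet> b"] zero_le_power2[of "norm z"] by linarith
      qed
      show "\<bar>1 - cos (z \<bullet> b)\<bar> \<le> 2" for z by (rule c2)
    qed measurable
    let ?g = "\<lambda>z::'a. 1 - cos (z \<bullet> b) - (1/2) * (indicator (ball 0 1) z * ((z \<bullet> b) * (z \<bullet> b)))"
    have e: "?g z * frac_kernel s z = (1 - cos (z \<bullet> b)) * frac_kernel s z - (1/2) * (indicator (ball 0 1) z * ((z \<bullet> b) * (z \<bullet> b)) * frac_kernel s z)" for z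
      by (simp add: algebra_simps)
    have int2: "integrable lborel (\<lambda>z. ?g z * frac_kernel s z)"
      unfolding e using int1 q by (intro Bochner_Integration.integrable_diff) (auto intro: integrable.intros)
    have "(\<integral>z. ?g z * frac_kernel s z \<partial>lborel) = ?I s - (1/2) * (?m s / real DIM('a))"
      unfolding e using int1 q by (subst Bochner_Integration.integral_diff) (auto intro: integrable.intros simp: has_bochner_integral_iff)
    moreover have "\<bar>\<integral>z. ?g z * frac_kernel s z \<partial>lborel\<bar> \<le> 0 * ?m s + 2 * 2 * (real DIM('a) * unit_ball_vol DIM('a))"
    proof (rule abs_integral_frac_kernel_le[OF s _ _ int2])
      fix z :: 'a
      have "(z \<bullet> b) ^ 4 \<le> norm z ^ 4" using power_mono[OF zb[of z], of 4] by simp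
      then have "\<bar>1 - cos (z \<bullet> b) - (1/2) * ((z \<bullet> b) * (z \<bullet> b))\<bar> \<le> 2 * norm z ^ 4"
        using one_minus_cos_approx[of "z \<bullet> b"] zero_le_power[of "norm z" 4] by (simp add: power2_eq_square)
      then show "\<bar>?g z\<bar> \<le> indicator (ball 0 1) z * (0 * (norm z)\<^sup>2 + 2 * norm z ^ 4) + indicator (- ball 0 1) z * 2"
        using c2[of "z \<bullet> b"] by (cases "z \<in> ball 0 1") auto
    qed simp
    ultimately show ?thesis by simp
  qed
  have ev: "\<forall>\<^sub>F s in at 1 within {0<..<1}. 0 < ?m s"
    using frac_mass_at_top[where 'a='a] by (simp add: filterlim_at_top_dense)
  have "((\<lambda>s. (?I s - ?m s / (2 * real DIM('a))) / ?m s + 1 / (2 * real DIM('a))) \<longlongrightarrow> 0 + 1 / (2 * real DIM('a))) (at 1 within {0<..<1})"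
    by (intro tendsto_add tendsto_const tendsto_bounded_over_frac_mass[OF Ib])
  then have "((\<lambda>s. (?I s - ?m s / (2 * real DIM('a))) / ?m s + 1 / (2 * real DIM('a))) \<longlongrightarrow> 1 / (2 * real DIM('a))) (at 1 within {0<..<1})"
    by simp
  then show ?thesis
  proof (rule Lim_transform_eventually)
    show "\<forall>\<^sub>F s in at 1 within {0<..<1}. (?I s - ?m s / (2 * real DIM('a))) / ?m s + 1 / (2 * real DIM('a)) = ?I s / ?m s"
      using ev by eventually_elim (simp add: field_simps)
  qed
qed

text \<open>Only the even part of h matters; its second order part is integrated by the symmetries of the kernel.\<close>

lemma frac_kernel_limit:
  fixes h :: "'a::euclidean_space \<Rightarrow> real" and A :: "'a \<Rightarrow> 'a \<Rightarrow> real"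
  assumes b: "b \<in> (Basis :: 'a set)" and [measurable]: "h \<in> borel_measurable borel"
    and b1: "\<And>z. \<bar>h z\<bar> \<le> C" and b2: "\<And>z. \<bar>h z\<bar> \<le> C * (norm z)\<^sup>2"
    and lim: "((\<lambda>z. (h z + h (- z) - (\<Sum>i\<in>Basis. \<Sum>j\<in>Basis. A i j * ((z \<bullet> i) * (z \<bullet> j)))) / (norm z)\<^sup>2) \<longlongrightarrow> 0) (at 0)"
  shows "((\<lambda>s. inverse (\<integral>z. (1 - cos (z \<bullet> b)) * frac_kernel s z \<partial>lborel) * (\<integral>z. h z * frac_kernel s z \<partial>lborel))
     \<longlongrightarrow> (\<Sum>i\<in>Basis. A i i)) (at 1 within {0<..<1})"
proof -
  let ?m = "frac_mass TYPE('a)" and ?N = "real DIM('a)"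
  let ?H = "\<lambda>s. \<integral>z. h z * frac_kernel s z \<partial>lborel"
  let ?I = "\<lambda>s. \<integral>z. (1 - cos (z \<bullet> b)) * frac_kernel s z \<partial>lborel"
  let ?q = "\<lambda>z. \<Sum>i\<in>Basis. \<Sum>j\<in>Basis. A i j * ((z \<bullet> i) * (z \<bullet> j))"
  let ?tr = "\<Sum>i\<in>Basis. A i i"
  have C0: "0 \<le> C" using order_trans[OF abs_ge_zero b1] .
  define Q where "Q = (\<Sum>i\<in>(Basis::'a set). \<Sum>j\<in>(Basis::'a set). \<bar>A i j\<bar>)"
  have Q0: "0 \<le> Q" unfolding Q_def by (intro sum_nonneg) auto
  have qb: "\<bar>?q z\<bar> \<le> Q * (norm z)\<^sup>2" for z
  proof -
    have "\<bar>?q z\<bar> \<le> (\<Sum>i\<in>Basis. \<Sum>j\<in>Basis. \<bar>A i j * ((z \<bullet> i) * (z \<bullet> j))\<bar>)"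
      by (rule order_trans[OF sum_abs sum_mono[OF sum_abs]])
    also have "\<dots> \<le> (\<Sum>i\<in>Basis. \<Sum>j\<in>Basis. \<bar>A i j\<bar> * (norm z)\<^sup>2)"
    proof (intro sum_mono)
      fix i j :: 'a assume "i \<in> Basis" "j \<in> Basis"
      then have "\<bar>(z \<bullet> i) * (z \<bullet> j)\<bar> \<le> (norm z)\<^sup>2"
        using Basis_le_norm[of i z] Basis_le_norm[of j z]
        unfolding abs_mult power2_eq_square by (intro mult_mono) auto
      then show "\<bar>A i j * ((z \<bullet> i) * (z \<bullet> j))\<bar> \<le> \<bar>A i j\<bar> * (norm z)\<^sup>2"
        unfolding abs_mult[of "A i j"] by (rule mult_left_mono) simp
    qed
    also have "\<dots> = Q * (norm z)\<^sup>2" by (simp add: Q_def sum_distrib_right)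
    finally show ?thesis .
  qed
  have E: "((\<lambda>s. (2 * ?H s - ?tr / ?N * ?m s) / ?m s) \<longlongrightarrow> 0) (at 1 within {0<..<1})"
  proof (rule tendstoI)
    fix \<epsilon> :: real assume \<epsilon>: "\<epsilon> > 0"
    have "\<forall>\<^sub>F z in at 0. dist ((h z + h (- z) - ?q z) / (norm z)\<^sup>2) 0 < \<epsilon> / 2"
      using tendstoD[OF lim, of "\<epsilon> / 2"] \<epsilon> by simp
    then obtain r where r: "r > 0" "\<And>z. z \<noteq> 0 \<Longrightarrow> norm z < r \<Longrightarrow> \<bar>(h z + h (- z) - ?q z) / (norm z)\<^sup>2\<bar> < \<epsilon> / 2"
      unfolding eventually_at by (auto simp: dist_norm)
    \<comment> \<open>For r \<le> |z| < 1 only quadratic bounds are at hand. There |z|^2 \<le> |z|^4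
      / r^2 makes them fourth order, at the price of a constant that depends on \<epsilon> but not
      on s.\<close>
    define B where "B = (2 * C + Q) / r\<^sup>2 + 2 * C"
    have B: "0 \<le> B" "2 * C \<le> B" "(2 * C + Q) / r\<^sup>2 \<le> B" using C0 Q0 by (auto simp: B_def)
    let ?g = "\<lambda>z. h z + h (- z) - indicator (ball 0 1) z * ?q z"
    have gb: "\<bar>?g z\<bar> \<le> indicator (ball 0 1) z * ((\<epsilon> / 2) * (norm z)\<^sup>2 + B * (norm z)^4) + indicator (- ball 0 1) z * B" for z
    proof (cases "z \<in> ball 0 1")
      case True
      have "\<bar>h z + h (- z) - ?q z\<bar> \<le> (\<epsilon> / 2) * (norm z)\<^sup>2 + B * (norm z)^4"
      proof (cases "norm z < r")
        case True
        have "\<bar>h z + h (- z) - ?q z\<bar> \<le> (\<epsilon> / 2) * (norm z)\<^sup>2"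
        proof (cases "z = 0")
          case True
          then show ?thesis using b2[of 0] by simp
        next
          case False
          then have "\<bar>h z + h (- z) - ?q z\<bar> / (norm z)\<^sup>2 < \<epsilon> / 2" using r(2)[of z] True by (simp add: abs_divide)
          then show ?thesis using False by (simp add: divide_less_eq)
        qed
        then show ?thesis using B(1) by (simp add: add_increasing2)
      next
        case False
        have "\<bar>h z + h (- z) - ?q z\<bar> \<le> C * (norm z)\<^sup>2 + C * (norm z)\<^sup>2 + Q * (norm z)\<^sup>2"
          using b2[of z] b2[of "- z"] qb[of z] unfolding norm_minus_cancel by linarith
        also have "\<dots> = (2 * C + Q) / r\<^sup>2 * (r\<^sup>2 * (norm z)\<^sup>2)" using r(1) by (simp add: field_simps)
        also have "\<dots> \<le> B * ((norm z)\<^sup>2 * (norm z)\<^sup>2)"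
          using False B r(1) by (intro mult_mono B(3) mult_right_mono power_mono) auto
        also have "\<dots> = B * (norm z)^4" by (simp add: power_add[symmetric])
        finally show ?thesis using \<epsilon> by (simp add: add_increasing)
      qed
      then show ?thesis using True by simp
    next
      case False
      then show ?thesis using b1[of z] b1[of "- z"] B(2) by simp
    qed
    have bnd: "\<bar>2 * ?H s - ?tr / ?N * ?m s\<bar> \<le> (\<epsilon> / 2) * ?m s + 2 * B * (?N * unit_ball_vol ?N)" if s: "1/2 \<le> s" "s < 1" for s
    proof -
      have s0: "0 < s" using s by simp
      have ih: "integrable lborel (\<lambda>z. h z * frac_kernel s z)"
        using s0 s(2) by (rule integrable_times_frac_kernel) (use b1 b2 in auto)
      have ih': "integrable lborel (\<lambda>z. h (- z) * frac_kernel s z)"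
        using s0 s(2) by (rule integrable_times_frac_kernel[where C=C]) (measurable, use b1 b2[of "- z" for z] in auto)
      have Hm: "(\<integral>z. h (- z) * frac_kernel s z \<partial>lborel) = ?H s"
      proof -
        have "(\<lambda>z::'a. h (- z) * frac_kernel s z) = (\<lambda>z. h (- z) * frac_kernel s (- z))" by (simp add: frac_kernel_def)
        then show ?thesis using integral_lborel_reflect[of "\<lambda>z. h z * frac_kernel s z"] by simp
      qed
      have q1: "has_bochner_integral lborel (\<lambda>z. \<Sum>i\<in>Basis. \<Sum>j\<in>Basis. A i j * (indicator (ball 0 1) z * ((z \<bullet> i) * (z \<bullet> j)) * frac_kernel s z))
          (\<Sum>i\<in>Basis. \<Sum>j\<in>Basis. A i j * (if i = j then ?m s / ?N else 0))"
        by (intro has_bochner_integral_sum has_bochner_integral_mult_right frac_kernel_quadratic s0 s(2)) auto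
      have "(\<lambda>z. \<Sum>i\<in>Basis. \<Sum>j\<in>Basis. A i j * (indicator (ball 0 1) z * ((z \<bullet> i) * (z \<bullet> j)) * frac_kernel s z)) =
          (\<lambda>z. indicator (ball 0 1) z * ?q z * frac_kernel s z)"
        by (intro ext) (simp add: sum_distrib_left sum_distrib_right mult_ac)
      moreover have "(\<Sum>i\<in>(Basis::'a set). \<Sum>j\<in>Basis. A i j * (if i = j then ?m s / ?N else 0)) = ?tr / ?N * ?m s"
        by (simp add: if_distrib[of "\<lambda>x. A _ _ * x"] sum.delta sum_distrib_right sum_divide_distrib cong: if_cong)
      ultimately have q2: "has_bochner_integral lborel (\<lambda>z. indicator (ball 0 1) z * ?q z * frac_kernel s z) (?tr / ?N * ?m s)"
        using q1 by simp
      have e: "?g z * frac_kernel s z = h z * frac_kernel s z + h (- z) * frac_kernel s z - indicator (ball 0 1) z * ?q z * frac_kernel s z" for z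
        by (simp add: algebra_simps)
      have hb: "has_bochner_integral lborel (\<lambda>z. ?g z * frac_kernel s z) (?H s + ?H s - ?tr / ?N * ?m s)"
        unfolding e using ih ih' Hm
        by (intro has_bochner_integral_diff has_bochner_integral_add q2) (auto simp: has_bochner_integral_iff)
      then have "\<bar>\<integral>z. ?g z * frac_kernel s z \<partial>lborel\<bar> \<le> (\<epsilon> / 2) * ?m s + 2 * B * (?N * unit_ball_vol ?N)"
        by (intro abs_integral_frac_kernel_le[OF s gb B(1)]) (auto intro: integrable.intros)
      then show ?thesis using hb by (simp add: has_bochner_integral_integral_eq)
    qed
    have ev1: "\<forall>\<^sub>F s in at 1 within {0<..<1}. 1/2 \<le> s \<and> s < (1::real)"
      unfolding eventually_at by (intro exI[of _ "1/2"]) (auto simp: dist_real_def)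
    have ev2: "\<forall>\<^sub>F s in at 1 within {0<..<1}. max 0 (2 * B * (?N * unit_ball_vol ?N) * (2 / \<epsilon>)) < ?m s"
      using frac_mass_at_top[where 'a='a] unfolding filterlim_at_top_dense by blast
    show "\<forall>\<^sub>F s in at 1 within {0<..<1}. dist ((2 * ?H s - ?tr / ?N * ?m s) / ?m s) 0 < \<epsilon>"
      using ev1 ev2
    proof eventually_elim
      case (elim s)
      then have m: "0 < ?m s" "2 * B * (?N * unit_ball_vol ?N) < \<epsilon> / 2 * ?m s"
        using \<epsilon> by (auto simp: field_simps)
      have "\<bar>2 * ?H s - ?tr / ?N * ?m s\<bar> \<le> (\<epsilon> / 2) * ?m s + 2 * B * (?N * unit_ball_vol ?N)"
        using elim by (intro bnd) auto
      also have "\<dots> < (\<epsilon> / 2) * ?m s + (\<epsilon> / 2) * ?m s" using m(2) by (rule add_strict_left_mono)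
      finally have "\<bar>2 * ?H s - ?tr / ?N * ?m s\<bar> < \<epsilon> * ?m s" by simp
      then show ?case using m(1) by (simp add: dist_real_def abs_divide divide_less_eq)
    qed
  qed
  have ev: "\<forall>\<^sub>F s in at 1 within {0<..<1}. 0 < ?m s"
    using frac_mass_at_top[where 'a='a] unfolding filterlim_at_top_dense by blast
  \<comment> \<open>The factor 1/2 undoes the symmetrisation. With 2 n from the cosine limit and 1 /
    n from the second moments, exactly the trace remains.\<close>
  have "((\<lambda>s. inverse (?I s / ?m s) * (1/2 * ((2 * ?H s - ?tr / ?N * ?m s) / ?m s + ?tr / ?N))) \<longlongrightarrow>
     inverse (1 / (2 * ?N)) * (1/2 * (0 + ?tr / ?N))) (at 1 within {0<..<1})"
  proof (rule tendsto_mult)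
    show "((\<lambda>s. inverse (?I s / ?m s)) \<longlongrightarrow> inverse (1 / (2 * ?N))) (at 1 within {0<..<1})"
      by (intro tendsto_inverse frac_kernel_cos_limit b) simp
    show "((\<lambda>s. 1/2 * ((2 * ?H s - ?tr / ?N * ?m s) / ?m s + ?tr / ?N)) \<longlongrightarrow> 1/2 * (0 + ?tr / ?N)) (at 1 within {0<..<1})"
      by (intro tendsto_mult tendsto_add tendsto_const E)
  qed
  also have "inverse (1 / (2 * ?N)) * (1/2 * (0 + ?tr / ?N)) = ?tr" by simp
  finally show ?thesis
  proof (rule Lim_transform_eventually)
    show "\<forall>\<^sub>F s in at 1 within {0<..<1}. inverse (?I s / ?m s) * (1/2 * ((2 * ?H s - ?tr / ?N * ?m s) / ?m s + ?tr / ?N)) = inverse (?I s) * ?H s"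
      using ev
    proof eventually_elim
      case (elim s)
      have "(2 * ?H s - ?tr / ?N * ?m s) / ?m s + ?tr / ?N = 2 * ?H s / ?m s"
        using elim by (simp add: diff_divide_distrib)
      then have "inverse (?I s / ?m s) * (1/2 * ((2 * ?H s - ?tr / ?N * ?m s) / ?m s + ?tr / ?N)) =
          inverse (?I s / ?m s) * (1/2 * (2 * ?H s / ?m s))" by (simp only:)
      also have "\<dots> = inverse (?I s) * ?H s"
        using elim by (cases "?I s = 0") (simp_all add: divide_simps)
      finally show ?case .
    qed
  qed
qed

section \<open>The divergence theorem\<close>

text \<open>Gradient and Hessian vanish off the closed support because u is locally zero there, so
  compactness of the support bounds them everywhere. The Lipschitz and Taylor estimates are mean
  value inequalities.\<close>

lemma C2_compact_support_bounds:
  fixes u :: "'a::euclidean_space \<Rightarrow> real"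
  assumes "C2_compact_support u"
  obtains G :: "'a \<Rightarrow> 'a" and H :: "'a \<Rightarrow> 'a \<Rightarrow>\<^sub>L 'a" and B R :: real
  where "0 \<le> B" and "\<And>x. GDERIV u x :> G x" and "\<And>x. (G has_derivative blinfun_apply (H x)) (at x)"
    and "continuous_on UNIV H"
    and "\<And>x. norm (H x) \<le> B" and "\<And>x. norm (G x) \<le> B" and "\<And>x. \<bar>u x\<bar> \<le> B"
    and "\<And>x y. norm (G x - G y) \<le> B * norm (x - y)"
    and "\<And>x y. \<bar>u x - u y\<bar> \<le> B * norm (x - y)"
    and "\<And>x z. \<bar>u (x + z) - u x - z \<bullet> G x\<bar> \<le> B * (norm z)\<^sup>2"
    and "\<And>x. norm x > R \<Longrightarrow> u x = 0"
proof -
  obtain G H where G: "\<And>x. GDERIV u x :> G x" and H: "\<And>x. (G has_derivative blinfun_apply (H x)) (at x)"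
    and Hc: "continuous_on UNIV H" and K: "compact (closure {x. u x \<noteq> 0})"
    using assms unfolding C2_compact_support_def by blast
  let ?K = "closure {x. u x \<noteq> 0}"
  have Gc: "continuous_on A G" for A
    using H by (intro continuous_at_imp_continuous_on) (auto intro: has_derivative_continuous)
  have uc: "continuous_on A u" for A
    using G by (intro continuous_at_imp_continuous_on) (auto simp: gderiv_def intro: has_derivative_continuous)
  have out: "open (- ?K)" using open_Compl[OF closed_closure] .
  have u0: "u x = 0" if "x \<notin> ?K" for x
    using that subsetD[OF closure_subset, of x "{x. u x \<noteq> 0}"] by auto
  have G0: "G x = 0" if x: "x \<notin> ?K" for x
  proof -
    have "((\<lambda>_. 0::real) has_derivative (\<lambda>h. 0)) (at x)" by simp
    then have "(u has_derivative (\<lambda>h. 0)) (at x)"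
    proof (rule has_derivative_transform_within_open[OF _ out])
      show "x \<in> - ?K" using x by simp
      show "0 = u y" if "y \<in> - ?K" for y using u0[of y] that by simp
    qed
    then have "GDERIV u x :> 0" by (simp add: gderiv_def)
    with G show ?thesis by (rule GDERIV_unique)
  qed
  have H0: "H x = 0" if x: "x \<notin> ?K" for x
  proof -
    have "((\<lambda>_. 0::'a) has_derivative (\<lambda>h. 0)) (at x)" by simp
    then have "(G has_derivative (\<lambda>h. 0)) (at x)"
    proof (rule has_derivative_transform_within_open[OF _ out])
      show "x \<in> - ?K" using x by simp
      show "0 = G y" if "y \<in> - ?K" for y using G0[of y] that by simp
    qed
    with H have "blinfun_apply (H x) = (\<lambda>h. 0)" by (rule has_derivative_unique)
    then show ?thesis by (intro blinfun_eqI) (simp add: fun_eq_iff)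
  qed
  have bd: "\<exists>B\<ge>0. \<forall>x. norm (f x) \<le> B"
    if "continuous_on UNIV f" "\<And>x. x \<notin> ?K \<Longrightarrow> f x = 0" for f :: "'a \<Rightarrow> 'b::real_normed_vector"
  proof -
    have "bounded (f ` ?K)"
      by (intro compact_imp_bounded compact_continuous_image continuous_on_subset[OF that(1)] K) auto
    then obtain B where "B > 0" "\<And>x. x \<in> ?K \<Longrightarrow> norm (f x) \<le> B" unfolding bounded_pos by auto
    then show ?thesis using that(2) by (intro exI[of _ B]) (metis less_imp_le norm_zero)
  qed
  obtain B1 where B1: "0 \<le> B1" "\<And>x. norm (H x) \<le> B1" using bd[OF Hc H0] by blast
  obtain B2 where B2: "0 \<le> B2" "\<And>x. norm (G x) \<le> B2" using bd[OF Gc G0] by blast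
  obtain B3 where B3: "0 \<le> B3" "\<And>x. norm (u x) \<le> B3" using bd[OF uc u0] by blast
  define B where "B = B1 + B2 + B3"
  have B: "0 \<le> B" "B1 \<le> B" "B2 \<le> B" "B3 \<le> B" using B1(1) B2(1) B3(1) by (auto simp: B_def)
  have Gl: "norm (G x - G y) \<le> B * norm (x - y)" for x y
  proof (rule differentiable_bound[of UNIV G "\<lambda>x. blinfun_apply (H x)"])
    show "onorm (blinfun_apply (H x)) \<le> B" for x using B1(2)[of x] B(2) by (simp add: norm_blinfun.rep_eq)
  qed (use H in auto)
  have on: "onorm (\<lambda>h. h \<bullet> g) \<le> norm g" for g :: 'a
    by (intro onorm_le) (use Cauchy_Schwarz_ineq2 in \<open>auto simp: mult.commute\<close>)
  have ul: "\<bar>u x - u y\<bar> \<le> B * norm (x - y)" for x y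
    unfolding real_norm_def[symmetric]
  proof (rule differentiable_bound[of UNIV u "\<lambda>x h. h \<bullet> G x"])
    show "onorm (\<lambda>h. h \<bullet> G x) \<le> B" for x using on[of "G x"] B2(2)[of x] B(3) by linarith
  qed (use G in \<open>auto simp: gderiv_def\<close>)
  have ut: "\<bar>u (x + z) - u x - z \<bullet> G x\<bar> \<le> B * (norm z)\<^sup>2" for x z
  proof -
    \<comment> \<open>The mean value inequality for y \<mapsto> u y - y . G x on the ball of radius
      |z| around x, where the derivative has norm at most B |z|.\<close>
    have "norm ((u (x + z) - (x + z) \<bullet> G x) - (u x - x \<bullet> G x)) \<le> (B * norm z) * norm (x + z - x)"
    proof (rule differentiable_bound[of "cball x (norm z)" "\<lambda>y. u y - y \<bullet> G x" "\<lambda>y h. h \<bullet> G y - h \<bullet> G x"])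
      fix y assume y: "y \<in> cball x (norm z)"
      have du: "(u has_derivative (\<lambda>h. h \<bullet> G y)) (at y)" using G by (simp add: gderiv_def)
      have "((\<lambda>y. y \<bullet> G x) has_derivative (\<lambda>h. h \<bullet> G x)) (at y)"
        by (rule bounded_linear_imp_has_derivative[OF bounded_linear_inner_left])
      then show "((\<lambda>y. u y - y \<bullet> G x) has_derivative (\<lambda>h. h \<bullet> G y - h \<bullet> G x)) (at y within cball x (norm z))"
        by (rule has_derivative_at_withinI[OF has_derivative_diff[OF du]])
      have "(\<lambda>h. h \<bullet> G y - h \<bullet> G x) = (\<lambda>h. h \<bullet> (G y - G x))" by (simp add: inner_diff_right)
      then have "onorm (\<lambda>h. h \<bullet> G y - h \<bullet> G x) \<le> norm (G y - G x)" using on by simp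
      also have "\<dots> \<le> B * norm (y - x)" by (rule Gl)
      also have "\<dots> \<le> B * norm z" using y B(1) by (intro mult_left_mono) (auto simp: dist_norm norm_minus_commute)
      finally show "onorm (\<lambda>h. h \<bullet> G y - h \<bullet> G x) \<le> B * norm z" .
    qed (auto simp: dist_norm)
    then show ?thesis by (simp add: inner_add_left power2_eq_square algebra_simps)
  qed
  obtain R where R: "?K \<subseteq> cball 0 R"
    using compact_imp_bounded[OF K] bounded_subset_ballD[of ?K 0] by (metis ball_subset_cball order_trans)
  show thesis
  proof (rule that[of B G H R])
    show "norm (H x) \<le> B" "norm (G x) \<le> B" "\<bar>u x\<bar> \<le> B" for x
      using B1(2)[of x] B2(2)[of x] B3(2)[of x] B by auto
    show "u x = 0" if "norm x > R" for x
    proof (rule u0)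
      show "x \<notin> ?K" using subsetD[OF R, of x] that unfolding mem_cball_0 by linarith
    qed
    show "0 \<le> B" by (rule B(1))
    show "GDERIV u x :> G x" for x by (rule G)
    show "(G has_derivative blinfun_apply (H x)) (at x)" for x by (rule H)
    show "continuous_on UNIV H" by (rule Hc)
    show "norm (G x - G y) \<le> B * norm (x - y)" for x y by (rule Gl)
    show "\<bar>u x - u y\<bar> \<le> B * norm (x - y)" for x y by (rule ul)
    show "\<bar>u (x + z) - u x - z \<bullet> G x\<bar> \<le> B * (norm z)\<^sup>2" for x z by (rule ut)
  qed
qed

lemma tendsto_at_0_quadratic:
  fixes E :: "'a::euclidean_space \<Rightarrow> real"
  assumes "\<And>z. \<bar>E z\<bar> \<le> C * norm z ^ 3"
  shows "((\<lambda>z. E z / (norm z)\<^sup>2) \<longlongrightarrow> 0) (at 0)"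
proof (rule Lim_null_comparison)
  show "\<forall>\<^sub>F z in at 0. norm (E z / (norm z)\<^sup>2) \<le> C * norm z"
  proof (intro always_eventually allI)
    fix z :: 'a
    show "norm (E z / (norm z)\<^sup>2) \<le> C * norm z"
      using assms[of z] by (cases "z = 0") (auto simp: abs_divide divide_le_eq power2_eq_square power3_eq_cube mult.assoc)
  qed
  have "((\<lambda>z::'a. C * norm z) \<longlongrightarrow> C * norm (0::'a)) (at 0)" by (intro tendsto_intros)
  then show "((\<lambda>z::'a. C * norm z) \<longlongrightarrow> 0) (at 0)" by simp
qed

section \<open>Integrated expansion of a vector field and its divergence\<close>

text \<open>M bounds the derivative as well as the Lipschitz constant of W; together they supply the
  dominating function for the limits below.\<close>

locale lipschitz_field =
  fixes \<Omega> :: "'a::euclidean_space set" and W :: "'a \<Rightarrow> 'a" and DW :: "'a \<Rightarrow> 'a \<Rightarrow> 'a" and M :: real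
  assumes \<Omega>: "open \<Omega>" "bounded \<Omega>" and M: "0 \<le> M"
    and der: "\<And>x. (W has_derivative DW x) (at x)"
    and DWc: "\<And>h. continuous_on UNIV (\<lambda>x. DW x h)"
    and DWb: "\<And>x h. norm (DW x h) \<le> M * norm h"
    and Wl: "\<And>x y. norm (W x - W y) \<le> M * norm (x - y)"
begin

lemma linear_DW: "linear (DW x)" using der has_derivative_linear by blast

lemma continuous_on_W: "continuous_on UNIV W"
  using der by (intro continuous_at_imp_continuous_on) (auto intro: has_derivative_continuous)

lemma field_measurable[measurable]: "W \<in> borel_measurable borel" "\<Omega> \<in> sets borel" "(\<lambda>x. DW x h) \<in> borel_measurable borel"
  using \<Omega> by (auto intro!: borel_measurable_continuous_onI continuous_on_W DWc)

lemma emeasure_finite: "emeasure lborel \<Omega> < \<infinity>" using \<Omega>(2) by (rule emeasure_bounded_finite)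

lemma integrable_\<Omega>:
  fixes f :: "'a \<Rightarrow> real"
  assumes [measurable]: "f \<in> borel_measurable borel" and "\<And>x. \<bar>f x\<bar> \<le> c"
  shows "integrable lborel (\<lambda>x. indicator \<Omega> x * f x)"
  using emeasure_finite assms(2) order_trans[OF abs_ge_zero assms(2)]
  by (intro integrable_bounded_support[where A=\<Omega> and c=c]) (auto simp: indicator_def)

lemma abs_inner_le: "\<bar>a \<bullet> b\<bar> \<le> c" if "norm a * norm b \<le> c" for a b :: 'a
  using Cauchy_Schwarz_ineq2[of a b] that by linarith

text \<open>The integral over \<Omega> of the derivative of component i of W in direction j. The
  trace of this matrix is the integral of div W.\<close>

definition Q :: "'a \<Rightarrow> 'a \<Rightarrow> real" where
  "Q i j = (\<integral>x. indicator \<Omega> x * (DW x j \<bullet> i) \<partial>lborel)"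

lemma integrable_DW: "integrable lborel (\<lambda>x. indicator \<Omega> x * (DW x h \<bullet> g))"
proof (rule integrable_\<Omega>[where c="M * norm h * norm g"])
  show "\<bar>DW x h \<bullet> g\<bar> \<le> M * norm h * norm g" for x
    using DWb[of x h] by (intro abs_inner_le mult_right_mono) auto
qed measurable

lemma Q_expand: "(\<Sum>i\<in>Basis. \<Sum>j\<in>Basis. Q i j * ((z \<bullet> i) * (z \<bullet> j))) = (\<integral>x. indicator \<Omega> x * (DW x z \<bullet> z) \<partial>lborel)"
proof -
  have "DW x z \<bullet> z = (\<Sum>i\<in>Basis. \<Sum>j\<in>Basis. (DW x j \<bullet> i) * ((z \<bullet> i) * (z \<bullet> j)))" for x
  proof -
    have "DW x z = (\<Sum>j\<in>Basis. (z \<bullet> j) *\<^sub>R DW x j)"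
      using linear_sum[OF linear_DW, of x "\<lambda>j. (z \<bullet> j) *\<^sub>R j" Basis] linear_scale[OF linear_DW]
      by (simp add: euclidean_representation)
    then have "DW x z \<bullet> i = (\<Sum>j\<in>Basis. (z \<bullet> j) * (DW x j \<bullet> i))" for i by (simp add: inner_sum_left)
    then show ?thesis
      by (subst euclidean_inner) (simp add: sum_distrib_left sum_distrib_right mult_ac)
  qed
  then have "(\<integral>x. indicator \<Omega> x * (DW x z \<bullet> z) \<partial>lborel) =
     (\<integral>x. (\<Sum>i\<in>Basis. \<Sum>j\<in>Basis. (indicator \<Omega> x * (DW x j \<bullet> i)) * ((z \<bullet> i) * (z \<bullet> j))) \<partial>lborel)"
    by (simp add: sum_distrib_left mult_ac)
  also have "\<dots> = (\<Sum>i\<in>Basis. \<Sum>j\<in>Basis. (\<integral>x. (indicator \<Omega> x * (DW x j \<bullet> i)) * ((z \<bullet> i) * (z \<bullet> j)) \<partial>lborel))"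
    by (subst Bochner_Integration.integral_sum | intro Bochner_Integration.integrable_sum integrable_mult_left integrable_DW sum.cong refl)+
  also have "\<dots> = (\<Sum>i\<in>Basis. \<Sum>j\<in>Basis. Q i j * ((z \<bullet> i) * (z \<bullet> j)))"
    by (simp add: Q_def)
  finally show ?thesis ..
qed

lemma derivative_remainder:
  assumes X: "\<And>n. X n \<noteq> 0" "X \<longlonglongrightarrow> 0"
  shows "(\<lambda>n. norm (W (x + X n) - W x - DW x (X n)) / norm (X n)) \<longlonglongrightarrow> 0"
proof -
  have "((\<lambda>h. norm (W (x + h) - W x - DW x h) / norm h) \<longlongrightarrow> 0) (at 0)"
    using der[of x] by (simp add: has_derivative_at)
  moreover have "filterlim X (at 0) sequentially" using X by (simp add: filterlim_at)
  ultimately show ?thesis by (rule filterlim_compose)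
qed

lemma remainder_bound: "norm (W (x + z) - W x - DW x z) \<le> 2 * M * norm z"
  using norm_triangle_ineq4[of "W (x + z) - W x" "DW x z"] Wl[of "x + z" x] DWb[of x z] by simp

text \<open>Dominated convergence with bound 2 M. The free factor Y n covers both uses: the moving
  direction X n / |X n| for the quadratic expansion and a fixed basis vector for the
  divergence.\<close>

lemma integral_remainder_tendsto:
  assumes X: "\<And>n. X n \<noteq> 0" "X \<longlonglongrightarrow> 0"
    and Y: "\<And>n. norm (Y n) \<le> 1"
  shows "(\<lambda>n. \<integral>x. indicator \<Omega> x * ((W (x + X n) - W x - DW x (X n)) \<bullet> Y n / norm (X n)) \<partial>lborel) \<longlonglongrightarrow> 0"
proof -
  have "(\<lambda>n. \<integral>x. indicator \<Omega> x * ((W (x + X n) - W x - DW x (X n)) \<bullet> Y n / norm (X n)) \<partial>lborel) \<longlonglongrightarrow> (\<integral>x. 0 \<partial>(lborel :: 'a measure))"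
  proof (rule integral_dominated_convergence[where w="\<lambda>x. (2 * M) * indicator \<Omega> x"])
    show "integrable lborel (\<lambda>x. (2 * M) * indicator \<Omega> x :: real)"
      using emeasure_finite by (intro integrable_mult_right integrable_real_indicator) auto
    have b: "\<bar>(W (x + X n) - W x - DW x (X n)) \<bullet> Y n / norm (X n)\<bar> \<le> norm (W (x + X n) - W x - DW x (X n)) / norm (X n)" for n x
    proof -
      have "norm (W (x + X n) - W x - DW x (X n)) * norm (Y n) \<le> norm (W (x + X n) - W x - DW x (X n)) * 1"
        using Y by (intro mult_left_mono) auto
      then have "\<bar>(W (x + X n) - W x - DW x (X n)) \<bullet> Y n\<bar> \<le> norm (W (x + X n) - W x - DW x (X n))"
        by (intro abs_inner_le) simp
      then show ?thesis by (simp add: abs_divide divide_right_mono)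
    qed
    show "AE x in lborel. (\<lambda>n. indicator \<Omega> x * ((W (x + X n) - W x - DW x (X n)) \<bullet> Y n / norm (X n))) \<longlonglongrightarrow> 0"
    proof (rule AE_I2)
      fix x
      have "(\<lambda>n. (W (x + X n) - W x - DW x (X n)) \<bullet> Y n / norm (X n)) \<longlonglongrightarrow> 0"
        by (rule Lim_null_comparison[OF _ derivative_remainder[OF X, of x]]) (use b in auto)
      then have "(\<lambda>n. indicator \<Omega> x * ((W (x + X n) - W x - DW x (X n)) \<bullet> Y n / norm (X n))) \<longlonglongrightarrow> indicator \<Omega> x * 0"
        by (intro tendsto_mult tendsto_const)
      then show "(\<lambda>n. indicator \<Omega> x * ((W (x + X n) - W x - DW x (X n)) \<bullet> Y n / norm (X n))) \<longlonglongrightarrow> 0" by simp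
    qed
    show "AE x in lborel. norm (indicator \<Omega> x * ((W (x + X n) - W x - DW x (X n)) \<bullet> Y n / norm (X n))) \<le> (2 * M) * indicator \<Omega> x" for n
    proof (rule AE_I2)
      fix x
      have "norm (W (x + X n) - W x - DW x (X n)) / norm (X n) \<le> 2 * M"
        using remainder_bound[of x "X n"] X(1)[of n] by (simp add: divide_le_eq)
      then show "norm (indicator \<Omega> x * ((W (x + X n) - W x - DW x (X n)) \<bullet> Y n / norm (X n))) \<le> (2 * M) * indicator \<Omega> x"
        using b[of x n] by (auto simp: indicator_def)
    qed
  qed measurable
  then show ?thesis by simp
qed

text \<open>The sequence X may approach 0 with changing direction, which makes the expansion uniform
  over all directions, as integration against the kernel requires.\<close>

lemma quadratic_expansion:
  "((\<lambda>z. ((\<integral>x. indicator \<Omega> x * ((W (x + z) - W x) \<bullet> z) \<partial>lborel) -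
      (\<Sum>i\<in>Basis. \<Sum>j\<in>Basis. Q i j * ((z \<bullet> i) * (z \<bullet> j)))) / (norm z)\<^sup>2) \<longlongrightarrow> 0) (at 0)"
proof (subst tendsto_at_iff_sequentially, intro allI impI)
  fix X :: "nat \<Rightarrow> 'a" assume "\<forall>i. X i \<in> UNIV - {0}" "X \<longlonglongrightarrow> 0"
  then have X: "\<And>n. X n \<noteq> 0" "X \<longlonglongrightarrow> 0" by auto
  have "(\<lambda>n. \<integral>x. indicator \<Omega> x * ((W (x + X n) - W x - DW x (X n)) \<bullet> (X n /\<^sub>R norm (X n)) / norm (X n)) \<partial>lborel) \<longlonglongrightarrow> 0"
    using X by (intro integral_remainder_tendsto) auto
  moreover have "(\<integral>x. indicator \<Omega> x * ((W (x + z) - W x - DW x z) \<bullet> (z /\<^sub>R norm z) / norm z) \<partial>lborel) =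
     ((\<integral>x. indicator \<Omega> x * ((W (x + z) - W x) \<bullet> z) \<partial>lborel) -
      (\<Sum>i\<in>Basis. \<Sum>j\<in>Basis. Q i j * ((z \<bullet> i) * (z \<bullet> j)))) / (norm z)\<^sup>2" for z
  proof -
    have i1: "integrable lborel (\<lambda>x. indicator \<Omega> x * ((W (x + z) - W x) \<bullet> z))"
    proof (rule integrable_\<Omega>[where c="M * norm z * norm z"])
      show "\<bar>(W (x + z) - W x) \<bullet> z\<bar> \<le> M * norm z * norm z" for x
        using Wl[of "x + z" x] by (intro abs_inner_le mult_right_mono) auto
    qed measurable
    have "(\<integral>x. indicator \<Omega> x * ((W (x + z) - W x - DW x z) \<bullet> (z /\<^sub>R norm z) / norm z) \<partial>lborel) =
      (\<integral>x. (indicator \<Omega> x * ((W (x + z) - W x) \<bullet> z) - indicator \<Omega> x * (DW x z \<bullet> z)) / (norm z)\<^sup>2 \<partial>lborel)"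
      by (intro Bochner_Integration.integral_cong) (auto simp: inner_diff_left power2_eq_square divide_inverse algebra_simps)
    also have "\<dots> = ((\<integral>x. indicator \<Omega> x * ((W (x + z) - W x) \<bullet> z) \<partial>lborel) - (\<integral>x. indicator \<Omega> x * (DW x z \<bullet> z) \<partial>lborel)) / (norm z)\<^sup>2"
      using i1 integrable_DW[of z z] by simp
    finally show ?thesis unfolding Q_expand .
  qed
  ultimately show "((\<lambda>z. ((\<integral>x. indicator \<Omega> x * ((W (x + z) - W x) \<bullet> z) \<partial>lborel) -
      (\<Sum>i\<in>Basis. \<Sum>j\<in>Basis. Q i j * ((z \<bullet> i) * (z \<bullet> j)))) / (norm z)\<^sup>2) \<circ> X) \<longlonglongrightarrow> 0"
    by (simp add: o_def)
qed

lemma divergence_limit: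
  assumes d: "d \<in> Basis"
  shows "(\<lambda>n. (\<integral>x. indicator \<Omega> x * ((W (x + (1 / real (Suc n)) *\<^sub>R d) - W x) \<bullet> d) \<partial>lborel) / (1 / real (Suc n))) \<longlonglongrightarrow> Q d d"
proof -
  define t where "t n = 1 / real (Suc n)" for n
  have t: "t n > 0" for n by (simp add: t_def)
  have nd: "norm (t n *\<^sub>R d) = t n" for n using t[of n] d by simp
  have "t \<longlonglongrightarrow> 0" using LIMSEQ_inverse_real_of_nat by (simp add: t_def[abs_def] inverse_eq_divide)
  then have X: "t n *\<^sub>R d \<noteq> 0" "(\<lambda>n. t n *\<^sub>R d) \<longlonglongrightarrow> 0" for n
    using t[of n] d tendsto_scaleR[of t 0 sequentially "\<lambda>_. d" d] by auto
  have "(\<lambda>n. \<integral>x. indicator \<Omega> x * ((W (x + t n *\<^sub>R d) - W x - DW x (t n *\<^sub>R d)) \<bullet> d / norm (t n *\<^sub>R d)) \<partial>lborel) \<longlonglongrightarrow> 0"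
    using X d by (intro integral_remainder_tendsto[of "\<lambda>n. t n *\<^sub>R d" "\<lambda>_. d"]) auto
  moreover have "(\<integral>x. indicator \<Omega> x * ((W (x + t n *\<^sub>R d) - W x - DW x (t n *\<^sub>R d)) \<bullet> d / norm (t n *\<^sub>R d)) \<partial>lborel) =
     (\<integral>x. indicator \<Omega> x * ((W (x + t n *\<^sub>R d) - W x) \<bullet> d) \<partial>lborel) / t n - Q d d" for n
  proof -
    have i1: "integrable lborel (\<lambda>x. indicator \<Omega> x * ((W (x + t n *\<^sub>R d) - W x) \<bullet> d))"
    proof (rule integrable_\<Omega>[where c="M * norm (t n *\<^sub>R d) * norm d"])
      show "\<bar>(W (x + t n *\<^sub>R d) - W x) \<bullet> d\<bar> \<le> M * norm (t n *\<^sub>R d) * norm d" for x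
        using Wl[of "x + t n *\<^sub>R d" x] by (intro abs_inner_le mult_right_mono) auto
    qed measurable
    have "DW x (t n *\<^sub>R d) = t n *\<^sub>R DW x d" for x using linear_scale[OF linear_DW] .
    then have "(\<integral>x. indicator \<Omega> x * ((W (x + t n *\<^sub>R d) - W x - DW x (t n *\<^sub>R d)) \<bullet> d / norm (t n *\<^sub>R d)) \<partial>lborel) =
       (\<integral>x. (indicator \<Omega> x * ((W (x + t n *\<^sub>R d) - W x) \<bullet> d)) / t n - indicator \<Omega> x * (DW x d \<bullet> d) \<partial>lborel)"
      using t[of n] unfolding nd
      by (intro Bochner_Integration.integral_cong) (auto simp: inner_diff_left diff_divide_distrib right_diff_distrib)
    then show ?thesis
      using i1 integrable_DW[of d d] by (simp add: Q_def)
  qed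
  ultimately have "(\<lambda>n. (\<integral>x. indicator \<Omega> x * ((W (x + t n *\<^sub>R d) - W x) \<bullet> d) \<partial>lborel) / t n - Q d d) \<longlonglongrightarrow> 0" by simp
  then show ?thesis unfolding t_def by (rule LIM_zero_cancel)
qed

text \<open>For each basis vector i, the boundary flux of component i and the diagonal entry
  \<open>Q i i\<close> are limits of one and the same quotient: a change of variables moves the
  shift from the indicator of \<Omega> to W.\<close>

lemma divergence_theorem:
  assumes dom: "bounded_lipschitz_domain \<Omega>" and supp: "\<And>x. norm x > R \<Longrightarrow> W x = 0"
  shows "(\<Sum>i\<in>Basis. Q i i) = (\<integral>y. indicator (frontier \<Omega>) y * (W y \<bullet> exterior_normal \<Omega> y) \<partial>surface_measure \<Omega>)"
proof -
  let ?\<sigma> = "surface_measure \<Omega>" and ?\<Gamma> = "frontier \<Omega>"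
  have ci: "continuous_on UNIV (\<lambda>x. W x \<bullet> i)" for i by (intro continuous_intros continuous_on_W)
  have comp: "Q i i = (\<integral>y. indicator ?\<Gamma> y * ((W y \<bullet> i) * (i \<bullet> exterior_normal \<Omega> y)) \<partial>?\<sigma>)" if i: "i \<in> Basis" for i
  proof -
    have "((\<lambda>t. (\<integral>x. (W x \<bullet> i) * (indicator \<Omega> (x - t *\<^sub>R i) - indicator \<Omega> x) \<partial>lborel) / t)
      \<longlongrightarrow> (\<integral>y. indicator ?\<Gamma> y * ((W y \<bullet> i) * (i \<bullet> exterior_normal \<Omega> y)) \<partial>?\<sigma>)) (at 0)"
      by (rule domain_flux(1)[OF dom ci, of R]) (simp add: supp)
    note l1 = LIMSEQ_quotient[OF this]
    have "(\<integral>x. (W x \<bullet> i) * (indicator \<Omega> (x - t *\<^sub>R i) - indicator \<Omega> x) \<partial>lborel) =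
       (\<integral>x. indicator \<Omega> x * ((W (x + t *\<^sub>R i) - W x) \<bullet> i) \<partial>lborel)" for t
    proof -
      obtain B where B: "\<And>x. norm (W x) \<le> B"
      proof -
        have "norm (W x) \<le> norm (W 0) + M * \<bar>R\<bar>" for x
        proof (cases "norm x \<le> R")
          case True
          have "norm (W x) \<le> norm (W 0) + norm (W x - W 0)" by (rule norm_triangle_sub)
          also have "norm (W x - W 0) \<le> M * \<bar>R\<bar>"
            using Wl[of x 0] mult_left_mono[of "norm x" "\<bar>R\<bar>" M] True M abs_ge_self[of R] by simp
          finally show ?thesis by simp
        next
          case False
          then show ?thesis using supp[of x] M by simp
        qed
        then show ?thesis using that by blast
      qed
      have Bi: "\<bar>W x \<bullet> i\<bar> \<le> B * norm i" for x using B[of x] by (intro abs_inner_le mult_right_mono) auto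
      have i1: "integrable lborel (\<lambda>x. indicator \<Omega> x * (W x \<bullet> i))" "integrable lborel (\<lambda>x. indicator \<Omega> x * (W (x + t *\<^sub>R i) \<bullet> i))"
        by (rule integrable_\<Omega>[OF _ Bi], measurable)+
      have i2: "integrable lborel (\<lambda>x. indicator \<Omega> (x - t *\<^sub>R i) * (W x \<bullet> i))"
        using integrable_lborel_translate[OF i1(2), of "- t *\<^sub>R i"] by simp
      have "(\<integral>x. (W x \<bullet> i) * (indicator \<Omega> (x - t *\<^sub>R i) - indicator \<Omega> x) \<partial>lborel) =
          (\<integral>x. indicator \<Omega> (x - t *\<^sub>R i) * (W x \<bullet> i) - indicator \<Omega> x * (W x \<bullet> i) \<partial>lborel)"
        by (intro Bochner_Integration.integral_cong) (auto simp: algebra_simps)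
      also have "\<dots> = (\<integral>x. indicator \<Omega> (x - t *\<^sub>R i) * (W x \<bullet> i) \<partial>lborel) - (\<integral>x. indicator \<Omega> x * (W x \<bullet> i) \<partial>lborel)"
        by (rule Bochner_Integration.integral_diff[OF i2 i1(1)])
      also have "(\<integral>x. indicator \<Omega> (x - t *\<^sub>R i) * (W x \<bullet> i) \<partial>lborel) = (\<integral>x. indicator \<Omega> x * (W (x + t *\<^sub>R i) \<bullet> i) \<partial>lborel)"
        using integral_lborel_translate[of "\<lambda>x. indicator \<Omega> (x - t *\<^sub>R i) * (W x \<bullet> i)" "t *\<^sub>R i"] by simp
      also have "\<dots> - (\<integral>x. indicator \<Omega> x * (W x \<bullet> i) \<partial>lborel) =
          (\<integral>x. indicator \<Omega> x * (W (x + t *\<^sub>R i) \<bullet> i) - indicator \<Omega> x * (W x \<bullet> i) \<partial>lborel)"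
        by (rule Bochner_Integration.integral_diff[OF i1(2,1), symmetric])
      also have "\<dots> = (\<integral>x. indicator \<Omega> x * ((W (x + t *\<^sub>R i) - W x) \<bullet> i) \<partial>lborel)"
        by (simp add: inner_diff_left right_diff_distrib)
      finally show ?thesis .
    qed
    with l1 divergence_limit[OF i] show ?thesis by (auto intro: LIMSEQ_unique)
  qed
  have "integrable ?\<sigma> (\<lambda>y. indicator ?\<Gamma> y * ((W y \<bullet> i) * (i \<bullet> exterior_normal \<Omega> y)))" for i
    by (rule domain_flux(2)[OF dom ci, of R]) (simp add: supp)
  then have "(\<Sum>i\<in>Basis. Q i i) = (\<integral>y. (\<Sum>i\<in>Basis. indicator ?\<Gamma> y * ((W y \<bullet> i) * (i \<bullet> exterior_normal \<Omega> y))) \<partial>?\<sigma>)"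
    using comp by (subst Bochner_Integration.integral_sum) auto
  also have "\<dots> = (\<integral>y. indicator ?\<Gamma> y * (W y \<bullet> exterior_normal \<Omega> y) \<partial>?\<sigma>)"
    by (simp add: sum_distrib_left[symmetric] euclidean_inner[symmetric] inner_commute[of _ "exterior_normal \<Omega> _"])
  finally show ?thesis .
qed

end

section \<open>The limit of the nonlocal flux\<close>

text \<open>The regularity of the boundary enters only through \<open>exit_le\<close>, the linear
  bound on the volume that a translation carries out of \<Omega>.\<close>

locale nonlocal_pair =
  fixes \<Omega> :: "'a::euclidean_space set" and u v :: "'a \<Rightarrow> real" and G :: "'a \<Rightarrow> 'a" and B C :: real
  assumes \<Omega>: "open \<Omega>" "bounded \<Omega>" and BC: "0 \<le> B" "0 \<le> C"
    and ub: "\<And>x. \<bar>u x\<bar> \<le> B" and vb: "\<And>x. \<bar>v x\<bar> \<le> B" and Gb: "\<And>x. norm (G x) \<le> B"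
    and ul: "\<And>x y. \<bar>u x - u y\<bar> \<le> B * norm (x - y)" and vl: "\<And>x y. \<bar>v x - v y\<bar> \<le> B * norm (x - y)"
    and ut: "\<And>x z. \<bar>u (x + z) - u x - z \<bullet> G x\<bar> \<le> B * (norm z)\<^sup>2"
    and um[measurable]: "u \<in> borel_measurable borel" and vm[measurable]: "v \<in> borel_measurable borel"
    and Gm[measurable]: "G \<in> borel_measurable borel"
    and exit_le: "\<And>z. emeasure lborel {y \<in> \<Omega>. y + z \<notin> \<Omega>} \<le> ennreal (C * norm z)"
begin

definition exit_set :: "'a \<Rightarrow> 'a set" where "exit_set z = {y \<in> \<Omega>. y + z \<notin> \<Omega>}"

lemma \<Omega>m[measurable]: "\<Omega> \<in> sets borel" using \<Omega> by simp

lemma sets_exit_set[measurable]: "exit_set z \<in> sets borel" unfolding exit_set_def by measurable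

lemma emeasure_finite: "emeasure lborel \<Omega> < \<infinity>" using \<Omega>(2) by (rule emeasure_bounded_finite)

lemma exit_set_finite: "emeasure lborel (exit_set z) < \<infinity>"
  using exit_le[of z] ennreal_less_top unfolding exit_set_def by (metis infinity_ennreal_def le_less_trans)

lemma measure_exit_set: "measure lborel (exit_set z) \<le> C * norm z"
  using exit_le[of z] BC by (simp add: exit_set_def[symmetric] measure_def enn2real_leI)

text \<open>The two indicators together mark the x for which exactly one of x and x - z lies in
  \<Omega>, a set of measure at most 2 C |z|.\<close>

lemma exit_integral:
  assumes [measurable]: "f \<in> borel_measurable borel" and k: "0 \<le> k"
    and b: "\<And>x. \<bar>f x\<bar> \<le> k * (indicator (exit_set z) (x - z) + indicator (exit_set (- z)) x)"
  shows "integrable lborel f" and "\<bar>\<integral>x. f x \<partial>lborel\<bar> \<le> 2 * k * (C * norm z)"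
proof -
  have i0: "integrable lborel (\<lambda>x. indicator (exit_set w) x :: real)" for w
    using exit_set_finite by (intro integrable_real_indicator) auto
  have i1: "integrable lborel (\<lambda>x. indicator (exit_set z) (x - z) :: real)"
    using integrable_lborel_translate[OF i0, of z "- z"] by simp
  have w: "integrable lborel (\<lambda>x. k * (indicator (exit_set z) (x - z) + indicator (exit_set (- z)) x) :: real)"
    using i0 i1 by (intro integrable_mult_right Bochner_Integration.integrable_add)
  show i: "integrable lborel f"
    by (rule Bochner_Integration.integrable_bound[OF w]) (use b in \<open>auto intro: order_trans[OF _ abs_ge_self]\<close>)
  have "\<bar>\<integral>x. f x \<partial>lborel\<bar> \<le> (\<integral>x. k * (indicator (exit_set z) (x - z) + indicator (exit_set (- z)) x) \<partial>lborel)"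
    by (rule order_trans[OF integral_abs_bound integral_mono[OF integrable_abs[OF i] w b]])
  also have "\<dots> = k * ((\<integral>x. indicator (exit_set z) (x - z) \<partial>lborel) + (\<integral>x. indicator (exit_set (- z)) x \<partial>lborel))"
    using i0 i1 by simp
  also have "(\<integral>x. indicator (exit_set z) (x - z) \<partial>lborel) = (\<integral>x. indicator (exit_set z) x \<partial>lborel :: real)"
    using integral_lborel_translate[of "\<lambda>x. indicator (exit_set z) x" "- z"] by simp
  also have "k * ((\<integral>x. indicator (exit_set z) x \<partial>lborel) + (\<integral>x. indicator (exit_set (- z)) x \<partial>lborel)) \<le> k * (C * norm z + C * norm z)"
    using measure_exit_set[of z] measure_exit_set[of "- z"] k by (intro mult_left_mono add_mono) auto
  finally show "\<bar>\<integral>x. f x \<partial>lborel\<bar> \<le> 2 * k * (C * norm z)" by (simp add: algebra_simps)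
qed

text \<open>The integrand of the double integral without the kernel, at y = x - z. Both domains of
  integration appear as indicators, so that Fubini applies on the whole space.\<close>

definition \<psi> :: "'a \<Rightarrow> 'a \<Rightarrow> real" where
  "\<psi> x z = v x * (u x - u (x - z)) * indicator (- \<Omega>) x * indicator \<Omega> (x - z)"

definition h :: "'a \<Rightarrow> real" where "h z = (\<integral>x. \<psi> x z \<partial>lborel)"

text \<open>Each minimum joins an estimate for small z to one for large z: the former multiply to
  order |z|^2, the latter keep the product bounded, and the kernel needs both.\<close>

definition bound :: "'a \<Rightarrow> real" where
  "bound z = B * min (B * norm z) (2 * B) * min (C * norm z) (measure lborel \<Omega>)"

lemma \<psi>_measurable[measurable]: "case_prod \<psi> \<in> borel_measurable (lborel \<Otimes>\<^sub>M lborel)"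
  unfolding \<psi>_def by measurable

lemma \<psi>_measurable1[measurable]: "(\<lambda>x. \<psi> x z) \<in> borel_measurable borel"
  unfolding \<psi>_def by measurable

lemma h_measurable[measurable]: "h \<in> borel_measurable borel"
proof -
  have "(\<lambda>z. \<integral>x. case_prod \<psi> (x, z) \<partial>lborel) \<in> borel_measurable lborel"
    by (intro lborel.borel_measurable_lebesgue_integral) measurable
  then show ?thesis by (simp add: h_def[abs_def])
qed

lemma bound_nonneg: "0 \<le> bound z" using BC by (simp add: bound_def)

lemma bound_measurable[measurable]: "bound \<in> borel_measurable borel" unfolding bound_def by measurable

lemma bound_le: "bound z \<le> (B * B * C + 2 * B * B * measure lborel \<Omega>) * (norm z)\<^sup>2"
  "bound z \<le> B * B * C + 2 * B * B * measure lborel \<Omega>"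
proof -
  show "bound z \<le> (B * B * C + 2 * B * B * measure lborel \<Omega>) * (norm z)\<^sup>2"
  proof -
    have "bound z \<le> B * (B * norm z) * (C * norm z)" unfolding bound_def using BC by (intro mult_mono) auto
    also have "\<dots> = B * B * C * (norm z)\<^sup>2" by (simp add: power2_eq_square)
    also have "\<dots> \<le> (B * B * C + 2 * B * B * measure lborel \<Omega>) * (norm z)\<^sup>2" using BC by (intro mult_right_mono) auto
    finally show ?thesis .
  qed
  have "bound z \<le> B * (2 * B) * measure lborel \<Omega>" unfolding bound_def using BC by (intro mult_mono) auto
  also have "\<dots> \<le> B * B * C + 2 * B * B * measure lborel \<Omega>" using BC by simp
  finally show "bound z \<le> B * B * C + 2 * B * B * measure lborel \<Omega>" .
qed

lemma nn_integral_\<psi>: "(\<integral>\<^sup>+x. ennreal \<bar>\<psi> x z\<bar> \<partial>lborel) \<le> ennreal (bound z)"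
proof -
  let ?k = "B * min (B * norm z) (2 * B)"
  have k: "0 \<le> ?k" using BC by simp
  have "(\<integral>\<^sup>+x. ennreal \<bar>\<psi> x z\<bar> \<partial>lborel) \<le> (\<integral>\<^sup>+x. ennreal ?k * indicator (exit_set z) (x - z) \<partial>lborel)"
  proof (rule nn_integral_mono)
    fix x
    show "ennreal \<bar>\<psi> x z\<bar> \<le> ennreal ?k * indicator (exit_set z) (x - z)"
    proof (cases "x - z \<in> exit_set z")
      case True
      have "\<bar>u x - u (x - z)\<bar> \<le> B * norm z" using ul[of x "x - z"] by simp
      moreover have "\<bar>u x - u (x - z)\<bar> \<le> 2 * B" using ub[of x] ub[of "x - z"] by linarith
      ultimately have "\<bar>v x\<bar> * \<bar>u x - u (x - z)\<bar> \<le> ?k" using vb[of x] BC by (intro mult_mono) auto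
      then have "\<bar>\<psi> x z\<bar> \<le> ?k" using k by (auto simp: \<psi>_def abs_mult indicator_def)
      then show ?thesis using True by (simp add: ennreal_leI)
    next
      case False
      then have "\<psi> x z = 0" by (auto simp: \<psi>_def exit_set_def indicator_def)
      then show ?thesis by simp
    qed
  qed
  also have "\<dots> = ennreal ?k * (\<integral>\<^sup>+x. indicator (exit_set z) (x - z) \<partial>lborel)"
    by (intro nn_integral_cmult) measurable
  also have "(\<integral>\<^sup>+x. indicator (exit_set z) (x - z) \<partial>lborel) = emeasure lborel (exit_set z)"
    using nn_integral_lborel_translate[of "indicator (exit_set z)" "- z"] by simp
  also have "\<dots> = ennreal (measure lborel (exit_set z))"
    using exit_set_finite[of z] by (simp add: emeasure_eq_ennreal_measure less_top)
  also have "ennreal ?k * \<dots> = ennreal (?k * measure lborel (exit_set z))" using k by (simp add: ennreal_mult)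
  also have "\<dots> \<le> ennreal (bound z)"
  proof (rule ennreal_leI)
    have "measure lborel (exit_set z) \<le> measure lborel \<Omega>"
      using emeasure_finite by (intro measure_mono_fmeasurable) (auto simp: exit_set_def fmeasurable_def)
    then show "?k * measure lborel (exit_set z) \<le> bound z"
      unfolding bound_def using measure_exit_set[of z] k by (intro mult_left_mono) auto
  qed
  finally show ?thesis .
qed

lemma \<psi>_integrable: "integrable lborel (\<lambda>x. \<psi> x z)"
  using nn_integral_\<psi>[of z] ennreal_less_top by (intro integrableI_bounded) (auto intro: le_less_trans)

lemma h_le: "\<bar>h z\<bar> \<le> bound z"
proof -
  have "ennreal \<bar>h z\<bar> \<le> (\<integral>\<^sup>+x. ennreal \<bar>\<psi> x z\<bar> \<partial>lborel)"
    using integral_norm_bound_ennreal[OF \<psi>_integrable[of z]] by (simp add: h_def)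
  also note nn_integral_\<psi>
  finally show ?thesis using bound_nonneg by simp
qed

text \<open>The remainder T is of order |z|^2 and lives where exactly one of x and x - z is in
  \<Omega>, a set of measure of order |z|. Its integral is thus of order |z|^3.\<close>

lemma h_symmetrised:
  "((\<lambda>z. (h z + h (- z) - (\<integral>x. indicator \<Omega> x * ((v (x + z) *\<^sub>R G (x + z) - v x *\<^sub>R G x) \<bullet> z) \<partial>lborel)) / (norm z)\<^sup>2) \<longlongrightarrow> 0) (at 0)"
proof (rule tendsto_at_0_quadratic)
  fix z :: 'a
  let ?W = "\<lambda>x. v x *\<^sub>R G x"
  \<comment> \<open>The first summand corrects for v being taken at x - z when x is the point inside
    \<Omega>; the second is the Taylor error of u at x.\<close>
  define T where "T x = (v x - v (x - z)) * (u x - u (x - z)) * (indicator (- \<Omega>) (x - z) * indicator \<Omega> x) +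
     v x * (u x - u (x - z) - z \<bullet> G x) * (indicator \<Omega> (x - z) - indicator \<Omega> x)" for x
  have Tm[measurable]: "T \<in> borel_measurable borel" unfolding T_def by measurable
  \<comment> \<open>After this shift both integrands refer to the same pair of points x and x -
    z.\<close>
  have hm: "h (- z) = (\<integral>x. \<psi> (x - z) (- z) \<partial>lborel)"
    using integral_lborel_translate[of "\<lambda>x. \<psi> x (- z)" "- z"] by (simp add: h_def)
  have ihm: "integrable lborel (\<lambda>x. \<psi> (x - z) (- z))"
    using integrable_lborel_translate[OF \<psi>_integrable[of "- z"], of "- z"] by simp
  have pt: "\<psi> x z + \<psi> (x - z) (- z) = T x + (?W x \<bullet> z) * (indicator \<Omega> (x - z) - indicator \<Omega> x)" for x
    by (cases "x \<in> \<Omega>"; cases "x - z \<in> \<Omega>") (simp_all add: \<psi>_def T_def inner_commute algebra_simps)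
  have d: "\<bar>u x - u (x - z)\<bar> \<le> B * norm z" "\<bar>v x - v (x - z)\<bar> \<le> B * norm z" "\<bar>u x - u (x - z) - z \<bullet> G x\<bar> \<le> B * (norm z)\<^sup>2" for x
    using ul[of x "x - z"] vl[of x "x - z"] ut[of x "- z"] by auto
  have Tb: "\<bar>T x\<bar> \<le> (2 * B * B * (norm z)\<^sup>2) * (indicator (exit_set z) (x - z) + indicator (exit_set (- z)) x)" for x
  proof -
    have a: "\<bar>(v x - v (x - z)) * (u x - u (x - z))\<bar> \<le> B * B * (norm z)\<^sup>2"
    proof -
      have "\<bar>(v x - v (x - z)) * (u x - u (x - z))\<bar> \<le> (B * norm z) * (B * norm z)"
        unfolding abs_mult using d[of x] BC by (intro mult_mono) auto
      then show ?thesis by (simp add: power2_eq_square mult_ac)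
    qed
    have b: "\<bar>v x * (u x - u (x - z) - z \<bullet> G x)\<bar> \<le> B * B * (norm z)\<^sup>2"
    proof -
      have "\<bar>v x * (u x - u (x - z) - z \<bullet> G x)\<bar> \<le> B * (B * (norm z)\<^sup>2)"
        unfolding abs_mult using d(3)[of x] vb[of x] BC by (intro mult_mono) auto
      then show ?thesis by (simp add: mult_ac)
    qed
    have nn: "0 \<le> B * B * (norm z)\<^sup>2" using BC by simp
    show ?thesis
      using a b nn unfolding T_def exit_set_def
      by (cases "x \<in> \<Omega>"; cases "x - z \<in> \<Omega>") auto
  qed
  have k: "0 \<le> 2 * B * B * (norm z)\<^sup>2" using BC by simp
  note iT = exit_integral[OF Tm k Tb]
  have Wb: "\<bar>?W x \<bullet> z\<bar> \<le> B * B * norm z" for x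
  proof -
    have "\<bar>?W x \<bullet> z\<bar> \<le> norm (?W x) * norm z" by (rule Cauchy_Schwarz_ineq2)
    also have "\<dots> \<le> (B * B) * norm z"
      using vb[of x] Gb[of x] BC by (intro mult_right_mono) (auto intro: mult_mono)
    finally show ?thesis .
  qed
  have iW: "integrable lborel (\<lambda>x. indicator \<Omega> x * (f x \<bullet> z))"
    if [measurable]: "f \<in> borel_measurable borel" and "\<And>x. \<bar>f x \<bullet> z\<bar> \<le> B * B * norm z" for f
    using emeasure_finite that(2) BC
    by (intro integrable_bounded_support[where A=\<Omega> and c="B * B * norm z"]) (auto simp: indicator_def)
  have i1: "integrable lborel (\<lambda>x. indicator \<Omega> x * (?W x \<bullet> z))" and i2: "integrable lborel (\<lambda>x. indicator \<Omega> x * (?W (x + z) \<bullet> z))"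
    using Wb by (intro iW; measurable)+
  have i3: "integrable lborel (\<lambda>x. indicator \<Omega> (x - z) * (?W x \<bullet> z))"
    using integrable_lborel_translate[OF i2, of "- z"] by simp
  have "h z + h (- z) = (\<integral>x. \<psi> x z + \<psi> (x - z) (- z) \<partial>lborel)"
    unfolding hm unfolding h_def by (rule Bochner_Integration.integral_add[OF \<psi>_integrable ihm, symmetric])
  also have "\<dots> = (\<integral>x. T x + (indicator \<Omega> (x - z) * (?W x \<bullet> z) - indicator \<Omega> x * (?W x \<bullet> z)) \<partial>lborel)"
    unfolding pt by (intro Bochner_Integration.integral_cong) (auto simp: algebra_simps)
  also have "\<dots> = (\<integral>x. T x \<partial>lborel) + ((\<integral>x. indicator \<Omega> (x - z) * (?W x \<bullet> z) \<partial>lborel) - (\<integral>x. indicator \<Omega> x * (?W x \<bullet> z) \<partial>lborel))"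
    by (simp only: Bochner_Integration.integral_add[OF iT(1) Bochner_Integration.integrable_diff[OF i3 i1]] Bochner_Integration.integral_diff[OF i3 i1])
  also have "(\<integral>x. indicator \<Omega> (x - z) * (?W x \<bullet> z) \<partial>lborel) = (\<integral>x. indicator \<Omega> x * (?W (x + z) \<bullet> z) \<partial>lborel)"
    using integral_lborel_translate[of "\<lambda>x. indicator \<Omega> (x - z) * (?W x \<bullet> z)" z] by simp
  also have "\<dots> - (\<integral>x. indicator \<Omega> x * (?W x \<bullet> z) \<partial>lborel) = (\<integral>x. indicator \<Omega> x * ((?W (x + z) - ?W x) \<bullet> z) \<partial>lborel)"
    by (simp only: Bochner_Integration.integral_diff[OF i2 i1, symmetric] inner_diff_left right_diff_distrib)
  finally have "h z + h (- z) - (\<integral>x. indicator \<Omega> x * ((?W (x + z) - ?W x) \<bullet> z) \<partial>lborel) = (\<integral>x. T x \<partial>lborel)" by simp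
  moreover have "2 * (2 * B * B * (norm z)\<^sup>2) * (C * norm z) = (4 * B * B * C) * norm z ^ 3"
    by (simp add: power2_eq_square power3_eq_cube)
  ultimately show "\<bar>h z + h (- z) - (\<integral>x. indicator \<Omega> x * ((?W (x + z) - ?W x) \<bullet> z) \<partial>lborel)\<bar> \<le> (4 * B * B * C) * norm z ^ 3"
    using iT(2) by (simp only:)
qed

text \<open>Integrating absolute values over x first leaves at most \<open>bound z\<close> times the
  kernel, which is integrable; this permits exchanging the integrals. The substitution in the inner
  integral is a translation followed by a reflection.\<close>

lemma nonlocal_eq_kernel:
  assumes s: "0 < s" "s < 1"
  shows "(\<integral>x. indicator (- \<Omega>) x * ((\<integral>y. indicator \<Omega> y * ((u x - u y) / norm (x - y) powr (real DIM('a) + 2 * s)) \<partial>lborel) * v x) \<partial>lborel) =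
     (\<integral>z. h z * frac_kernel s z \<partial>lborel)"
proof -
  let ?K = "frac_kernel s :: 'a \<Rightarrow> real"
  have inner: "indicator (- \<Omega>) x * ((\<integral>y. indicator \<Omega> y * ((u x - u y) / norm (x - y) powr (real DIM('a) + 2 * s)) \<partial>lborel) * v x) =
     (\<integral>z. \<psi> x z * ?K z \<partial>lborel)" for x
  proof -
    let ?f = "\<lambda>y. indicator \<Omega> y * ((u x - u y) * ?K (x - y))"
    have "(\<integral>y. indicator \<Omega> y * ((u x - u y) / norm (x - y) powr (real DIM('a) + 2 * s)) \<partial>lborel) = (\<integral>y. ?f y \<partial>lborel)"
      by (simp add: frac_kernel_def)
    also have "\<dots> = (\<integral>z. ?f (z + x) \<partial>lborel)"
      by (rule integral_lborel_translate[symmetric]) measurable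
    also have "\<dots> = (\<integral>z. ?f (- z + x) \<partial>lborel)"
      by (rule integral_lborel_reflect[symmetric]) measurable
    finally show ?thesis
      by (simp add: \<psi>_def mult_ac integral_mult_right_zero[symmetric] del: integral_mult_right_zero integral_mult_left_zero)
  qed
  have Km: "case_prod (\<lambda>x z. \<psi> x z * ?K z) \<in> borel_measurable (lborel \<Otimes>\<^sub>M lborel)"
    by measurable
  have int: "integrable (lborel \<Otimes>\<^sub>M lborel) (case_prod (\<lambda>x z. \<psi> x z * ?K z))"
  proof (rule integrableI_bounded[OF Km])
    have "(\<integral>\<^sup>+p. ennreal (norm (case_prod (\<lambda>x z. \<psi> x z * ?K z) p)) \<partial>(lborel \<Otimes>\<^sub>M lborel)) =
        (\<integral>\<^sup>+z. (\<integral>\<^sup>+x. ennreal (norm (case_prod (\<lambda>x z. \<psi> x z * ?K z) (x, z))) \<partial>lborel) \<partial>lborel)"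
      by (intro lborel_pair.nn_integral_snd[symmetric]) (use Km in measurable)
    also have "\<dots> \<le> (\<integral>\<^sup>+z. ennreal (bound z * ?K z) \<partial>lborel)"
    proof (rule nn_integral_mono)
      fix z :: 'a
      have "(\<integral>\<^sup>+x. ennreal (norm (case_prod (\<lambda>x z. \<psi> x z * ?K z) (x, z))) \<partial>lborel) = (\<integral>\<^sup>+x. ennreal \<bar>\<psi> x z\<bar> * ennreal (?K z) \<partial>lborel)"
        by (intro nn_integral_cong) (simp add: abs_mult ennreal_mult)
      also have "\<dots> = (\<integral>\<^sup>+x. ennreal \<bar>\<psi> x z\<bar> \<partial>lborel) * ennreal (?K z)"
        by (intro nn_integral_multc) measurable
      also have "\<dots> \<le> ennreal (bound z) * ennreal (?K z)"
        by (intro mult_right_mono nn_integral_\<psi>) simp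
      also have "\<dots> = ennreal (bound z * ?K z)" using bound_nonneg by (simp add: ennreal_mult)
      finally show "(\<integral>\<^sup>+x. ennreal (norm (case_prod (\<lambda>x z. \<psi> x z * ?K z) (x, z))) \<partial>lborel) \<le> ennreal (bound z * ?K z)" .
    qed
    also have "\<dots> < \<infinity>"
    proof -
      have "integrable lborel (\<lambda>z. bound z * ?K z)"
        using bound_le bound_nonneg by (intro integrable_times_frac_kernel[OF s]) auto
      then have "(\<integral>\<^sup>+z. ennreal (norm (bound z * ?K z)) \<partial>lborel) < \<infinity>" by (simp only: integrable_iff_bounded)
      then show ?thesis using bound_nonneg by simp
    qed
    finally show "(\<integral>\<^sup>+p. ennreal (norm (case_prod (\<lambda>x z. \<psi> x z * ?K z) p)) \<partial>(lborel \<Otimes>\<^sub>M lborel)) < \<infinity>" .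
  qed
  have "(\<integral>x. (\<integral>z. \<psi> x z * ?K z \<partial>lborel) \<partial>lborel) = (\<integral>z. (\<integral>x. \<psi> x z * ?K z \<partial>lborel) \<partial>lborel)"
    using lborel_pair.Fubini_integral[OF int] by simp
  also have "\<dots> = (\<integral>z. h z * ?K z \<partial>lborel)" by (simp add: h_def)
  finally show ?thesis unfolding inner .
qed

end

theorem proposition5p1:
  fixes \<Omega> :: "(real ^ 'n) set" and u v :: "real ^ 'n \<Rightarrow> real" and k :: 'n
  assumes "bounded_lipschitz_domain \<Omega>"
    and "C2_compact_support u" and "C2_compact_support v"
  shows "((\<lambda>s. LINT x:(- \<Omega>)|lborel. nonlocal_normal_derivative k \<Omega> s u x * v x) \<longlongrightarrow>
           (LINT x:frontier \<Omega>|surface_measure \<Omega>. normal_derivative \<Omega> u x * v x))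
         (at 1 within {0<..<1})"
proof -
  have o: "open \<Omega>" "bounded \<Omega>" using assms(1) by (auto simp: bounded_lipschitz_domain_def)
  obtain Gu Hu Bu Ru where Bu: "0 \<le> Bu" and Gu: "\<And>x. GDERIV u x :> Gu x"
    and Hu: "\<And>x. (Gu has_derivative blinfun_apply (Hu x)) (at x)" "continuous_on UNIV Hu"
    and bu: "\<And>x. norm (Hu x) \<le> Bu" "\<And>x. norm (Gu x) \<le> Bu" "\<And>x. \<bar>u x\<bar> \<le> Bu"
      "\<And>x y. norm (Gu x - Gu y) \<le> Bu * norm (x - y)" "\<And>x y. \<bar>u x - u y\<bar> \<le> Bu * norm (x - y)"
      "\<And>x z. \<bar>u (x + z) - u x - z \<bullet> Gu x\<bar> \<le> Bu * (norm z)\<^sup>2"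
    by (rule C2_compact_support_bounds[OF assms(2)]) blast
  obtain Gv Hv Bv Rv where Bv: "0 \<le> Bv" and Gv: "\<And>x. GDERIV v x :> Gv x"
    and Hv: "\<And>x. (Gv has_derivative blinfun_apply (Hv x)) (at x)"
    and bv: "\<And>x. norm (Gv x) \<le> Bv" "\<And>x. \<bar>v x\<bar> \<le> Bv" "\<And>x y. \<bar>v x - v y\<bar> \<le> Bv * norm (x - y)"
    and Rv: "\<And>x. norm x > Rv \<Longrightarrow> v x = 0"
    by (rule C2_compact_support_bounds[OF assms(3)]) blast
  obtain C where C: "0 \<le> C" "\<And>z. emeasure lborel {y \<in> \<Omega>. y + z \<notin> \<Omega>} \<le> ennreal (C * norm z)"
    using exit_measure_bound[OF assms(1)] by blast
  define B where "B = Bu + Bv"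
  have B: "0 \<le> B" "Bu \<le> B" "Bv \<le> B" using Bu Bv by (auto simp: B_def)
  have uc: "continuous_on A u" and vc: "continuous_on A v" and Guc: "continuous_on A Gu" and Gvc: "continuous_on A Gv" for A
    using Gu Gv Hu(1) Hv
    by (auto intro!: continuous_at_imp_continuous_on has_derivative_continuous simp: gderiv_def)
  interpret nonlocal_pair \<Omega> u v Gu B C
  proof
    have m: "a * r \<le> B * r" if "a \<le> B" "0 \<le> r" for a r using that by (rule mult_right_mono)
    show "\<bar>u x\<bar> \<le> B" "\<bar>v x\<bar> \<le> B" "norm (Gu x) \<le> B" for x
      using bu(3)[of x] bv(2)[of x] bu(2)[of x] B by linarith+
    show "\<bar>u x - u y\<bar> \<le> B * norm (x - y)" "\<bar>v x - v y\<bar> \<le> B * norm (x - y)" for x y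
      using bu(5)[of x y] bv(3)[of x y] m[OF B(2), of "norm (x - y)"] m[OF B(3), of "norm (x - y)"] by auto
    show "\<bar>u (x + z) - u x - z \<bullet> Gu x\<bar> \<le> B * (norm z)\<^sup>2" for x z
      using bu(6)[of x z] m[OF B(2), of "(norm z)\<^sup>2"] by auto
  qed (use o B C uc vc Guc in \<open>auto intro: borel_measurable_continuous_onI\<close>)
  define W where "W x = v x *\<^sub>R Gu x" for x
  \<comment> \<open>The product rule for v grad u, with \<open>Hu\<close> the derivative of the
    gradient of u.\<close>
  define DW where "DW x t = v x *\<^sub>R blinfun_apply (Hu x) t + (t \<bullet> Gv x) *\<^sub>R Gu x" for x t
  have BB: "Bv * Bu + Bv * Bu \<le> 2 * B * B" using B Bu Bv mult_mono[of Bv B Bu B] by (simp add: mult.commute[of Bu Bv])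
  interpret W: lipschitz_field \<Omega> W DW "2 * B * B"
  proof
    show "(W has_derivative DW x) (at x)" for x
      unfolding W_def DW_def using Gv[of x] Hu(1)[of x] unfolding gderiv_def by (rule has_derivative_scaleR)
    show "continuous_on UNIV (\<lambda>x. DW x t)" for t
      unfolding DW_def by (intro continuous_intros vc Guc Gvc Hu(2))
    show "norm (DW x t) \<le> 2 * B * B * norm t" for x t
    proof -
      have "norm (v x *\<^sub>R blinfun_apply (Hu x) t) \<le> Bv * (Bu * norm t)"
        using norm_blinfun[of "Hu x" t] mult_right_mono[OF bu(1)[of x], of "norm t"] bv(2)[of x] Bu Bv
        by (auto intro!: mult_mono)
      moreover have "norm ((t \<bullet> Gv x) *\<^sub>R Gu x) \<le> (norm t * Bv) * Bu"
        using Cauchy_Schwarz_ineq2[of t "Gv x"] mult_left_mono[OF bv(1)[of x], of "norm t"] bu(2)[of x] Bu Bv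
        by (auto intro!: mult_mono)
      ultimately have "norm (DW x t) \<le> (Bv * Bu + Bv * Bu) * norm t"
        unfolding DW_def by (intro order_trans[OF norm_triangle_ineq]) (simp add: algebra_simps)
      also have "\<dots> \<le> 2 * B * B * norm t" by (intro mult_right_mono BB) simp
      finally show ?thesis .
    qed
    show "norm (W x - W y) \<le> 2 * B * B * norm (x - y)" for x y
    proof -
      have "W x - W y = v x *\<^sub>R (Gu x - Gu y) + (v x - v y) *\<^sub>R Gu y" by (simp add: W_def algebra_simps)
      also have "norm \<dots> \<le> Bv * (Bu * norm (x - y)) + (Bv * norm (x - y)) * Bu"
        using bv(2)[of x] bu(4)[of x y] bv(3)[of x y] bu(2)[of y] Bu Bv
        by (intro order_trans[OF norm_triangle_ineq] add_mono) (auto intro!: mult_mono)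
      also have "\<dots> = (Bv * Bu + Bv * Bu) * norm (x - y)" by (simp add: algebra_simps)
      also have "\<dots> \<le> 2 * B * B * norm (x - y)" by (intro mult_right_mono BB) simp
      finally show ?thesis .
    qed
  qed (use o B in auto)
  \<comment> \<open>The basis vector whose inner product with z is the coordinate k in
    \<open>frac_laplace_const\<close>.\<close>
  let ?e = "axis k 1 :: real ^ 'n"
  let ?I = "\<lambda>s. \<integral>z. (1 - cos (z \<bullet> ?e)) * frac_kernel s z \<partial>lborel"
  have e: "?e \<in> Basis" by (simp add: axis_in_Basis_iff)
  \<comment> \<open>Two expansions telescope: h(z) + h(-z) is compared with the integrated increment
    of W, and this in turn with the quadratic form of \<open>W.Q\<close>.\<close>
  have lim: "((\<lambda>z. (h z + h (- z) - (\<Sum>i\<in>Basis. \<Sum>j\<in>Basis. W.Q i j * ((z \<bullet> i) * (z \<bullet> j)))) / (norm z)\<^sup>2) \<longlongrightarrow> 0) (at 0)"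
  proof -
    have "(a - J) / r + (J - q) / r = (a - q) / r" for a J q r :: real
      by (simp add: diff_divide_distrib)
    with tendsto_add[OF h_symmetrised W.quadratic_expansion[unfolded W_def]] show ?thesis by (simp only: add_0)
  qed
  have "((\<lambda>s. inverse (?I s) * (\<integral>z. h z * frac_kernel s z \<partial>lborel)) \<longlongrightarrow> (\<Sum>i\<in>Basis. W.Q i i)) (at 1 within {0<..<1})"
    using h_le bound_le by (intro frac_kernel_limit[OF e h_measurable _ _ lim]) (auto intro: order_trans)
  also have "(\<Sum>i\<in>Basis. W.Q i i) = (\<integral>y. indicator (frontier \<Omega>) y * (W y \<bullet> exterior_normal \<Omega> y) \<partial>surface_measure \<Omega>)"
    by (rule W.divergence_theorem[OF assms(1), of Rv]) (simp add: W_def Rv)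
  also have "\<dots> = (LINT x:frontier \<Omega>|surface_measure \<Omega>. normal_derivative \<Omega> u x * v x)"
    unfolding set_lebesgue_integral_def
    by (simp add: W_def normal_derivative_def gradient_eq[OF Gu] mult_ac)
  finally show ?thesis
  proof (rule Lim_transform_eventually)
    have "\<forall>\<^sub>F s in at 1 within {0<..<1}. s \<in> {0<..<1::real}" by (simp add: eventually_at_filter)
    then show "\<forall>\<^sub>F s in at 1 within {0<..<1}. inverse (?I s) * (\<integral>z. h z * frac_kernel s z \<partial>lborel) =
        (LINT x:(- \<Omega>)|lborel. nonlocal_normal_derivative k \<Omega> s u x * v x)"
    proof eventually_elim
      case (elim s)
      have c: "frac_laplace_const k s = inverse (?I s)"
        by (simp add: frac_laplace_const_def frac_kernel_def inner_axis)
      have "(LINT x:(- \<Omega>)|lborel. nonlocal_normal_derivative k \<Omega> s u x * v x) =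
         (\<integral>x. frac_laplace_const k s * (indicator (- \<Omega>) x * ((\<integral>y. indicator \<Omega> y * ((u x - u y) / norm (x - y) powr (real DIM(real ^ 'n) + 2 * s)) \<partial>lborel) * v x)) \<partial>lborel)"
        unfolding set_lebesgue_integral_def nonlocal_normal_derivative_def by (simp add: mult_ac)
      also have "\<dots> = frac_laplace_const k s * (\<integral>z. h z * frac_kernel s z \<partial>lborel)"
        using nonlocal_eq_kernel[of s] elim by simp
      finally show ?case unfolding c ..
    qed
  qed
qed

end
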